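(* Let $\mathcal H\subset\mathbb R^2$ be a nonempty bounded open set with $B_2(0)\subset\mathcal H\subset B_{\mathcal R}(0)$ for some $\mathcal R\in(2,\infty)$. Let $J\in C^2_c(\mathbb R^2)$ be radially symmetric with $J(x)>0$ if $|x|<d$, $J(x)=0$ if $|x|\ge d$ (for some $d>0$), and $\int_{\mathbb R^2}J=1$. Let $u_0\ge0$ with $u_0=0$ in $\mathcal H$, $u_0\in L^\infty(\mathbb R^2)$, $u_0\in L^1(\mathbb R^2,\log|x|\,dx)$ and $u_0\in L^1(\mathbb R^2,|x|^2\,dx)$. Let $u$ be the solution of the nonlocal exterior problem with hole $\mathcal H$ and initial datum $u_0$. Then both of the following limits exist and $$\lim_{t\to\infty}\log t\int_{\mathbb R^2}u(x,t)\,dx=\lim_{t\to\infty}2\int_{\mathbb R^2}u(x,t)\log|x|\,dx.$$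
   Context: $L$ is the operator $Lg:=J*g-g$. The solution $u\in C([0,\infty);L^1(\mathbb R^2))$ is the unique solution of: $\partial_tu=Lu$ in $(\mathbb R^2\setminus\mathcal H)\times(0,\infty)$, $u=0$ in $\mathcal H\times(0,\infty)$, $u(\cdot,0)=u_0$ in $\mathbb R^2$. *)

theory Defs
  imports "HOL-Analysis.Analysis"
begin

definition C2_on_space :: "('a::euclidean_space \<Rightarrow> real) \<Rightarrow> bool" where
  "C2_on_space f \<longleftrightarrow>
     (\<exists>(f' :: 'a \<Rightarrow> 'a \<Rightarrow>\<^sub>L real) (f'' :: 'a \<Rightarrow> 'a \<Rightarrow>\<^sub>L ('a \<Rightarrow>\<^sub>L real)).
        (\<forall>x. (f has_derivative blinfun_apply (f' x)) (at x)) \<and>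
        (\<forall>x. (f' has_derivative blinfun_apply (f'' x)) (at x)) \<and>
        continuous_on UNIV f'')"

definition compactly_supported :: "('a::euclidean_space \<Rightarrow> real) \<Rightarrow> bool" where
  "compactly_supported f \<longleftrightarrow> compact (closure {x. f x \<noteq> 0})"

definition radially_symmetric :: "('a::euclidean_space \<Rightarrow> real) \<Rightarrow> bool" where
  "radially_symmetric f \<longleftrightarrow> (\<forall>x y. norm x = norm y \<longrightarrow> f x = f y)"

definition Linfty :: "('a::euclidean_space \<Rightarrow> real) \<Rightarrow> bool" where
  "Linfty f \<longleftrightarrow> f \<in> borel_measurable lebesgue \<and> (\<exists>C. AE x in lebesgue. \<bar>f x\<bar> \<le> C)"

definition convolution ::
    "('a::euclidean_space \<Rightarrow> real) \<Rightarrow> ('a \<Rightarrow> real) \<Rightarrow> 'a \<Rightarrow> real" where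
  "convolution J g x = (LINT y|lebesgue. J (x - y) * g y)"

definition nonlocal_op ::
    "('a::euclidean_space \<Rightarrow> real) \<Rightarrow> ('a \<Rightarrow> real) \<Rightarrow> 'a \<Rightarrow> real" where
  "nonlocal_op J g x = convolution J g x - g x"

text \<open>
  Here \<open>u t\<close> stands for \<open>u(\<cdot>,t)\<close>, a representative of an element of \<open>L\<^sup>1\<close>; only
  times \<open>t \<ge> 0\<close> are relevant.  The first two clauses say \<open>u \<in> C([0,\<infinity>); L\<^sup>1)\<close>.
  The time derivative in the evolution equation is the strong derivative of the
  \<open>L\<^sup>1\<close>-valued map \<open>t \<mapsto> u(\<cdot>,t)\<close>, restricted to the complement of \<open>H\<close>, and the remaining
  identities hold almost everywhere.  Hence the notion does not depend on the chosen
  representatives.  All the Bochner integrals below have integrable integrands as soon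
  as \<open>J\<close> is continuous with compact support, \<open>H\<close> is measurable, the first clause holds and
  (in the third) \<open>h\<close> is close to \<open>0\<close>, so the convention that the integral of a
  non-integrable function is \<open>0\<close> plays no role.
\<close>

definition exterior_solution ::
    "('a::euclidean_space \<Rightarrow> real) \<Rightarrow> 'a set \<Rightarrow> ('a \<Rightarrow> real) \<Rightarrow> (real \<Rightarrow> 'a \<Rightarrow> real) \<Rightarrow> bool" where
  "exterior_solution J H u0 u \<longleftrightarrow>
     (\<forall>t\<ge>0. integrable lebesgue (u t)) \<and>
     (\<forall>t\<ge>0. ((\<lambda>s. LINT x|lebesgue. \<bar>u s x - u t x\<bar>) \<longlongrightarrow> 0) (at t within {0..})) \<and>
     (\<forall>t>0. ((\<lambda>h. LINT x:- H|lebesgue. \<bar>(u (t + h) x - u t x) / h - nonlocal_op J (u t) x\<bar>)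
               \<longlongrightarrow> 0) (at 0)) \<and>
     (\<forall>t>0. AE x in lebesgue. x \<in> H \<longrightarrow> u t x = 0) \<and>
     (AE x in lebesgue. u 0 x = u0 x)"

end

theory Submission
  imports Defs "HOL-Real_Asymp.Real_Asymp"
begin

text \<open>
  By uniqueness \<open>u(t)\<close> is the Poisson mixture, with mean \<open>t\<close>, of the discrete evolution
  \<open>p\<^sub>0 = u\<^sub>0\<close>, \<open>p\<^sub>k\<^sub>+\<^sub>1 = 1\<^bsub>- H\<^esub> (J * p\<^sub>k)\<close>, so it suffices to treat \<open>p\<^sub>k\<close> and to check that Poisson
  averaging preserves the limits.

  A bounded perturbation of \<open>2 log\<bar>x\<bar>\<close> is superharmonic for \<open>J\<close> outside a ball.  The mass that the
  walk puts on a fixed ball is summable in \<open>k\<close>: near the hole a fixed fraction of it is lost at each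
  step, and this propagates outwards.  Hence the integrals of \<open>p\<^sub>k\<close> against the perturbed logarithm
  converge.  As the logarithm is unbounded, the total mass tends to \<open>0\<close>, and the perturbation does not
  affect the limit.

  A Nash inequality gives \<open>\<parallel>p\<^sub>k\<parallel>\<^sub>2\<^sup>2 = o(1 / k)\<close>, and the second moment of \<open>p\<^sub>k\<close> is \<open>o(k)\<close>, both because
  the mass tends to \<open>0\<close>.  So \<open>log\<bar>x\<bar>\<^sup>2\<close> may be replaced by \<open>log k\<close> in the integral against \<open>p\<^sub>k\<close>.
\<close>

section \<open>Sequences and Poisson averages\<close>

text \<open>Scale-invariant bounds, \<open>O(1 / k)\<close> for the energy and \<open>O(k)\<close>
  for the second moment, would not be enough. Trading the logarithm for
  \<open>ln (real (Suc k))\<close> costs a multiple of \<open>sqrt (real (Suc k) * energy k)\<close>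
  on one side and essentially \<open>second_moment k / real (Suc k)\<close> on the other, and both
  must vanish, not merely stay bounded. So the decay of the mass has to be known beforehand, and it
  must come from the hole alone: bounded moments of an unbounded barrier, plus summable mass on
  balls. An inequality for the barrier up to a summable error already yields a limit, so no exactly
  \<open>J\<close>-harmonic function has to be constructed and the value of the limit is never
  identified. In the continuous problem \<open>L\<close> is a bounded operator; after multiplication
  by \<open>exp t\<close> the killed evolution is a power series in one killed step. The equation
  holds in the \<open>L^1\<close> sense and can be paired only with bounded functions, while the
  logarithm is unbounded. Hence \<open>u t\<close> is first identified as a function, by means of
  bounded test functions, and only then integrated against the logarithm.\<close>

lemma nash_one_step:
  fixes a a' K :: real
  assumes a: "0 < a" and K: "0 \<le> K"
    and step: "\<And>m::nat. 0 < m \<Longrightarrow> a' \<le> a - (a - K / (4 * (real m)\<^sup>2)) / (2 * (real m)\<^sup>2)"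
  shows "a' \<le> a - a\<^sup>2 / (4 * K + 8 * a)"
proof -
  \<comment> \<open>The smallest scale, up to rounding, at which the error
    \<open>K / (4 m^2)\<close> is at most half of \<open>a\<close>. Rounding up gives
    \<open>m^2 \<le> K / a + 2\<close>, whence the term \<open>8 * a\<close> in the
    denominator.\<close>
  define s where "s = sqrt (K / (2 * a))"
  define m where "m = nat \<lfloor>s\<rfloor> + 1"
  have s0: "0 \<le> s" and s2: "s\<^sup>2 = K / (2 * a)"
    using a K by (auto simp: s_def)
  have m: "s < real m" "real m \<le> s + 1" "0 < m"
    using s0 unfolding m_def by linarith+
  have "s\<^sup>2 \<le> (real m)\<^sup>2"
    using m s0 by (intro power_mono) auto
  then have le: "K / (4 * (real m)\<^sup>2) \<le> a / 2"
    using a m(3) s2 by (simp add: field_simps)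
  have "(real m)\<^sup>2 \<le> (s + 1)\<^sup>2"
    using m by (intro power_mono) auto
  also have "\<dots> \<le> 2 * s\<^sup>2 + 2"
    using sum_squares_bound[of s 1] by (simp add: power2_eq_square algebra_simps)
  finally have m2: "(real m)\<^sup>2 \<le> K / a + 2"
    using s2 by simp
  have "a' \<le> a - (a - K / (4 * (real m)\<^sup>2)) / (2 * (real m)\<^sup>2)"
    by (rule step[OF m(3)])
  also have "\<dots> \<le> a - (a / 2) / (2 * (real m)\<^sup>2)"
    using le by (intro diff_left_mono divide_right_mono) auto
  also have "\<dots> = a - a / (4 * (real m)\<^sup>2)"
    by simp
  also have "\<dots> \<le> a - a / (4 * (K / a + 2))"
    using m2 m(3) a K by (intro diff_left_mono divide_left_mono mult_pos_pos) (auto intro: add_nonneg_pos)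
  also have "a / (4 * (K / a + 2)) = a\<^sup>2 / (4 * K + 8 * a)"
    using a by (simp add: field_simps power2_eq_square)
  finally show ?thesis .
qed

text \<open>For \<open>a = 0\<close> no finite scale is optimal; the bound follows by letting
  \<open>m\<close> tend to infinity.\<close>

lemma nash_zero_step:
  fixes a' K :: real
  assumes step: "\<And>m::nat. 0 < m \<Longrightarrow> a' \<le> 0 - (0 - K / (4 * (real m)\<^sup>2)) / (2 * (real m)\<^sup>2)"
  shows "a' \<le> 0"
proof (rule tendsto_lowerbound)
  show "((\<lambda>m::nat. K / (4 * (real m)\<^sup>2) / (2 * (real m)\<^sup>2)) \<longlongrightarrow> 0) sequentially"
    by real_asymp
  show "\<forall>\<^sub>F m::nat in sequentially. a' \<le> K / (4 * (real m)\<^sup>2) / (2 * (real m)\<^sup>2)"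
    by (rule eventually_mono[OF eventually_gt_at_top[of 0]]) (use step in auto)
qed simp

text \<open>Nash's differential inequality \<open>a' \<le> - a\<^sup>2 / D\<close> in discrete time, restarted at time \<open>n\<close>.\<close>

lemma nash_decay:
  fixes a M :: "nat \<Rightarrow> real"
  assumes a: "\<And>k. 0 \<le> a k" and M: "\<And>k. 0 \<le> M k" "decseq M" and B: "0 \<le> B"
    and step: "\<And>k m. 0 < m \<Longrightarrow>
      a (Suc k) \<le> a k - (a k - B * (M k)\<^sup>2 / (4 * (real m)\<^sup>2)) / (2 * (real m)\<^sup>2)"
  shows "real j * a (n + j) \<le> 4 * B * (M n)\<^sup>2 + 8 * a n" and "decseq a"
proof -
  have one: "a (Suc k) \<le> a k - (a k)\<^sup>2 / (4 * (B * (M k)\<^sup>2) + 8 * a k)" for k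
  proof (cases "a k = 0")
    case True
    then show ?thesis
      using nash_zero_step[of "a (Suc k)" "B * (M k)\<^sup>2"] step[of _ k] by simp
  next
    case False
    then show ?thesis
      using nash_one_step[of "a k" "B * (M k)\<^sup>2" "a (Suc k)"] step[of _ k] a[of k] B by simp
  qed
  have le: "a (Suc k) \<le> a k" for k
  proof -
    have "0 \<le> (a k)\<^sup>2 / (4 * (B * (M k)\<^sup>2) + 8 * a k)"
      using a[of k] B by simp
    then show ?thesis using one[of k] by linarith
  qed
  then show dec: "decseq a"
    by (simp add: decseq_SucI)
  \<comment> \<open>Mass and energy both decrease, so this value at time \<open>n\<close> bounds the
    denominators at all later times.\<close>
  define D where "D = 4 * B * (M n)\<^sup>2 + 8 * a n"
  have D0: "0 \<le> D"
    using a[of n] B by (simp add: D_def)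
  have "real j * a (n + j) \<le> D"
  proof (cases "D = 0")
    case True
    then have "a n = 0"
      using a[of n] B by (simp add: D_def add_nonneg_eq_0_iff)
    then have "a (n + j) = 0"
      using decseqD[OF dec, of n "n + j"] a[of "n + j"] by simp
    then show ?thesis using D0 by simp
  next
    case False
    then have D: "D > 0" using D0 by simp
    show ?thesis
    proof (induction j)
      case (Suc j)
      let ?x = "a (n + j)"
      have x: "0 \<le> ?x" "?x \<le> a n"
        using a decseqD[OF dec, of n "n + j"] by auto
      have xD: "?x \<le> D"
      proof -
        have "0 \<le> 4 * B * (M n)\<^sup>2" using B by simp
        then show ?thesis using x a[of n] unfolding D_def by linarith
      qed
      have "(M (n + j))\<^sup>2 \<le> (M n)\<^sup>2"
        using decseqD[OF M(2), of n "n + j"] M(1) by (intro power_mono) auto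
      then have "4 * (B * (M (n + j))\<^sup>2) + 8 * ?x \<le> D"
        using x B mult_left_mono[of "(M (n + j))\<^sup>2" "(M n)\<^sup>2" B] by (simp add: D_def)
      moreover have "0 \<le> B * (M (n + j))\<^sup>2" using B by simp
      ultimately have "?x\<^sup>2 / D \<le> ?x\<^sup>2 / (4 * (B * (M (n + j))\<^sup>2) + 8 * ?x)"
        using x(1) D by (cases "?x = 0") (auto intro!: divide_left_mono mult_pos_pos add_nonneg_pos)
      then have "a (Suc (n + j)) \<le> ?x - ?x\<^sup>2 / D"
        using one[of "n + j"] by linarith
      \<comment> \<open>Discrete form of the fact that \<open>1 / a\<close> grows by at least
        \<open>1 / D\<close> per step: from \<open>j x \<le> D\<close> one gets
        \<open>(j x + x)(1 - x / D) \<le> (D + x)(1 - x / D) = D - x^2 / D\<close>.\<close>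
      then have "real (Suc j) * a (Suc (n + j)) \<le> real (Suc j) * (?x - ?x\<^sup>2 / D)"
        by (rule mult_left_mono) simp
      also have "\<dots> = (real j * ?x + ?x) * (1 - ?x / D)"
        by (simp add: power2_eq_square algebra_simps add_divide_distrib)
      also have "\<dots> \<le> (D + ?x) * (1 - ?x / D)"
        using Suc xD D by (intro mult_right_mono) auto
      also have "\<dots> = D - ?x * ?x / D"
        using D by (simp add: field_simps)
      also have "\<dots> \<le> D"
        using D x by simp
      finally show ?case by simp
    qed (use D0 in simp)
  qed
  then show "real j * a (n + j) \<le> 4 * B * (M n)\<^sup>2 + 8 * a n"
    by (simp add: D_def)
qed

text \<open>A Cesaro argument, meant for the second moment, whose increments are at most a multiple
  of the mass.\<close>

lemma linear_growth_sublinear: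
  fixes S M :: "nat \<Rightarrow> real"
  assumes S: "\<And>k. 0 \<le> S k" and M: "M \<longlonglongrightarrow> 0" and step: "\<And>k. S (Suc k) \<le> S k + M k"
  shows "(\<lambda>k. S k / real (Suc k)) \<longlonglongrightarrow> 0"
proof (rule LIMSEQ_I)
  fix r :: real assume r: "0 < r"
  obtain N where "\<forall>k\<ge>N. norm (M k - 0) < r / 2"
    using LIMSEQ_D[OF M, of "r / 2"] r by auto
  then have N: "M k < r / 2" if "k \<ge> N" for k
    using that abs_ge_self[of "M k"] by fastforce
  have lin: "S (N + j) \<le> S N + real j * (r / 2)" for j
  proof (induction j)
    case (Suc j)
    have "S (Suc (N + j)) \<le> S N + real j * (r / 2) + r / 2"
      using Suc step[of "N + j"] N[of "N + j"] by linarith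
    then show ?case
      by (simp add: distrib_right add_divide_distrib)
  qed simp
  obtain N' :: nat where N': "2 * S N / r < real N'"
    using reals_Archimedean2 by blast
  have "norm (S k / real (Suc k) - 0) < r" if k: "k \<ge> N + N'" for k
  proof -
    have "S k \<le> S N + real (k - N) * (r / 2)"
      using lin[of "k - N"] k by simp
    also have "\<dots> \<le> S N + real k * (r / 2)"
      using r by (intro add_left_mono mult_right_mono) auto
    also have "S N \<le> real N' * (r / 2)"
      using N' r by (simp add: field_simps)
    also have "real N' * (r / 2) + real k * (r / 2) \<le> real k * r"
      using k r by (simp add: field_simps mult_left_mono)
    also have "\<dots> < r * real (Suc k)"
      using r by (simp add: algebra_simps)
    finally have "S k < r * real (Suc k)" by simp
    then show ?thesis
      using S[of k] by (simp add: pos_divide_less_eq del: of_nat_Suc)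
  qed
  then show "\<exists>no. \<forall>n\<ge>no. norm (S n / real (Suc n) - 0) < r" by blast
qed

text \<open>The number of powers \<open>4 ^ j\<close> below \<open>z\<close> is at least
  \<open>ln z / ln 4\<close>, and \<open>ln 4 \<le> 2\<close>. This turns a logarithm into a sum of
  indicators; base 4 fits because \<open>z\<close> will be a ratio of squared lengths, so that the
  radii halve.\<close>

lemma ln_le_dyadic_count:
  fixes z :: real
  assumes "0 < z"  "z \<le> 4 ^ N"
  shows "ln z \<le> 2 * (\<Sum>j\<le>N. of_bool (4 ^ j \<le> z))"
  using assms
proof (induction N arbitrary: z)
  case (Suc N)
  show ?case
  proof (cases "z \<le> 1")
    case True
    then have "ln z \<le> 0" using Suc.prems by simp
    also have "0 \<le> 2 * (\<Sum>j\<le>Suc N. of_bool (4 ^ j \<le> z) :: real)"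
      by (simp add: sum_nonneg)
    finally show ?thesis .
  next
    case False
    have "ln (4::real) \<le> 2"
      using ln_le_minus_one[of "2::real"] ln_mult[of 2 "2::real"] by simp
    moreover have "ln (z / 4) \<le> 2 * (\<Sum>j\<le>N. of_bool (4 ^ j \<le> z / 4))"
      using Suc.prems by (intro Suc.IH) auto
    moreover have "(\<Sum>j\<le>Suc N. of_bool (4 ^ j \<le> z) :: real) = 1 + (\<Sum>j\<le>N. of_bool (4 ^ j \<le> z / 4))"
      using False by (subst sum.atMost_Suc_shift) (simp add: mult.commute field_simps)
    ultimately show ?thesis
      using Suc.prems by (simp add: ln_div)
  qed
qed simp

section \<open>Poisson weights and averages\<close>

definition poisson :: "real \<Rightarrow> nat \<Rightarrow> real" where
  "poisson t k = exp (- t) * (t ^ k / fact k)"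

definition poisson_mean :: "real \<Rightarrow> (nat \<Rightarrow> real) \<Rightarrow> real" where
  "poisson_mean t x = (\<Sum>k. poisson t k * x k)"

lemma poisson_nonneg: "0 \<le> t \<Longrightarrow> 0 \<le> poisson t k"
  by (simp add: poisson_def)

lemma poisson_sums: "poisson t sums 1"
proof -
  have "(\<lambda>k. t ^ k / fact k) sums exp t"
    using exp_converges[of t] by (simp add: field_simps)
  moreover have "exp (- t) * exp t = 1"
    by (simp add: exp_minus)
  ultimately show ?thesis
    using sums_mult[of "\<lambda>k. t ^ k / fact k" "exp t" "exp (- t)"] by (simp add: poisson_def[abs_def])
qed

lemma poisson_Suc: "t \<noteq> 0 \<Longrightarrow> poisson t (Suc k) * (real (Suc k) / t) = poisson t k"
  by (simp add: poisson_def)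

lemma summable_poisson_bounded:
  assumes t: "0 \<le> t" and x: "\<And>k. \<bar>x k\<bar> \<le> C"
  shows "summable (\<lambda>k. poisson t k * x k)"
proof (rule summable_comparison_test')
  show "summable (\<lambda>k. poisson t k * C)"
    using poisson_sums by (intro summable_mult2) (rule sums_summable)
  show "norm (poisson t k * x k) \<le> poisson t k * C" for k
    using x[of k] poisson_nonneg[OF t, of k] by (simp add: abs_mult mult_left_mono)
qed

lemma poisson_mean_const: "poisson_mean t (\<lambda>_. c) = c"
  using sums_mult2[OF poisson_sums, of t c] by (simp add: poisson_mean_def sums_iff)

lemma poisson_tendsto_0: "((\<lambda>t. poisson t k) \<longlongrightarrow> 0) at_top"
proof -
  have "((\<lambda>t::real. t ^ k / exp t) \<longlongrightarrow> 0) at_top"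
    by (rule tendsto_power_div_exp_0)
  then have "((\<lambda>t::real. (t ^ k / exp t) / fact k) \<longlongrightarrow> 0 / fact k) at_top"
    by (intro tendsto_divide tendsto_const) auto
  then show ?thesis
    by (simp add: poisson_def[abs_def] exp_minus field_simps)
qed

text \<open>Toeplitz summation: the weights have sum 1, and each single weight vanishes as
  \<open>t\<close> grows, so any finite initial segment becomes negligible.\<close>

lemma poisson_mean_tendsto_0:
  assumes x: "x \<longlonglongrightarrow> 0"
  shows "((\<lambda>t. poisson_mean t x) \<longlongrightarrow> 0) at_top"
proof (rule tendstoI)
  fix e :: real assume e: "0 < e"
  obtain N where N: "\<And>k. k \<ge> N \<Longrightarrow> \<bar>x k\<bar> < e / 2"
    using LIMSEQ_D[OF x, of "e / 2"] e by auto
  obtain C where C: "\<And>k. \<bar>x k\<bar> \<le> C"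
    using Bseq_def convergent_imp_Bseq convergentI[OF x] by (metis real_norm_def)
  have "((\<lambda>t. \<Sum>k<N. poisson t k * C) \<longlongrightarrow> (\<Sum>k<N. 0 * C)) at_top"
    by (intro tendsto_sum tendsto_mult tendsto_const poisson_tendsto_0)
  then have "\<forall>\<^sub>F t in at_top. (\<Sum>k<N. poisson t k * C) < e / 2"
    using e by (intro order_tendstoD(2)[where a = "e / 2"]) auto
  then show "\<forall>\<^sub>F t in at_top. dist (poisson_mean t x) 0 < e"
    using eventually_ge_at_top[of 0]
  proof eventually_elim
    case (elim t)
    have s: "summable (\<lambda>k. poisson t k * x k)" "summable (\<lambda>k. poisson t k * \<bar>x k\<bar>)"
      "summable (\<lambda>k. poisson t k * (if k < N then C else 0))" "summable (\<lambda>k. poisson t k * (e / 2))"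
      using elim(2) C order_trans[OF abs_ge_zero C] by (auto intro!: summable_poisson_bounded[where C = C]
          summable_mult2 sums_summable[OF poisson_sums])
    have "\<bar>poisson_mean t x\<bar> \<le> (\<Sum>k. poisson t k * \<bar>x k\<bar>)"
      using summable_rabs[of "\<lambda>k. poisson t k * x k"] s(2) poisson_nonneg[OF elim(2)]
      by (simp add: poisson_mean_def abs_mult)
    also have "\<dots> \<le> (\<Sum>k. poisson t k * (if k < N then C else 0) + poisson t k * (e / 2))"
    proof (rule suminf_le)
      fix k
      have "\<bar>x k\<bar> \<le> (if k < N then C else 0) + e / 2"
        using C[of k] N[of k] e by (auto simp: not_less less_imp_le)
      from mult_left_mono[OF this poisson_nonneg[OF elim(2), of k]]
      show "poisson t k * \<bar>x k\<bar> \<le> poisson t k * (if k < N then C else 0) + poisson t k * (e / 2)"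
        by (simp add: algebra_simps)
    qed (rule s(2) summable_add[OF s(3) s(4)])+
    also have "\<dots> = (\<Sum>k. poisson t k * (if k < N then C else 0)) + (\<Sum>k. poisson t k * (e / 2))"
      by (rule suminf_add[symmetric]) (use s in auto)
    also have "(\<Sum>k. poisson t k * (e / 2)) = e / 2"
      using poisson_mean_const[of t "e / 2"] by (simp add: poisson_mean_def)
    also have "(\<Sum>k. poisson t k * (if k < N then C else 0)) = (\<Sum>k<N. poisson t k * C)"
      by (subst suminf_finite[of "{..<N}"]) (auto intro!: sum.cong)
    finally show ?case
      using elim(1) by simp
  qed
qed

lemma poisson_mean_add:
  assumes "0 \<le> t" "\<And>k. \<bar>x k\<bar> \<le> C" "\<And>k. \<bar>y k\<bar> \<le> D"
  shows "poisson_mean t (\<lambda>k. x k + y k) = poisson_mean t x + poisson_mean t y"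
  unfolding poisson_mean_def distrib_left
  by (rule suminf_add[symmetric]) (rule summable_poisson_bounded assms)+

lemma poisson_mean_cmult:
  assumes "0 \<le> t" "\<And>k. \<bar>x k\<bar> \<le> C"
  shows "poisson_mean t (\<lambda>k. c * x k) = c * poisson_mean t x"
  unfolding poisson_mean_def
  using suminf_mult[OF summable_poisson_bounded[where x = x, OF assms], of c] by (simp add: mult_ac)

lemma LIMSEQ_bounded:
  fixes x :: "nat \<Rightarrow> real"
  assumes "x \<longlonglongrightarrow> l"
  obtains C where "\<And>k. \<bar>x k\<bar> \<le> C"
  using convergent_imp_Bseq[OF convergentI[OF assms]] by (auto simp: Bseq_def)

lemma poisson_mean_tendsto:
  assumes x: "x \<longlonglongrightarrow> l"
  shows "((\<lambda>t. poisson_mean t x) \<longlongrightarrow> l) at_top"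
proof -
  have y: "(\<lambda>k. x k - l) \<longlonglongrightarrow> 0"
    using tendsto_diff[OF x tendsto_const[of l]] by simp
  obtain C where C: "\<And>k. \<bar>x k - l\<bar> \<le> C"
    using LIMSEQ_bounded[OF y] by blast
  have "((\<lambda>t. poisson_mean t (\<lambda>k. x k - l) + l) \<longlongrightarrow> 0 + l) at_top"
    by (intro tendsto_add poisson_mean_tendsto_0 y tendsto_const)
  moreover have "\<forall>\<^sub>F t in at_top. poisson_mean t (\<lambda>k. x k - l) + l = poisson_mean t x"
    using eventually_ge_at_top[of 0]
  proof eventually_elim
    case (elim t)
    show ?case
      using poisson_mean_add[OF elim C, of "\<lambda>_. l" "\<bar>l\<bar>"] by (simp add: poisson_mean_const)
  qed
  ultimately show ?thesis
    using tendsto_cong[of _ _ at_top] by force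
qed

text \<open>Under the Poisson law of large mean \<open>t\<close> the index is comparable to \<open>t\<close>: both
  \<open>(k + 1) / t\<close> and \<open>t / (k + 1)\<close> are absorbed by a shift of the index.\<close>

lemma poisson_mean_log:
  assumes M: "M \<longlonglongrightarrow> 0" and lM: "(\<lambda>k. ln (real (Suc k)) * M k) \<longlonglongrightarrow> l"
  shows "((\<lambda>t. ln t * poisson_mean t M) \<longlongrightarrow> l) at_top"
proof -
  obtain C where C: "\<And>k. \<bar>M k\<bar> \<le> C"
    using LIMSEQ_bounded[OF M] by blast
  obtain D where D: "\<And>k. \<bar>ln (real (Suc k)) * M k\<bar> \<le> D"
    using LIMSEQ_bounded[OF lM] by blast
  let ?A = "\<lambda>k. \<bar>M k\<bar>"
  \<comment> \<open>The value at index 0 is a filler: the shifted series has no term there.\<close>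
  let ?B = "\<lambda>k. case k of 0 \<Rightarrow> 0 | Suc j \<Rightarrow> \<bar>M j\<bar>"
  have A: "?A \<longlonglongrightarrow> 0"
    using tendsto_rabs[OF M] by simp
  have A': "(\<lambda>k. ?A (Suc k)) \<longlonglongrightarrow> 0"
    using A by (rule LIMSEQ_Suc)
  have B': "?B \<longlonglongrightarrow> 0"
    by (rule LIMSEQ_imp_Suc) (use A in simp)
  have Cb: "\<bar>?B k\<bar> \<le> C" for k
    using C order_trans[OF abs_ge_zero C] by (auto split: nat.split)
  have bound: "\<bar>poisson_mean t (\<lambda>k. ln (real (Suc k)) * M k) - ln t * poisson_mean t M\<bar>
      \<le> poisson_mean t (\<lambda>k. ?A (Suc k)) + (1 / t) * poisson_mean t ?A + poisson_mean t ?B"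
    if t: "t \<ge> 1" for t
  proof -
    have t0: "0 \<le> t" "t > 0" using t by auto
    have w: "0 \<le> poisson t k" for k using poisson_nonneg[OF t0(1)] .
    let ?g = "\<lambda>k. ln (real (Suc k)) * M k + (- ln t) * M k"
    have sA: "summable (\<lambda>k. poisson t k * ?A k)"
      and sA': "summable (\<lambda>k. poisson t k * ?A (Suc k))"
      and sB: "summable (\<lambda>k. poisson t k * ?B k)"
      by (rule summable_poisson_bounded[OF t0(1), where C = C], use C Cb in simp)+
    \<comment> \<open>The factor \<open>k\<close> cancels against the factorial, and since the term
      with \<open>k = 0\<close> vanishes, the shifted series is the whole one.\<close>
    have s1: "(\<lambda>k. poisson t k * (real k / t * ?A k)) sums poisson_mean t (\<lambda>k. ?A (Suc k))"
    proof -
      have "(\<lambda>k. poisson t (Suc k) * (real (Suc k) / t * ?A (Suc k))) sums poisson_mean t (\<lambda>k. ?A (Suc k))"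
        using summable_sums[OF sA'] poisson_Suc[of t] t0
        by (simp only: poisson_mean_def mult.assoc[symmetric])
      then show ?thesis
        by (subst (asm) sums_Suc_iff) simp
    qed
    have s2: "(\<lambda>k. poisson t k * (t / real (Suc k) * ?A k)) sums poisson_mean t ?B"
    proof -
      have e: "poisson t k * (t / real (Suc k)) = poisson t (Suc k)" for k
        by (simp add: poisson_def mult_ac)
      have "(\<lambda>k. poisson t k * (t / real (Suc k) * ?A k)) = (\<lambda>k. poisson t (Suc k) * ?B (Suc k))"
        by (rule ext) (simp only: mult.assoc[symmetric] e nat.case)
      moreover have "(\<lambda>k. poisson t (Suc k) * ?B (Suc k)) sums poisson_mean t ?B"
        using summable_sums[OF sB] by (subst sums_Suc_iff) (simp add: poisson_mean_def)
      ultimately show ?thesis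
        by simp
    qed
    have s3: "(\<lambda>k. (1 / t) * (poisson t k * ?A k)) sums ((1 / t) * poisson_mean t ?A)"
      unfolding poisson_mean_def by (rule sums_mult[OF summable_sums[OF sA]])
    have main: "(\<lambda>k. poisson t k * ((real k / t + 1 / t + t / real (Suc k)) * ?A k)) sums
        (poisson_mean t (\<lambda>k. ?A (Suc k)) + (1 / t) * poisson_mean t ?A + poisson_mean t ?B)"
      using sums_add[OF sums_add[OF s1 s3] s2] by (simp add: algebra_simps)
    have gb: "\<bar>?g k\<bar> \<le> (real k / t + 1 / t + t / real (Suc k)) * ?A k" for k
    proof -
      \<comment> \<open>Applied to \<open>z = (k + 1) / t\<close>. The resulting pieces
        \<open>k / t\<close>, \<open>1 / t\<close> and \<open>t / (k + 1)\<close> are exactly those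
        summed in \<open>s1\<close>, \<open>s3\<close> and \<open>s2\<close>.\<close>
      have "\<bar>ln z\<bar> \<le> z + 1 / z" if "z > 0" for z :: real
      proof -
        have "ln z \<le> z - 1" "- ln z \<le> 1 / z - 1" "0 < 1 / z"
          using ln_le_minus_one[of z] ln_le_minus_one[of "1 / z"] that ln_div[of 1 z] by auto
        then show ?thesis
          using that by linarith
      qed
      from this[of "real (Suc k) / t"]
      have "\<bar>ln (real (Suc k)) - ln t\<bar> \<le> real k / t + 1 / t + t / real (Suc k)"
        using t0 ln_div[of "real (Suc k)" t] by (simp add: add_divide_distrib del: of_nat_Suc) (simp add: add_divide_distrib)
      then have "\<bar>(ln (real (Suc k)) - ln t) * M k\<bar> \<le> (real k / t + 1 / t + t / real (Suc k)) * ?A k"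
        by (simp only: abs_mult) (rule mult_right_mono, auto)
      then show ?thesis by (simp add: algebra_simps)
    qed
    have le: "\<bar>poisson t k * ?g k\<bar> \<le> poisson t k * ((real k / t + 1 / t + t / real (Suc k)) * ?A k)" for k
      using mult_left_mono[OF gb[of k] w[of k]] w[of k] by (simp only: abs_mult abs_of_nonneg)
    have sabs: "summable (\<lambda>k. \<bar>poisson t k * ?g k\<bar>)"
      by (rule summable_comparison_test'[OF sums_summable[OF main]]) (use le in simp)
    have "poisson_mean t ?g = poisson_mean t (\<lambda>k. ln (real (Suc k)) * M k) + poisson_mean t (\<lambda>k. (- ln t) * M k)"
    proof (rule poisson_mean_add[OF t0(1) D])
      show "\<bar>(- ln t) * M k\<bar> \<le> \<bar>ln t\<bar> * C" for k
        using C[of k] by (simp add: abs_mult mult_left_mono)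
    qed
    also have "poisson_mean t (\<lambda>k. (- ln t) * M k) = - ln t * poisson_mean t M"
      by (rule poisson_mean_cmult[OF t0(1) C])
    finally have "\<bar>poisson_mean t (\<lambda>k. ln (real (Suc k)) * M k) - ln t * poisson_mean t M\<bar> = \<bar>poisson_mean t ?g\<bar>"
      by simp
    also have "\<dots> \<le> (\<Sum>k. \<bar>poisson t k * ?g k\<bar>)"
      unfolding poisson_mean_def by (rule summable_rabs[OF sabs])
    also have "\<dots> \<le> (\<Sum>k. poisson t k * ((real k / t + 1 / t + t / real (Suc k)) * ?A k))"
      by (rule suminf_le[OF le sabs sums_summable[OF main]])
    also have "\<dots> = poisson_mean t (\<lambda>k. ?A (Suc k)) + (1 / t) * poisson_mean t ?A + poisson_mean t ?B"
      using main by (rule sums_unique[symmetric])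
    finally show ?thesis .
  qed
  have "((\<lambda>t::real. 1 / t) \<longlongrightarrow> 0) at_top"
    by real_asymp
  then have lim: "((\<lambda>t. poisson_mean t (\<lambda>k. ?A (Suc k)) + (1 / t) * poisson_mean t ?A + poisson_mean t ?B)
      \<longlongrightarrow> 0 + 0 * 0 + 0) at_top"
    by (intro tendsto_add tendsto_mult poisson_mean_tendsto_0 A A' B')
  have "((\<lambda>t. poisson_mean t (\<lambda>k. ln (real (Suc k)) * M k) - ln t * poisson_mean t M) \<longlongrightarrow> 0) at_top"
  proof (rule Lim_null_comparison)
    show "\<forall>\<^sub>F t in at_top. norm (poisson_mean t (\<lambda>k. ln (real (Suc k)) * M k) - ln t * poisson_mean t M)
      \<le> poisson_mean t (\<lambda>k. ?A (Suc k)) + (1 / t) * poisson_mean t ?A + poisson_mean t ?B"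
      unfolding real_norm_def by (rule eventually_mono[OF eventually_ge_at_top[of 1] bound])
    show "((\<lambda>t. poisson_mean t (\<lambda>k. ?A (Suc k)) + (1 / t) * poisson_mean t ?A + poisson_mean t ?B)
      \<longlongrightarrow> 0) at_top"
      using lim by (simp only: add_0_left mult_zero_left)
  qed
  from tendsto_diff[OF poisson_mean_tendsto[OF lM] this] show ?thesis
    by simp
qed

section \<open>Convolution on Euclidean space\<close>

lemma integral_lborel_affine:
  fixes f :: "'a::euclidean_space \<Rightarrow> real"
  assumes [measurable]: "f \<in> borel_measurable borel" and c: "c \<noteq> 0"
  shows "(LINT x|lborel. f x) = \<bar>c\<bar> ^ DIM('a) * (LINT x|lborel. f (t + c *\<^sub>R x))"
  by (subst lborel_affine[OF c, of t])
     (simp add: integral_density integral_distr)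

lemma integrable_lborel_affine:
  fixes f :: "'a::euclidean_space \<Rightarrow> real"
  assumes f: "integrable lborel f" and c: "c \<noteq> 0"
  shows "integrable lborel (\<lambda>x. f (t + c *\<^sub>R x))"
proof -
  have [measurable]: "f \<in> borel_measurable borel"
    using borel_measurable_integrable[OF f] by simp
  have "integrable (density (distr lborel borel (\<lambda>x. t + c *\<^sub>R x)) (\<lambda>_. ennreal (\<bar>c\<bar> ^ DIM('a)))) f"
    using f lborel_affine[OF c, of t] by simp
  then have "integrable lborel (\<lambda>x. \<bar>c\<bar> ^ DIM('a) *\<^sub>R f (t + c *\<^sub>R x))"
    by (subst (asm) integrable_density) (simp_all add: integrable_distr_eq)
  then show ?thesis
    using c by simp
qed

lemma lborel_shift:
  fixes f :: "'a::euclidean_space \<Rightarrow> real"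
  assumes f: "f \<in> borel_measurable borel"
  shows "(LINT x|lborel. f (x + t)) = (LINT x|lborel. f x)"
    and "(LINT x|lborel. f (x - t)) = (LINT x|lborel. f x)"
    and "(LINT x|lborel. f (t - x)) = (LINT x|lborel. f x)"
  using integral_lborel_affine[OF f, of 1 t] integral_lborel_affine[OF f, of 1 "-t"]
    integral_lborel_affine[OF f, of "-1" t]
  by (simp_all add: add.commute)

lemma lborel_shift_integrable:
  fixes f :: "'a::euclidean_space \<Rightarrow> real"
  assumes f: "integrable lborel f"
  shows "integrable lborel (\<lambda>x. f (x + t))"
    and "integrable lborel (\<lambda>x. f (x - t))"
    and "integrable lborel (\<lambda>x. f (t - x))"
  using integrable_lborel_affine[OF f, of 1 t] integrable_lborel_affine[OF f, of 1 "-t"]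
    integrable_lborel_affine[OF f, of "-1" t]
  by (simp_all add: add.commute)

text \<open>Leaves the completed measure for \<open>lborel\<close>, where the product measure and
  Fubini are used.\<close>

lemma convolution_eq:
  fixes J g :: "'a::euclidean_space \<Rightarrow> real"
  assumes [measurable]: "J \<in> borel_measurable borel" "g \<in> borel_measurable borel"
  shows "convolution J g x = (LINT y|lborel. J (x - y) * g y)"
  unfolding convolution_def by (rule integral_completion) measurable

lemma borel_measurable_convolution [measurable]:
  fixes J g :: "'a::euclidean_space \<Rightarrow> real"
  assumes [measurable]: "J \<in> borel_measurable borel" "g \<in> borel_measurable borel"
  shows "convolution J g \<in> borel_measurable borel"
proof -
  have "convolution J g = (\<lambda>x. LINT y|lborel. J (x - y) * g y)"
    by (rule ext) (simp add: convolution_eq)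
  then show ?thesis
    by simp
qed

text \<open>The kernel only sees \<open>\<phi>\<close> within distance \<open>d\<close>, so a local majorant \<open>W\<close> of \<open>\<phi>\<close> that is
  integrable against \<open>g\<close> is enough for Fubini; this admits unbounded \<open>\<phi>\<close>.\<close>

lemma convolution_duality:
  fixes J g \<phi> W :: "'a::euclidean_space \<Rightarrow> real"
  assumes J: "integrable lborel J" "\<And>x. 0 \<le> J x" "\<And>x. J (- x) = J x"
    and supp: "\<And>x. d \<le> norm x \<Longrightarrow> J x = 0"
    and [measurable]: "g \<in> borel_measurable borel" "\<phi> \<in> borel_measurable borel"
    and W: "\<And>x y. norm (x - y) < d \<Longrightarrow> \<bar>\<phi> x\<bar> \<le> W y"
    and gW: "integrable lborel (\<lambda>y. g y * W y)"
  shows "integrable lborel (\<lambda>y. g y * convolution J \<phi> y)"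
    and "integrable lborel (\<lambda>x. convolution J g x * \<phi> x)"
    and "(LINT x|lborel. convolution J g x * \<phi> x) = (LINT y|lborel. g y * convolution J \<phi> y)"
proof -
  have [measurable]: "J \<in> borel_measurable borel"
    using borel_measurable_integrable[OF J(1)] by simp
  define F where "F = (\<lambda>y x. g y * (J (y - x) * \<phi> x))"
  have bnd: "\<bar>J (y - x) * \<phi> x\<bar> \<le> J (y - x) * W y" for x y
  proof (cases "norm (x - y) < d")
    case True
    then show ?thesis
      using W[OF True] J(2)[of "y - x"] by (simp add: abs_mult mult_left_mono)
  next
    case False
    then have "J (y - x) = 0"
      using supp[of "y - x"] by (simp add: norm_minus_commute)
    then show ?thesis by simp
  qed
  have intJ: "integrable lborel (\<lambda>x. J (y - x))" for y
    by (rule lborel_shift_integrable[OF J(1)])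
  have intJ\<phi>: "integrable lborel (\<lambda>x. J (y - x) * \<phi> x)" for y
    by (rule Bochner_Integration.integrable_bound[of _ "\<lambda>x. J (y - x) * W y"])
      (use intJ[of y] order_trans[OF bnd abs_ge_self, of y] in auto)
  have bnd2: "(LINT x|lborel. \<bar>J (y - x) * \<phi> x\<bar>) \<le> (LINT x|lborel. J x) * W y" for y
  proof -
    have "(LINT x|lborel. \<bar>J (y - x) * \<phi> x\<bar>) \<le> (LINT x|lborel. J (y - x) * W y)"
      by (rule integral_mono) (use intJ[of y] intJ\<phi>[of y] bnd[of y] in auto)
    also have "\<dots> = (LINT x|lborel. J x) * W y"
      by (simp add: lborel_shift(3)[of J y])
    finally show ?thesis .
  qed
  have int: "integrable (lborel \<Otimes>\<^sub>M lborel) (case_prod F)"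
  proof (rule lborel_pair.Fubini_integrable)
    show "case_prod F \<in> borel_measurable (lborel \<Otimes>\<^sub>M lborel)"
      unfolding F_def by measurable
    show "AE y in lborel. integrable lborel (\<lambda>x. case_prod F (y, x))"
      using intJ\<phi> by (simp add: F_def)
    have "(LINT x|lborel. norm (case_prod F (y, x))) = \<bar>g y\<bar> * (LINT x|lborel. \<bar>J (y - x) * \<phi> x\<bar>)" for y
      by (simp add: F_def abs_mult[of "g y"])
    moreover have "integrable lborel (\<lambda>y. \<bar>g y\<bar> * (LINT x|lborel. \<bar>J (y - x) * \<phi> x\<bar>))"
    proof (rule Bochner_Integration.integrable_bound)
      show "integrable lborel (\<lambda>y. (LINT x|lborel. J x) * (g y * W y))"
        using gW by simp
      have "norm (\<bar>g y\<bar> * (LINT x|lborel. \<bar>J (y - x) * \<phi> x\<bar>)) \<le> norm ((LINT x|lborel. J x) * (g y * W y))" for y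
      proof -
        have "0 \<le> (LINT x|lborel. \<bar>J (y - x) * \<phi> x\<bar>)"
          by simp
        then have "\<bar>g y\<bar> * (LINT x|lborel. \<bar>J (y - x) * \<phi> x\<bar>) \<le> \<bar>g y\<bar> * \<bar>(LINT x|lborel. J x) * W y\<bar>"
          using bnd2[of y] by (intro mult_left_mono) auto
        then show ?thesis
          by (simp add: abs_mult mult_ac)
      qed
      then show "AE y in lborel. norm (\<bar>g y\<bar> * (LINT x|lborel. \<bar>J (y - x) * \<phi> x\<bar>)) \<le> norm ((LINT x|lborel. J x) * (g y * W y))"
        by simp
    qed measurable
    ultimately show "integrable lborel (\<lambda>y. LINT x|lborel. norm (case_prod F (y, x)))"
      by simp
  qed
  have 1: "(LINT x|lborel. F y x) = g y * convolution J \<phi> y" for y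
    by (simp add: F_def convolution_eq)
  have 2: "(LINT y|lborel. F y x) = convolution J g x * \<phi> x" for x
  proof -
    have "J (y - x) = J (x - y)" for y
      using J(3)[of "x - y"] by simp
    then have "(LINT y|lborel. F y x) = (LINT y|lborel. (J (x - y) * g y) * \<phi> x)"
      by (simp add: F_def mult_ac)
    then show ?thesis
      by (simp add: convolution_eq)
  qed
  show "integrable lborel (\<lambda>y. g y * convolution J \<phi> y)"
    using lborel_pair.integrable_fst[OF int] by (simp add: 1)
  show "integrable lborel (\<lambda>x. convolution J g x * \<phi> x)"
    using lborel_pair.integrable_snd[OF int] by (simp add: 2)
  show "(LINT x|lborel. convolution J g x * \<phi> x) = (LINT y|lborel. g y * convolution J \<phi> y)"
    using lborel_pair.Fubini_integral[OF int] by (simp add: 1 2)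
qed

section \<open>A nonlocal Nash inequality\<close>

text \<open>At \<open>z = 0\<close> this is the squared \<open>L^2\<close> norm, and its drop from 0
  to \<open>z\<close> is half the squared \<open>L^2\<close> distance between \<open>f\<close> and
  its translate by \<open>z\<close>. It does the work that a Fourier transform would do in a Nash
  inequality.\<close>

definition autocorrelation :: "('a::euclidean_space \<Rightarrow> real) \<Rightarrow> 'a \<Rightarrow> real" where
  "autocorrelation f z = (LINT x|lborel. f x * f (x - z))"

lemma integrable_mult_bounded:
  fixes f g :: "'a::euclidean_space \<Rightarrow> real"
  assumes f: "integrable lborel f" and [measurable]: "g \<in> borel_measurable borel"
    and g: "\<And>x. \<bar>g x\<bar> \<le> C"
  shows "integrable lborel (\<lambda>x. f x * g x)"
proof (rule Bochner_Integration.integrable_bound)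
  show "integrable lborel (\<lambda>x. C * f x)"
    using f by simp
  have [measurable]: "f \<in> borel_measurable borel"
    using borel_measurable_integrable[OF f] by simp
  show "(\<lambda>x. f x * g x) \<in> borel_measurable lborel"
    by measurable
  have "\<bar>f x\<bar> * \<bar>g x\<bar> \<le> \<bar>f x\<bar> * \<bar>C\<bar>" for x
    using g[of x] by (intro mult_left_mono) auto
  then show "AE x in lborel. norm (f x * g x) \<le> norm (C * f x)"
    by (simp add: abs_mult mult.commute)
qed

lemma autocorrelation_shift:
  fixes f :: "'a::euclidean_space \<Rightarrow> real"
  assumes [measurable]: "f \<in> borel_measurable borel"
  shows "(LINT x|lborel. f (x - a) * f (x - b)) = autocorrelation f (b - a)"
  using lborel_shift(1)[of "\<lambda>x. f (x - a) * f (x - b)" a]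
  by (simp add: autocorrelation_def algebra_simps)

text \<open>Bounded and integrable together give square integrability, so all products of translates
  are integrable.\<close>

locale nonneg_density =
  fixes f :: "'a::euclidean_space \<Rightarrow> real" and C :: real
  assumes integrable: "integrable lborel f"
    and nonneg: "\<And>x. 0 \<le> f x"
    and bounded: "\<And>x. f x \<le> C"
begin

lemma measurable_f [measurable]: "f \<in> borel_measurable borel"
  using borel_measurable_integrable[OF integrable] by simp

lemma abs_le: "\<bar>f x\<bar> \<le> C"
  using nonneg[of x] bounded[of x] by simp

lemma integrable_shift_mult: "integrable lborel (\<lambda>x. f (x - a) * f (x - b))"
  by (rule integrable_mult_bounded[where C = C])
    (use lborel_shift_integrable(2)[OF integrable] abs_le in auto)

lemma integral_sq_diff:
  "(LINT x|lborel. (f (x - a) - f (x - b))\<^sup>2) = 2 * (autocorrelation f 0 - autocorrelation f (b - a))"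
proof -
  have "(f (x - a) - f (x - b))\<^sup>2
      = f (x - a) * f (x - a) + f (x - b) * f (x - b) - 2 * (f (x - a) * f (x - b))" for x
    by (simp add: power2_eq_square algebra_simps)
  then have "(LINT x|lborel. (f (x - a) - f (x - b))\<^sup>2) =
      (LINT x|lborel. f (x - a) * f (x - a)) + (LINT x|lborel. f (x - b) * f (x - b))
        - 2 * (LINT x|lborel. f (x - a) * f (x - b))"
    using integrable_shift_mult by simp
  then show ?thesis
    by (simp add: autocorrelation_shift)
qed

lemma integrable_sq_diff: "integrable lborel (\<lambda>x. (f (x - a) - f (x - b))\<^sup>2)"
proof -
  have "(f (x - a) - f (x - b))\<^sup>2
      = f (x - a) * f (x - a) + f (x - b) * f (x - b) - 2 * (f (x - a) * f (x - b))" for x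
    by (simp add: power2_eq_square algebra_simps)
  then show ?thesis
    using integrable_shift_mult by simp
qed

text \<open>Telescoping splits the translation by \<open>m z\<close> into \<open>m\<close>
  translations by \<open>z\<close>. Cauchy-Schwarz contributes one factor \<open>m\<close>, and the
  \<open>m\<close> equal integrals contribute the other.\<close>

lemma autocorrelation_multiple:
  "autocorrelation f 0 - autocorrelation f (real m *\<^sub>R z)
     \<le> (real m)\<^sup>2 * (autocorrelation f 0 - autocorrelation f z)"
proof -
  let ?g = "\<lambda>i x. f (x - real i *\<^sub>R z) - f (x - real (Suc i) *\<^sub>R z)"
  have "(f (x - 0) - f (x - real m *\<^sub>R z))\<^sup>2 \<le> real m * (\<Sum>i<m. (?g i x)\<^sup>2)" for x
  proof -
    have "f (x - 0) - f (x - real m *\<^sub>R z) = (\<Sum>i<m. ?g i x)"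
      by (subst sum_lessThan_telescope') simp
    then show ?thesis
      using sum_squared_le_sum_of_squares[of "\<lambda>i. ?g i x" "{..<m}"] by (simp add: mult.commute)
  qed
  then have "(LINT x|lborel. (f (x - 0) - f (x - real m *\<^sub>R z))\<^sup>2)
      \<le> (LINT x|lborel. real m * (\<Sum>i<m. (?g i x)\<^sup>2))"
    by (intro integral_mono integrable_sq_diff integrable_mult_right Bochner_Integration.integrable_sum)
  also have "\<dots> = real m * (\<Sum>i<m. LINT x|lborel. (?g i x)\<^sup>2)"
    by (simp add: integral_sum integrable_sq_diff)
  also have "\<dots> = real m * (\<Sum>i<m. 2 * (autocorrelation f 0 - autocorrelation f z))"
    by (simp add: integral_sq_diff algebra_simps)
  finally have "(LINT x|lborel. (f (x - 0) - f (x - real m *\<^sub>R z))\<^sup>2)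
      \<le> 2 * ((real m)\<^sup>2 * (autocorrelation f 0 - autocorrelation f z))"
    by (simp add: power2_eq_square algebra_simps)
  then show ?thesis
    by (simp only: integral_sq_diff) simp
qed

lemma autocorrelation_nonneg: "0 \<le> autocorrelation f z"
  unfolding autocorrelation_def by (simp add: nonneg)

lemma autocorrelation_le: "autocorrelation f z \<le> C * (LINT x|lborel. f x)"
proof -
  have "autocorrelation f z \<le> (LINT x|lborel. C * f x)"
    unfolding autocorrelation_def
  proof (rule integral_mono)
    show "integrable lborel (\<lambda>x. f x * f (x - z))"
      using integrable_shift_mult[of 0 z] by simp
    show "f x * f (x - z) \<le> C * f x" for x
      using mult_left_mono[OF bounded nonneg] by (simp add: mult.commute)
  qed (use integrable in auto)
  then show ?thesis by simp
qed

lemma measurable_autocorrelation [measurable]: "autocorrelation f \<in> borel_measurable borel"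
  unfolding autocorrelation_def[abs_def] by measurable

lemma kernel_autocorrelation:
  assumes J: "integrable lborel J" "\<And>x. 0 \<le> J x"
  shows "integrable (lborel \<Otimes>\<^sub>M lborel) (\<lambda>(w, x). J w * (f (x - r *\<^sub>R w) * f (x - s *\<^sub>R w)))"
    and "integrable lborel (\<lambda>w. J w * autocorrelation f (s *\<^sub>R w))"
    and "(LINT x|lborel. LINT w|lborel. J w * (f (x - r *\<^sub>R w) * f (x - s *\<^sub>R w)))
      = (LINT w|lborel. J w * autocorrelation f ((s - r) *\<^sub>R w))"
proof -
  have [measurable]: "J \<in> borel_measurable borel"
    using borel_measurable_integrable[OF J(1)] by simp
  have A: "integrable lborel (\<lambda>w. J w * autocorrelation f (s *\<^sub>R w))" for s
  proof (rule integrable_mult_bounded[OF J(1), where C = "C * (LINT x|lborel. f x)"])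
    show "(\<lambda>w. autocorrelation f (s *\<^sub>R w)) \<in> borel_measurable borel"
      by measurable
    show "\<bar>autocorrelation f (s *\<^sub>R w)\<bar> \<le> C * (LINT x|lborel. f x)" for w
      using autocorrelation_le[of "s *\<^sub>R w"] autocorrelation_nonneg[of "s *\<^sub>R w"] by simp
  qed
  show "integrable lborel (\<lambda>w. J w * autocorrelation f (s *\<^sub>R w))"
    by (rule A)
  have eq: "(LINT x|lborel. J w * (f (x - r *\<^sub>R w) * f (x - s *\<^sub>R w)))
      = J w * autocorrelation f ((s - r) *\<^sub>R w)" for w
    by (simp add: autocorrelation_shift algebra_simps)
  show int: "integrable (lborel \<Otimes>\<^sub>M lborel) (\<lambda>(w, x). J w * (f (x - r *\<^sub>R w) * f (x - s *\<^sub>R w)))"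
  proof (rule lborel_pair.Fubini_integrable)
    show "AE w in lborel. integrable lborel
        (\<lambda>x. case (w, x) of (w, x) \<Rightarrow> J w * (f (x - r *\<^sub>R w) * f (x - s *\<^sub>R w)))"
      using integrable_shift_mult by simp
    have "(LINT x|lborel. norm (case (w, x) of (w, x) \<Rightarrow> J w * (f (x - r *\<^sub>R w) * f (x - s *\<^sub>R w))))
        = J w * autocorrelation f ((s - r) *\<^sub>R w)" for w
      using eq[of w] by (simp add: J(2) nonneg)
    then show "integrable lborel (\<lambda>w. LINT x|lborel. norm (case (w, x) of (w, x) \<Rightarrow>
        J w * (f (x - r *\<^sub>R w) * f (x - s *\<^sub>R w))))"
      using A by simp
  qed measurable
  show "(LINT x|lborel. LINT w|lborel. J w * (f (x - r *\<^sub>R w) * f (x - s *\<^sub>R w)))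
      = (LINT w|lborel. J w * autocorrelation f ((s - r) *\<^sub>R w))"
    using lborel_pair.Fubini_integral[OF int] by (simp only: eq)
qed

text \<open>With the kernel replaced by its bound \<open>B\<close>, the integral of
  \<open>f (x - s w)\<close> over \<open>w\<close> is the mass divided by the volume factor of the
  dilation; the integral over \<open>x\<close> supplies the second factor of mass.\<close>

lemma kernel_autocorrelation_le:
  assumes J: "integrable lborel J" "\<And>x. 0 \<le> J x" and B: "\<And>x. J x \<le> B" and s: "s > 0"
  shows "(LINT w|lborel. J w * autocorrelation f (s *\<^sub>R w))
    \<le> B * (LINT x|lborel. f x)\<^sup>2 / s ^ DIM('a)"
proof -
  let ?M = "LINT x|lborel. f x"
  have [measurable]: "J \<in> borel_measurable borel"
    using borel_measurable_integrable[OF J(1)] by simp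
  have inner: "(LINT w|lborel. J w * (f (x - 0 *\<^sub>R w) * f (x - s *\<^sub>R w))) \<le> (B * ?M / s ^ DIM('a)) * f x" for x
  proof -
    have i: "integrable lborel (\<lambda>w. f (x - s *\<^sub>R w))"
      using integrable_lborel_affine[OF integrable, of "-s" x] s by simp
    have "(LINT w|lborel. J w * (f (x - 0 *\<^sub>R w) * f (x - s *\<^sub>R w)))
        \<le> (LINT w|lborel. (B * f x) * f (x - s *\<^sub>R w))"
    proof (rule integral_mono)
      show "integrable lborel (\<lambda>w. J w * (f (x - 0 *\<^sub>R w) * f (x - s *\<^sub>R w)))"
      proof (rule integrable_mult_bounded[OF J(1), where C = "C * C"])
        show "\<bar>f (x - 0 *\<^sub>R w) * f (x - s *\<^sub>R w)\<bar> \<le> C * C" for w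
          using abs_le nonneg bounded by (auto simp: abs_mult intro!: mult_mono intro: order_trans[OF nonneg bounded])
      qed measurable
      show "J w * (f (x - 0 *\<^sub>R w) * f (x - s *\<^sub>R w)) \<le> (B * f x) * f (x - s *\<^sub>R w)" for w
        using mult_right_mono[OF B[of w], of "f x * f (x - s *\<^sub>R w)"] nonneg by (simp add: mult.assoc)
    qed (use i in simp)
    also have "\<dots> = (B * f x) * (?M / s ^ DIM('a))"
      using integral_lborel_affine[of f "-s" x] s by simp
    finally show ?thesis by (simp add: mult_ac)
  qed
  have "(LINT w|lborel. J w * autocorrelation f (s *\<^sub>R w))
      = (LINT x|lborel. LINT w|lborel. J w * (f (x - 0 *\<^sub>R w) * f (x - s *\<^sub>R w)))"
    using kernel_autocorrelation(3)[OF J, of 0 s] by simp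
  also have "\<dots> \<le> (LINT x|lborel. (B * ?M / s ^ DIM('a)) * f x)"
    using inner lborel_pair.integrable_snd[OF kernel_autocorrelation(1)[OF J, of 0 s]] integrable
    by (intro integral_mono) auto
  also have "\<dots> = B * ?M\<^sup>2 / s ^ DIM('a)"
    by (simp add: power2_eq_square)
  finally show ?thesis .
qed

end

text \<open>Jensen for the probability density \<open>J\<close>, obtained from the nonnegativity of
  the variance.\<close>

lemma square_integral_le:
  fixes J h :: "'a::euclidean_space \<Rightarrow> real"
  assumes J: "integrable lborel J" "\<And>x. 0 \<le> J x" "(LINT x|lborel. J x) = 1"
    and [measurable]: "h \<in> borel_measurable borel" and h: "\<And>x. \<bar>h x\<bar> \<le> C"
  shows "(LINT w|lborel. J w * h w)\<^sup>2 \<le> (LINT w|lborel. J w * (h w)\<^sup>2)"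
proof -
  define \<mu> where "\<mu> = (LINT w|lborel. J w * h w)"
  have i1: "integrable lborel (\<lambda>w. J w * h w)"
    by (rule integrable_mult_bounded[OF J(1) _ h]) measurable
  have h2: "\<bar>(h x)\<^sup>2\<bar> \<le> C\<^sup>2" for x
    using power_mono[OF h[of x], of 2] by simp
  have i2: "integrable lborel (\<lambda>w. J w * (h w)\<^sup>2)"
    by (rule integrable_mult_bounded[OF J(1) _ h2]) measurable
  have "0 \<le> (LINT w|lborel. J w * (h w - \<mu>)\<^sup>2)"
    using J(2) by simp
  also have "(\<lambda>w. J w * (h w - \<mu>)\<^sup>2) = (\<lambda>w. J w * (h w)\<^sup>2 - 2 * \<mu> * (J w * h w) + \<mu>\<^sup>2 * J w)"
    by (rule ext) (simp add: power2_eq_square algebra_simps)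
  also have "(LINT w|lborel. J w * (h w)\<^sup>2 - 2 * \<mu> * (J w * h w) + \<mu>\<^sup>2 * J w)
      = (LINT w|lborel. J w * (h w)\<^sup>2) - 2 * \<mu> * \<mu> + \<mu>\<^sup>2"
    using i1 i2 J by (simp add: \<mu>_def)
  finally show ?thesis
    by (simp add: \<mu>_def power2_eq_square)
qed

context nonneg_density
begin

text \<open>A Nash inequality for the nonlocal energy.  By Jensen, convolution loses at least the part of
  \<open>\<parallel>f\<parallel>\<^sup>2\<close> measured by \<open>f - f(\<cdot> - 2w)\<close> for \<open>w\<close> in the support of the kernel; chaining \<open>m\<close> such
  translations compares \<open>f\<close> with its average over the kernel dilated by \<open>2m\<close>, which is bounded
  by a multiple of the mass over the volume of the dilated support.\<close>

lemma nash_step: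
  assumes J: "integrable lborel J" "\<And>x. 0 \<le> J x" "\<And>x. J (- x) = J x" "(LINT x|lborel. J x) = 1"
    and B: "\<And>x. J x \<le> B" and m: "m > 0"
    and conv2: "integrable lborel (\<lambda>x. (convolution J f x)\<^sup>2)"
  shows "(LINT x|lborel. (convolution J f x)\<^sup>2) \<le> autocorrelation f 0
    - (autocorrelation f 0 - B * (LINT x|lborel. f x)\<^sup>2 / (2 * real m) ^ DIM('a)) / (2 * (real m)\<^sup>2)"
proof -
  let ?a = "autocorrelation f 0"
  have [measurable]: "J \<in> borel_measurable borel"
    using borel_measurable_integrable[OF J(1)] by simp
  have iJ: "integrable lborel (\<lambda>w. J w * g w)"
    if "g \<in> borel_measurable borel" "\<And>w. \<bar>g w\<bar> \<le> D" for g :: "'a \<Rightarrow> real" and D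
    by (rule integrable_mult_bounded[OF J(1) that])
  let ?F = "\<lambda>r s x. LINT w|lborel. J w * (f (x - r *\<^sub>R w) * f (x - s *\<^sub>R w))"
  have pw: "(convolution J f x)\<^sup>2 \<le> (?F 1 1 x + ?F (-1) (-1) x + 2 * ?F (-1) 1 x) / 4" for x
  proof -
    have c1: "convolution J f x = (LINT w|lborel. J w * f (x - w))"
      using lborel_shift(3)[of "\<lambda>y. J (x - y) * f y" x] by (simp add: convolution_eq)
    have c2: "convolution J f x = (LINT w|lborel. J w * f (x + w))"
      using lborel_shift(1)[of "\<lambda>y. J (x - y) * f y" x] J(3) by (simp add: convolution_eq add.commute)
    \<comment> \<open>Jensen applied to \<open>f (x - w)\<close> alone would only show that the norm
      does not grow. Evenness of \<open>J\<close> allows \<open>w\<close> and \<open>-w\<close> to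
      be averaged first; the square then has the cross term \<open>f (x + w) * f (x - w)\<close>,
      which integrates to the autocorrelation at \<open>2 w\<close>.\<close>
    let ?h = "\<lambda>w. (f (x - w) + f (x + w)) / 2"
    have "convolution J f x = (LINT w|lborel. J w * ?h w)"
    proof -
      have "(LINT w|lborel. J w * ?h w) = (LINT w|lborel. (J w * f (x - w) + J w * f (x + w)) / 2)"
        by (simp add: algebra_simps add_divide_distrib)
      also have "\<dots> = ((LINT w|lborel. J w * f (x - w)) + (LINT w|lborel. J w * f (x + w))) / 2"
        using iJ[of "\<lambda>w. f (x - w)" C] iJ[of "\<lambda>w. f (x + w)" C] abs_le by simp
      finally show ?thesis
        using c1 c2 by simp
    qed
    moreover have "\<bar>?h w\<bar> \<le> C" for w
      using nonneg[of "x - w"] nonneg[of "x + w"] bounded[of "x - w"] bounded[of "x + w"] by simp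
    ultimately have "(convolution J f x)\<^sup>2 \<le> (LINT w|lborel. J w * (?h w)\<^sup>2)"
      using square_integral_le[OF J(1,2,4), of ?h C] by (simp only:) simp
    also have "(\<lambda>w. J w * (?h w)\<^sup>2) = (\<lambda>w. (J w * (f (x - 1 *\<^sub>R w) * f (x - 1 *\<^sub>R w))
        + J w * (f (x - (-1) *\<^sub>R w) * f (x - (-1) *\<^sub>R w))
        + 2 * (J w * (f (x - (-1) *\<^sub>R w) * f (x - 1 *\<^sub>R w)))) / 4)"
      by (rule ext) (simp add: power2_eq_square algebra_simps add_divide_distrib)
    also have "(LINT w|lborel. \<dots> w) = (?F 1 1 x + ?F (-1) (-1) x + 2 * ?F (-1) 1 x) / 4"
    proof -
      have "integrable lborel (\<lambda>w. J w * (f (x - r *\<^sub>R w) * f (x - s *\<^sub>R w)))" for r s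
      proof (rule iJ)
        show "\<bar>f (x - r *\<^sub>R w) * f (x - s *\<^sub>R w)\<bar> \<le> C * C" for w
          using abs_le by (auto simp: abs_mult intro!: mult_mono intro: order_trans[OF nonneg bounded])
      qed measurable
      from this[of 1 1] this[of "-1" "-1"] this[of "-1" 1] show ?thesis
        by simp
    qed
    finally show ?thesis .
  qed
  have iF: "integrable lborel (?F r s)" for r s
    using lborel_pair.integrable_snd[OF kernel_autocorrelation(1)[OF J(1,2), of r s]] .
  have "(LINT x|lborel. (convolution J f x)\<^sup>2)
      \<le> (LINT x|lborel. (?F 1 1 x + ?F (-1) (-1) x + 2 * ?F (-1) 1 x) / 4)"
    by (intro integral_mono conv2 pw integrable_divide Bochner_Integration.integrable_add
        integrable_mult_right iF)
  also have "\<dots> = ((LINT x|lborel. ?F 1 1 x) + (LINT x|lborel. ?F (-1) (-1) x)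
      + 2 * (LINT x|lborel. ?F (-1) 1 x)) / 4"
    using iF[of 1 1] iF[of "-1" "-1"] iF[of "-1" 1] by simp
  also have "\<dots> = (?a + (LINT w|lborel. J w * autocorrelation f (2 *\<^sub>R w))) / 2"
    unfolding kernel_autocorrelation(3)[OF J(1,2)] using J(4) by simp
  finally have step: "(LINT x|lborel. (convolution J f x)\<^sup>2)
      \<le> (?a + (LINT w|lborel. J w * autocorrelation f (2 *\<^sub>R w))) / 2" .
  have chain: "autocorrelation f (2 *\<^sub>R w) \<le> ?a - (?a - autocorrelation f ((2 * real m) *\<^sub>R w)) / (real m)\<^sup>2" for w
    using autocorrelation_multiple[of m "2 *\<^sub>R w"] m by (simp add: field_simps)
  have iA: "integrable lborel (\<lambda>w. J w * autocorrelation f (s *\<^sub>R w))" for s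
    by (rule kernel_autocorrelation(2)[OF J(1,2)])
  have "(LINT w|lborel. J w * autocorrelation f (2 *\<^sub>R w))
      \<le> (LINT w|lborel. (?a - ?a / (real m)\<^sup>2) * J w
            + (J w * autocorrelation f ((2 * real m) *\<^sub>R w)) / (real m)\<^sup>2)"
  proof (rule integral_mono)
    show "J w * autocorrelation f (2 *\<^sub>R w) \<le> (?a - ?a / (real m)\<^sup>2) * J w
        + (J w * autocorrelation f ((2 * real m) *\<^sub>R w)) / (real m)\<^sup>2" for w
      using mult_left_mono[OF chain[of w] J(2)[of w]] by (simp add: algebra_simps diff_divide_distrib)
  qed (use iA J(1) in auto)
  also have "\<dots> = ?a - ?a / (real m)\<^sup>2
      + (LINT w|lborel. J w * autocorrelation f ((2 * real m) *\<^sub>R w)) / (real m)\<^sup>2"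
    using iA J(1,4) by simp
  also have "\<dots> \<le> ?a - ?a / (real m)\<^sup>2
      + (B * (LINT x|lborel. f x)\<^sup>2 / (2 * real m) ^ DIM('a)) / (real m)\<^sup>2"
    using kernel_autocorrelation_le[OF J(1,2) B, of "2 * real m"] m
    by (intro add_left_mono divide_right_mono) auto
  finally have "(LINT w|lborel. J w * autocorrelation f (2 *\<^sub>R w))
      \<le> ?a - ?a / (real m)\<^sup>2 + (B * (LINT x|lborel. f x)\<^sup>2 / (2 * real m) ^ DIM('a)) / (real m)\<^sup>2" .
  moreover have "X \<le> a - (u - v) / (2 * D)" if "L \<le> a - u / D + v / D" "X \<le> (a + L) / 2"
    for X L a u v D :: real
    using that by (simp add: diff_divide_distrib)
  ultimately show ?thesis
    using step by blast
qed

end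

section \<open>The superharmonic barrier\<close>

text \<open>The quarter turn. It preserves \<open>J\<close> and Lebesgue measure, so convolutions
  can be averaged over the square \<open>z\<close>, \<open>rot z\<close>, \<open>-z\<close>,
  \<open>-rot z\<close>, on which quadratic terms no longer depend on the direction of
  \<open>z\<close>.\<close>

definition rot :: "real ^ 2 \<Rightarrow> real ^ 2" where
  "rot x = vector [- (x $ 2), x $ 1]"

lemma rot_nth [simp]: "rot x $ 1 = - (x $ 2)" "rot x $ 2 = x $ 1"
  by (simp_all add: rot_def)

lemma measurable_rot [measurable]: "rot \<in> borel_measurable borel"
proof -
  have "linear rot"
    by (rule linearI) (simp_all add: vec_eq_iff forall_2)
  then show ?thesis
    by (intro borel_measurable_continuous_onI linear_continuous_on)
      (simp add: linear_conv_bounded_linear)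
qed

lemma inner_real2: "x \<bullet> y = x $ 1 * y $ 1 + x $ 2 * y $ 2" for x y :: "real ^ 2"
  by (simp add: inner_vec_def sum_2)

lemma norm_rot [simp]: "norm (rot x) = norm x"
  by (simp add: norm_eq_sqrt_inner inner_real2 add.commute)

lemma inner_rot_Pythagoras: "(x \<bullet> z)\<^sup>2 + (x \<bullet> rot z)\<^sup>2 = (norm x)\<^sup>2 * (norm z)\<^sup>2"
  by (simp add: power2_norm_eq_inner inner_real2) (simp add: power2_eq_square algebra_simps)

lemma prod_Basis_real2: "prod f (Basis :: (real ^ 2) set) = f (axis 1 1) * f (axis 2 1)"
proof -
  have "(Basis :: (real ^ 2) set) = range (\<lambda>i. axis i 1)"
    by (auto simp: Basis_vec_def)
  then have B: "(Basis :: (real ^ 2) set) = {axis 1 1, axis 2 1}"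
    by (simp only: UNIV_2 image_insert image_empty)
  have "axis 1 1 \<noteq> (axis 2 1 :: real ^ 2)"
    by (simp add: axis_eq_axis)
  then show ?thesis
    unfolding B by simp
qed

text \<open>A quarter turn carries boxes to boxes with the two side lengths exchanged, and boxes
  determine \<open>lborel\<close>.\<close>

lemma lborel_distr_rot: "distr lborel borel rot = lborel"
proof (rule lborel_eqI[symmetric])
  fix l u :: "real ^ 2" assume le: "\<And>b. b \<in> Basis \<Longrightarrow> l \<bullet> b \<le> u \<bullet> b"
  have le12: "l $ 1 \<le> u $ 1" "l $ 2 \<le> u $ 2"
    using le[of "axis 1 1"] le[of "axis 2 1"] by (simp_all add: inner_axis axis_in_Basis_iff)
  let ?l = "vector [l $ 2, - (u $ 1)] :: real ^ 2" and ?u = "vector [u $ 2, - (l $ 1)] :: real ^ 2"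
  have eq: "rot -` box l u = box ?l ?u"
    by (auto simp: mem_box_cart forall_2)
  have "?l $ i \<le> ?u $ i" for i
    using le12 exhaust_2[of i] by auto
  then have "?l \<bullet> b \<le> ?u \<bullet> b" if "b \<in> Basis" for b
    using that by (auto simp: Basis_vec_def inner_axis)
  then have "emeasure lborel (box ?l ?u) = (\<Prod>b\<in>Basis. (?u - ?l) \<bullet> b)"
    by (rule emeasure_lborel_box)
  also have "\<dots> = (\<Prod>b\<in>Basis. (u - l) \<bullet> b)"
    by (simp add: prod_Basis_real2 inner_axis mult.commute)
  finally show "emeasure (distr lborel borel rot) (box l u) = (\<Prod>b\<in>Basis. (u - l) \<bullet> b)"
    by (simp add: emeasure_distr eq)
qed simp

lemma integral_rot:
  fixes f :: "real ^ 2 \<Rightarrow> real"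
  assumes "f \<in> borel_measurable borel"
  shows "(LINT x|lborel. f (rot x)) = (LINT x|lborel. f x)"
  using integral_distr[of rot lborel borel f] assms by (simp add: lborel_distr_rot)

text \<open>Here \<open>v = 1 + \<parallel>x\<parallel>\<^sup>2\<close>.  The logarithm alone is only superharmonic for \<open>J\<close> up to an error of
  order \<open>v\<^sup>-\<^sup>2\<close>; the convex term \<open>1 / v\<close> gains exactly this order.\<close>

definition barrier_profile :: "real \<Rightarrow> real \<Rightarrow> real" where
  "barrier_profile d v = ln v + (4 + 2 * d\<^sup>2) * (1 - 1 / v)"

text \<open>Here \<open>a = 1 + |x|^2\<close> and \<open>q = |z|^2\<close>, while \<open>p\<close>,
  \<open>p'\<close> are twice the inner products of \<open>x\<close> with \<open>z\<close> and
  \<open>rot z\<close>. The four logarithms exceed \<open>4 ln a\<close> by at most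
  \<open>(4 q + 2 q^2) / a^2\<close>, which is at most \<open>(4 + 2 d^2) q / a^2\<close>. The four
  reciprocals exceed \<open>4 / a\<close> by at least \<open>q / a^2\<close>. The weight
  \<open>4 + 2 d^2\<close> in the profile balances the two.\<close>

lemma barrier_profile_four_point:
  fixes a q p p' d :: real
  assumes pos: "0 < a + q + p" "0 < a + q - p" "0 < a + q + p'" "0 < a + q - p'"
    and q: "0 \<le> q" "q \<le> d\<^sup>2" and pp: "p\<^sup>2 + p'\<^sup>2 = 4 * (a - 1) * q"
    and a: "4 + 9 * d\<^sup>2 \<le> a"
  shows "barrier_profile d (a + q + p) + barrier_profile d (a + q - p)
      + barrier_profile d (a + q + p') + barrier_profile d (a + q - p') \<le> 4 * barrier_profile d a"
proof -
  define s where "s = a + q"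
  have a0: "a \<ge> 4" "a > 0" and s0: "s > 0" "s \<ge> a"
    using a q zero_le_power2[of d] unfolding s_def by linarith+
  have lnpair: "ln (s + r) + ln (s - r) \<le> 2 * ln a + ((s\<^sup>2 - r\<^sup>2) / a\<^sup>2 - 1)"
    if r: "0 < s + r" "0 < s - r" for r
  proof -
    have eq: "(s + r) * (s - r) = s\<^sup>2 - r\<^sup>2"
      by (simp add: power2_eq_square algebra_simps)
    have p: "0 < (s\<^sup>2 - r\<^sup>2) / a\<^sup>2"
      using r a0 by (simp flip: eq)
    have "ln (s + r) + ln (s - r) = ln ((s + r) * (s - r))"
      using r by (simp add: ln_mult_pos)
    also have "(s + r) * (s - r) = a\<^sup>2 * ((s\<^sup>2 - r\<^sup>2) / a\<^sup>2)"
      using a0 by (simp add: eq)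
    also have "ln \<dots> = ln (a\<^sup>2) + ln ((s\<^sup>2 - r\<^sup>2) / a\<^sup>2)"
      using p a0 by (subst ln_mult_pos) auto
    also have "ln (a\<^sup>2) = 2 * ln a"
      using a0 by (simp add: ln_realpow)
    also have "ln ((s\<^sup>2 - r\<^sup>2) / a\<^sup>2) \<le> (s\<^sup>2 - r\<^sup>2) / a\<^sup>2 - 1"
      using p by (rule ln_le_minus_one)
    finally show ?thesis by simp
  qed
  have invpair: "2 / s + 2 * r\<^sup>2 / s ^ 3 \<le> 1 / (s + r) + 1 / (s - r)"
    if r: "0 < s + r" "0 < s - r" for r
  proof -
    have "0 < (s + r) * (s - r)"
      using r by simp
    then have pos: "0 < s\<^sup>2 - r\<^sup>2"
      by (simp add: power2_eq_square algebra_simps)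
    have "1 / (s + r) + 1 / (s - r) = 2 * s / (s\<^sup>2 - r\<^sup>2)"
    proof -
      have "s\<^sup>2 - r\<^sup>2 = (s + r) * (s - r)"
        by (simp add: power2_eq_square algebra_simps)
      then show ?thesis
        using r by (simp add: field_simps)
    qed
    moreover have "2 / s + 2 * r\<^sup>2 / s ^ 3 = 2 * (s\<^sup>2 + r\<^sup>2) / s ^ 3"
      using s0 by (simp add: field_simps power2_eq_square power3_eq_cube)
    moreover have "2 * (s\<^sup>2 + r\<^sup>2) / s ^ 3 \<le> 2 * s / (s\<^sup>2 - r\<^sup>2)"
    proof -
      have "(s\<^sup>2 + r\<^sup>2) * (s\<^sup>2 - r\<^sup>2) \<le> s * s ^ 3"
        using zero_le_power2[of "r\<^sup>2"] by (simp add: power2_eq_square power3_eq_cube algebra_simps)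
      then have "2 * (s\<^sup>2 + r\<^sup>2) * (s\<^sup>2 - r\<^sup>2) \<le> 2 * s * s ^ 3"
        unfolding mult.assoc by simp
      then show ?thesis
        using pos s0 by (simp add: frac_le_eq divide_le_0_iff frac_le field_split_simps)
    qed
    ultimately show ?thesis by simp
  qed
  \<comment> \<open>The relation for \<open>p\<close> and \<open>p'\<close> removes the terms of
    order \<open>a q\<close>, leaving \<open>4 q + 2 q^2\<close>; this cancellation reflects the
    harmonicity of the logarithm in the plane.\<close>
  have logs: "ln (s + p) + ln (s - p) + ln (s + p') + ln (s - p') \<le> 4 * ln a + (4 * q + 2 * q\<^sup>2) / a\<^sup>2"
  proof -
    have "(s\<^sup>2 - p\<^sup>2) / a\<^sup>2 - 1 + ((s\<^sup>2 - p'\<^sup>2) / a\<^sup>2 - 1) = (2 * s\<^sup>2 - (p\<^sup>2 + p'\<^sup>2) - 2 * a\<^sup>2) / a\<^sup>2"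
      using a0 by (simp add: field_simps)
    also have "2 * s\<^sup>2 - (p\<^sup>2 + p'\<^sup>2) - 2 * a\<^sup>2 = 4 * q + 2 * q\<^sup>2"
      unfolding pp s_def by (simp add: power2_eq_square algebra_simps)
    finally show ?thesis
      using lnpair[of p] lnpair[of p'] pos by (simp add: s_def)
  qed
  have inverses: "4 / a + q / a\<^sup>2 \<le> 1 / (s + p) + 1 / (s - p) + 1 / (s + p') + 1 / (s - p')"
  proof -
    have "2 / s + 2 * p\<^sup>2 / s ^ 3 + (2 / s + 2 * p'\<^sup>2 / s ^ 3) = 4 / s + 2 * (p\<^sup>2 + p'\<^sup>2) / s ^ 3"
      by (simp add: add_divide_distrib)
    also have "\<dots> = 4 / s + 8 * (a - 1) * q / s ^ 3"
      by (simp add: pp)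
    finally have 1: "4 / s + 8 * (a - 1) * q / s ^ 3 \<le> 1 / (s + p) + 1 / (s - p) + 1 / (s + p') + 1 / (s - p')"
      using invpair[of p] invpair[of p'] pos by (simp add: s_def)
    \<comment> \<open>The right side is \<open>4 a (a - 1) - 3 (a + q)^2\<close> rearranged, which
      explains the threshold \<open>4 + 9 d^2\<close> for \<open>a\<close>.\<close>
    have "0 \<le> a * (a - 4 - 9 * q) + 3 * q * (a - q)"
      using a0 q a zero_le_power2[of d] by (intro add_nonneg_nonneg mult_nonneg_nonneg) linarith+
    then have "3 * s\<^sup>2 \<le> 4 * a * (a - 1)"
      unfolding s_def by (simp add: power2_eq_square algebra_simps)
    then have "(6 * s\<^sup>2) / (a * s ^ 3) \<le> (8 * (a - 1) * a) / (a * s ^ 3)"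
      using a0 s0 by (intro divide_right_mono) (auto simp: algebra_simps)
    then have 2: "6 / (a * s) \<le> 8 * (a - 1) / s ^ 3"
      using a0 s0 by (simp add: power2_eq_square power3_eq_cube mult_ac)
    have "a * s \<le> 2 * a\<^sup>2"
      using a a0 q zero_le_power2[of d] unfolding s_def by (simp add: power2_eq_square algebra_simps mult_left_mono)
    then have 3: "1 / a\<^sup>2 \<le> 2 / (a * s)"
      using a0 s0 by (simp add: divide_le_eq le_divide_eq)
    have 4: "4 / a = 4 / s + q * (4 / (a * s))"
    proof -
      have "4 / s + q * (4 / (a * s)) = 4 * (a + q) / (a * s)"
        using a0 s0 by (simp add: field_simps)
      then show ?thesis
        using s0 by (simp flip: s_def)
    qed
    have "q * (4 / (a * s) + 1 / a\<^sup>2) \<le> q * (8 * (a - 1) / s ^ 3)"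
      using 2 3 q by (intro mult_left_mono) auto
    then show ?thesis
      using 1 4 by (simp add: algebra_simps)
  qed
  have "0 \<le> q / a\<^sup>2" "4 * q + 2 * q\<^sup>2 \<le> (4 + 2 * d\<^sup>2) * q"
    using q mult_right_mono[OF q(2) q(1)] by (auto simp: power2_eq_square algebra_simps)
  then have "(4 * q + 2 * q\<^sup>2) / a\<^sup>2 \<le> (4 + 2 * d\<^sup>2) * (q / a\<^sup>2)"
    using divide_right_mono[of "4 * q + 2 * q\<^sup>2" "(4 + 2 * d\<^sup>2) * q" "a\<^sup>2"] by simp
  moreover have "(4 + 2 * d\<^sup>2) * (4 / a + q / a\<^sup>2)
      \<le> (4 + 2 * d\<^sup>2) * (1 / (s + p) + 1 / (s - p) + 1 / (s + p') + 1 / (s - p'))"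
    using inverses by (intro mult_left_mono) auto
  ultimately show ?thesis
    using logs unfolding barrier_profile_def s_def[symmetric]
    by (simp add: algebra_simps)
qed

section \<open>Averages with respect to a radial kernel\<close>

locale radial_kernel =
  fixes J :: "real ^ 2 \<Rightarrow> real" and d :: real
  assumes continuous: "continuous_on UNIV J"
    and radial: "radially_symmetric J"
    and d_pos: "0 < d"
    and J_pos: "\<And>x. norm x < d \<Longrightarrow> 0 < J x"
    and J_zero: "\<And>x. d \<le> norm x \<Longrightarrow> J x = 0"
    and total: "(LINT x|lborel. J x) = 1"
begin

lemma measurable_J [measurable]: "J \<in> borel_measurable borel"
  using continuous by (rule borel_measurable_continuous_onI)

lemma J_nonneg: "0 \<le> J x"
  using J_pos[of x] J_zero[of x] by linarith

lemma J_even: "J (- x) = J x"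
  using radial unfolding radially_symmetric_def by (metis norm_minus_cancel)

lemma J_rot: "J (rot x) = J x"
  using radial unfolding radially_symmetric_def by (metis norm_rot)

text \<open>A non-integrable function has integral 0 by convention, so total mass 1 forces
  integrability.\<close>

lemma J_integrable: "integrable lborel J"
  using total by (metis not_integrable_integral_eq zero_neq_one)

lemma J_bounded: obtains B where "0 \<le> B" "\<And>x. J x \<le> B"
proof -
  have "compact (J ` cball 0 d)"
    using continuous by (intro compact_continuous_image) (auto intro: continuous_on_subset)
  then have "bounded (J ` cball 0 d)"
    by (rule compact_imp_bounded)
  then obtain B where "\<forall>y\<in>J ` cball 0 d. norm y \<le> B"
    unfolding bounded_iff by blast
  then have B: "norm (J x) \<le> B" if "x \<in> cball 0 d" for x
    using that by blast
  show ?thesis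
  proof (rule that[of "\<bar>B\<bar>"])
    show "J x \<le> \<bar>B\<bar>" for x
      using B[of x] J_zero[of x] by (cases "norm x \<le> d") auto
  qed simp
qed

lemma integrable_kernel_mult:
  assumes [measurable]: "\<phi> \<in> borel_measurable borel"
    and C: "\<And>y. norm (x - y) < d \<Longrightarrow> \<bar>\<phi> y\<bar> \<le> C"
  shows "integrable lborel (\<lambda>y. J (x - y) * \<phi> y)"
proof (rule Bochner_Integration.integrable_bound)
  show "integrable lborel (\<lambda>y. C * J (x - y))"
    using lborel_shift_integrable(3)[OF J_integrable] by simp
  have "\<bar>J (x - y) * \<phi> y\<bar> \<le> \<bar>C * J (x - y)\<bar>" for y
  proof (cases "norm (x - y) < d")
    case True
    then have "\<bar>\<phi> y\<bar> \<le> \<bar>C\<bar>"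
      using C by fastforce
    then show ?thesis
      by (simp add: abs_mult mult.commute[of "\<bar>C\<bar>"] mult_left_mono)
  qed (simp add: J_zero)
  then show "AE y in lborel. norm (J (x - y) * \<phi> y) \<le> norm (C * J (x - y))"
    by simp
qed measurable

lemma kernel_total: "(LINT y|lborel. J (x - y)) = 1"
  by (simp add: lborel_shift(3) total)

lemma convolution_const: "convolution J (\<lambda>_. c) x = c"
  by (simp add: convolution_eq kernel_total)

lemma convolution_mono:
  assumes [measurable]: "\<phi> \<in> borel_measurable borel" "\<psi> \<in> borel_measurable borel"
    and C: "\<And>y. norm (x - y) < d \<Longrightarrow> \<bar>\<phi> y\<bar> \<le> C" "\<And>y. norm (x - y) < d \<Longrightarrow> \<bar>\<psi> y\<bar> \<le> C"
    and le: "\<And>y. norm (x - y) < d \<Longrightarrow> \<phi> y \<le> \<psi> y"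
  shows "convolution J \<phi> x \<le> convolution J \<psi> x"
proof -
  have "J (x - y) * \<phi> y \<le> J (x - y) * \<psi> y" for y
    using le[of y] J_nonneg J_zero[of "x - y"] by (cases "norm (x - y) < d") (auto intro: mult_left_mono)
  then show ?thesis
    unfolding convolution_eq[OF measurable_J assms(1)] convolution_eq[OF measurable_J assms(2)]
    by (intro integral_mono integrable_kernel_mult[where C = C] assms)
qed

lemma convolution_nonneg:
  assumes [measurable]: "\<phi> \<in> borel_measurable borel" and nonneg: "\<And>y. 0 \<le> \<phi> y"
  shows "0 \<le> convolution J \<phi> x"
  by (simp add: convolution_eq J_nonneg nonneg)

lemma convolution_le:
  assumes [measurable]: "\<phi> \<in> borel_measurable borel"
    and C: "\<And>y. norm (x - y) < d \<Longrightarrow> 0 \<le> \<phi> y \<and> \<phi> y \<le> C"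
  shows "convolution J \<phi> x \<le> C"
proof -
  have "convolution J \<phi> x \<le> convolution J (\<lambda>_. C) x"
  proof (rule convolution_mono[where C = "\<bar>C\<bar>"])
    show "\<bar>\<phi> y\<bar> \<le> \<bar>C\<bar>" if "norm (x - y) < d" for y
      using C[OF that] by linarith
  qed (use C in auto)
  then show ?thesis
    by (simp add: convolution_const)
qed

lemma abs_convolution_le:
  assumes [measurable]: "\<phi> \<in> borel_measurable borel"
    and C: "\<And>y. \<bar>\<phi> y\<bar> \<le> C"
  shows "\<bar>convolution J \<phi> x\<bar> \<le> C"
proof -
  have "\<bar>\<phi> y\<bar> \<le> \<bar>C\<bar>" "\<phi> y \<le> C" "- C \<le> \<phi> y" for y
    using C[of y] by linarith+
  then have "convolution J \<phi> x \<le> convolution J (\<lambda>_. C) x" "convolution J (\<lambda>_. - C) x \<le> convolution J \<phi> x"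
    by (intro convolution_mono[where C = "\<bar>C\<bar>"]; simp)+
  then show ?thesis
    by (simp add: convolution_const abs_le_iff)
qed

text \<open>The substitutions by \<open>z\<close>, \<open>-z\<close>, \<open>rot z\<close> and
  \<open>-rot z\<close> all give the same integral because \<open>J\<close> is radial, so a
  pointwise bound on four-point sums replaces a second-order expansion.\<close>

lemma convolution_four_point_le:
  assumes [measurable]: "\<phi> \<in> borel_measurable borel"
    and C: "\<And>y. norm (x - y) < d \<Longrightarrow> \<bar>\<phi> y\<bar> \<le> C"
    and le: "\<And>z. norm z < d \<Longrightarrow> \<phi> (x + z) + \<phi> (x - z) + \<phi> (x + rot z) + \<phi> (x - rot z) \<le> 4 * c"
  shows "convolution J \<phi> x \<le> c"
proof -
  let ?I = "\<lambda>h. LINT z|lborel. J z * \<phi> (h z)"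
  have i: "integrable lborel (\<lambda>y. J (x - y) * \<phi> y)"
    by (rule integrable_kernel_mult[OF _ C]) measurable
  have e1: "?I (\<lambda>z. x + z) = convolution J \<phi> x"
    using lborel_shift(1)[of "\<lambda>y. J (x - y) * \<phi> y" x]
    by (simp add: convolution_eq J_even add.commute[of _ x])
  have e2: "?I (\<lambda>z. x - z) = convolution J \<phi> x"
    using lborel_shift(3)[of "\<lambda>y. J (x - y) * \<phi> y" x] by (simp add: convolution_eq)
  have e3: "?I (\<lambda>z. x + rot z) = convolution J \<phi> x"
    using integral_rot[of "\<lambda>z. J z * \<phi> (x + z)"] by (simp add: J_rot flip: e1)
  have e4: "?I (\<lambda>z. x - rot z) = convolution J \<phi> x"
    using integral_rot[of "\<lambda>z. J z * \<phi> (x - z)"] by (simp add: J_rot flip: e2)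
  have int: "integrable lborel (\<lambda>z. J z * \<phi> (h z))"
    if h: "h \<in> borel_measurable borel" "\<And>z. norm (x - h z) = norm z" for h
  proof (rule Bochner_Integration.integrable_bound)
    show "integrable lborel (\<lambda>z. C * J z)"
      using J_integrable by simp
    show "(\<lambda>z. J z * \<phi> (h z)) \<in> borel_measurable lborel"
      using h(1) by measurable
    have "\<bar>J z * \<phi> (h z)\<bar> \<le> \<bar>C * J z\<bar>" for z
    proof (cases "norm z < d")
      case True
      then have "\<bar>\<phi> (h z)\<bar> \<le> \<bar>C\<bar>"
        using C[of "h z"] h(2)[of z] by fastforce
      then show ?thesis
        by (simp add: abs_mult mult.commute[of "\<bar>C\<bar>"] mult_left_mono)
    qed (simp add: J_zero)
    then show "AE z in lborel. norm (J z * \<phi> (h z)) \<le> norm (C * J z)"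
      by simp
  qed
  have ints: "integrable lborel (\<lambda>z. J z * \<phi> (x + z))" "integrable lborel (\<lambda>z. J z * \<phi> (x - z))"
    "integrable lborel (\<lambda>z. J z * \<phi> (x + rot z))" "integrable lborel (\<lambda>z. J z * \<phi> (x - rot z))"
    by (rule int; simp)+
  have "4 * convolution J \<phi> x = (LINT z|lborel. J z * \<phi> (x + z) + J z * \<phi> (x - z)
      + J z * \<phi> (x + rot z) + J z * \<phi> (x - rot z))"
    using ints by (simp add: e1 e2 e3 e4)
  also have "\<dots> \<le> (LINT z|lborel. (4 * c) * J z)"
  proof (rule integral_mono)
    show "J z * \<phi> (x + z) + J z * \<phi> (x - z) + J z * \<phi> (x + rot z) + J z * \<phi> (x - rot z) \<le> (4 * c) * J z" for z
    proof (cases "norm z < d")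
      case True
      then show ?thesis
        using mult_left_mono[OF le[OF True] J_nonneg[of z]] by (simp add: algebra_simps)
    qed (simp add: J_zero)
  qed (use ints J_integrable in simp_all)
  finally show ?thesis
    by (simp add: total)
qed

section \<open>The barrier under convolution\<close>

definition barrier :: "real ^ 2 \<Rightarrow> real" where
  "barrier x = barrier_profile d (1 + (norm x)\<^sup>2)"

lemma measurable_barrier [measurable]: "barrier \<in> borel_measurable borel"
  unfolding barrier_def[abs_def] barrier_profile_def by measurable

lemma barrier_bounds:
  shows "ln (1 + (norm x)\<^sup>2) \<le> barrier x" and "barrier x \<le> ln (1 + (norm x)\<^sup>2) + (4 + 2 * d\<^sup>2)"
proof -
  have pos: "0 < 1 + (norm x)\<^sup>2"
    using zero_le_power2[of "norm x"] by linarith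
  have "0 \<le> 1 / (1 + (norm x)\<^sup>2)" "1 / (1 + (norm x)\<^sup>2) \<le> 1"
    by (simp_all only: pos_divide_le_eq[OF pos] pos_le_divide_eq[OF pos]) simp_all
  then have "0 \<le> 1 - 1 / (1 + (norm x)\<^sup>2)" "1 - 1 / (1 + (norm x)\<^sup>2) \<le> 1"
    by linarith+
  from mult_left_mono[OF this(1), of "4 + 2 * d\<^sup>2"] mult_left_mono[OF this(2), of "4 + 2 * d\<^sup>2"]
  show "ln (1 + (norm x)\<^sup>2) \<le> barrier x" "barrier x \<le> ln (1 + (norm x)\<^sup>2) + (4 + 2 * d\<^sup>2)"
    by (simp_all add: barrier_def barrier_profile_def)
qed

lemma barrier_nonneg: "0 \<le> barrier x"
  by (rule order_trans[OF ln_ge_zero barrier_bounds(1)]) simp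

lemma barrier_quadratic: "barrier x \<le> (norm x)\<^sup>2 + (4 + 2 * d\<^sup>2)"
  using barrier_bounds(2)[of x] ln_add_one_self_le_self[of "(norm x)\<^sup>2"] by simp

lemma norm_near: "norm (x - y) < d \<Longrightarrow> (norm y)\<^sup>2 \<le> 2 * (norm x)\<^sup>2 + 2 * d\<^sup>2"
proof -
  assume "norm (x - y) < d"
  then have "norm y \<le> norm x + d"
    using norm_triangle_ineq3[of x y] by linarith
  then have "(norm y)\<^sup>2 \<le> (norm x + d)\<^sup>2"
    by (intro power_mono) auto
  also have "\<dots> \<le> 2 * (norm x)\<^sup>2 + 2 * d\<^sup>2"
    using sum_squares_bound[of "norm x" d] by (simp add: power2_eq_square algebra_simps)
  finally show ?thesis .
qed

lemma convolution_barrier_le: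
  obtains C K where "0 \<le> C" "\<And>x. convolution J barrier x \<le> barrier x + C * indicator (ball 0 K) x"
proof -
  \<comment> \<open>As \<open>K \<ge> 1\<close>, \<open>norm x \<ge> K\<close> implies
    \<open>1 + |x|^2 \<ge> K\<close>, the threshold of the four-point inequality. Inside the ball,
    \<open>C\<close> is a crude bound on the convolution itself.\<close>
  define K where "K = 4 + 9 * d\<^sup>2"
  have K0: "K \<ge> 4" by (simp add: K_def)
  define C where "C = 2 * K\<^sup>2 + 2 * d\<^sup>2 + (4 + 2 * d\<^sup>2)"
  have C0: "0 \<le> C" by (simp add: C_def)
  have near: "\<bar>barrier y\<bar> \<le> 2 * (norm x)\<^sup>2 + 2 * d\<^sup>2 + (4 + 2 * d\<^sup>2)" if "norm (x - y) < d" for x y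
    using norm_near[OF that] barrier_quadratic[of y] barrier_nonneg[of y] by simp
  have "convolution J barrier x \<le> barrier x + C * indicator (ball 0 K) x" for x
  proof (cases "norm x < K")
    case True
    have "(norm x)\<^sup>2 \<le> K\<^sup>2"
      using True by (intro power_mono) auto
    then have "convolution J barrier x \<le> C"
      using near[of x] barrier_nonneg by (intro convolution_le) (force simp: C_def)+
    then show ?thesis
      using True barrier_nonneg[of x] by simp
  next
    case False
    have "K \<le> K\<^sup>2" using K0 by (simp add: power2_eq_square)
    also have "K\<^sup>2 \<le> (norm x)\<^sup>2"
      using False K0 by (intro power_mono) auto
    finally have a: "4 + 9 * d\<^sup>2 \<le> 1 + (norm x)\<^sup>2" by (simp add: K_def)
    have "convolution J barrier x \<le> barrier x"
    proof (rule convolution_four_point_le[OF measurable_barrier near])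
      fix z :: "real ^ 2" assume z: "norm z < d"
      let ?a = "1 + (norm x)\<^sup>2" and ?q = "(norm z)\<^sup>2"
      have n: "1 + (norm (x + w))\<^sup>2 = ?a + (norm w)\<^sup>2 + 2 * (x \<bullet> w)"
        "1 + (norm (x - w))\<^sup>2 = ?a + (norm w)\<^sup>2 - 2 * (x \<bullet> w)" for w
        by (simp_all add: power2_norm_eq_inner inner_add inner_diff inner_commute algebra_simps)
      have p: "0 < 1 + (norm w)\<^sup>2" for w :: "real ^ 2"
        by (simp add: add_pos_nonneg)
      have "barrier_profile d (?a + ?q + 2 * (x \<bullet> z)) + barrier_profile d (?a + ?q - 2 * (x \<bullet> z))
          + barrier_profile d (?a + ?q + 2 * (x \<bullet> rot z)) + barrier_profile d (?a + ?q - 2 * (x \<bullet> rot z))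
          \<le> 4 * barrier_profile d ?a"
      proof (rule barrier_profile_four_point[OF _ _ _ _ _ _ _ a])
        show "?q \<le> d\<^sup>2"
          using z by (intro power_mono) auto
        show "(2 * (x \<bullet> z))\<^sup>2 + (2 * (x \<bullet> rot z))\<^sup>2 = 4 * (?a - 1) * ?q"
          using inner_rot_Pythagoras[of x z] by (simp add: power_mult_distrib)
      qed (use p[of "x + z"] p[of "x - z"] p[of "x + rot z"] p[of "x - rot z"] in \<open>simp_all add: n\<close>)
      then show "barrier (x + z) + barrier (x - z) + barrier (x + rot z) + barrier (x - rot z) \<le> 4 * barrier x"
        by (simp add: barrier_def n)
    qed
    then show ?thesis
      using C0 by (simp add: indicator_def)
  qed
  then show ?thesis
    using that C0 by blast
qed

text \<open>From every point of the larger ball the kernel reaches a small ball lying inside the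
  smaller one. That \<open>\<delta>\<close> does not depend on \<open>r\<close> is what later
  permits reaching any radius in finitely many enlargements.\<close>

lemma convolution_ball_pos:
  obtains \<delta> where "0 < \<delta>"
    "\<And>r. 2 \<le> r \<Longrightarrow> \<exists>c>0. \<forall>x\<in>ball 0 (r + \<delta>). c \<le> convolution J (indicator (ball 0 r)) x"
proof -
  \<comment> \<open>\<open>3 \<delta> < d\<close> keeps \<open>J\<close> bounded away from 0 on the
    closed ball of radius \<open>3 \<delta>\<close>, and \<open>\<delta> \<le> 1\<close> keeps
    \<open>r - \<delta>\<close> positive.\<close>
  define \<delta> where "\<delta> = min (d / 4) 1"
  have \<delta>: "0 < \<delta>" "\<delta> \<le> 1" "3 * \<delta> < d"
    using d_pos by (auto simp: \<delta>_def)
  have "\<exists>m. \<forall>x\<in>cball 0 (3 * \<delta>). 0 < m \<and> m \<le> J x"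
  proof -
    obtain x0 where x0: "x0 \<in> cball 0 (3 * \<delta>)" "\<And>x. x \<in> cball 0 (3 * \<delta>) \<Longrightarrow> J x0 \<le> J x"
      using continuous_attains_inf[of "cball 0 (3 * \<delta>)" J] continuous_on_subset[OF continuous] \<delta>
      by (auto simp: Bex_def simp del: mem_cball)
    have "0 < J x0"
      using x0(1) \<delta> by (intro J_pos) simp
    then show ?thesis using x0(2) by blast
  qed
  then obtain m where m: "\<And>x. x \<in> cball 0 (3 * \<delta>) \<Longrightarrow> m \<le> J x" "0 < m"
    using \<delta> by (metis centre_in_cball less_eq_real_def mult_pos_pos zero_less_numeral)
  have "m * measure lborel (ball (0 :: real ^ 2) \<delta>) \<le> convolution J (indicator (ball 0 r)) x"
    if r: "2 \<le> r" and x: "x \<in> ball 0 (r + \<delta>)" for r x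
  proof -
    \<comment> \<open>The point \<open>x\<close> pulled radially inwards:
      \<open>|z| < r - \<delta>\<close> and \<open>|x - z| < 2 \<delta>\<close>, so
      \<open>ball z \<delta>\<close> lies in \<open>ball 0 r\<close> and within distance
      \<open>3 \<delta>\<close> of \<open>x\<close>.\<close>
    define z where "z = ((r - \<delta>) / (r + \<delta>)) *\<^sub>R x"
    have pos: "0 < r + \<delta>" "0 < r - \<delta>" using r \<delta> by linarith+
    have nx: "norm x < r + \<delta>" using x by simp
    have z1: "norm z < r - \<delta>"
      using nx pos by (simp add: z_def pos_divide_less_eq mult.commute)
    have "x - z = (2 * \<delta> / (r + \<delta>)) *\<^sub>R x"
    proof -
      have "1 - (r - \<delta>) / (r + \<delta>) = 2 * \<delta> / (r + \<delta>)"
        using pos by (simp add: field_simps)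
      then show ?thesis
        unfolding z_def by (metis scaleR_left_diff_distrib scaleR_one)
    qed
    then have z2: "norm (x - z) < 2 * \<delta>"
      using nx pos \<delta> by (simp add: pos_divide_less_eq mult.commute)
    have sub: "norm y < r \<and> norm (x - y) \<le> 3 * \<delta>" if "y \<in> ball z \<delta>" for y
    proof -
      have "dist z y < \<delta>" using that by simp
      then have "norm y \<le> norm z + dist z y" "norm (x - y) \<le> norm (x - z) + dist z y"
        using norm_triangle_ineq[of z "y - z"] norm_triangle_ineq[of "x - z" "z - y"]
        by (simp_all add: dist_norm norm_minus_commute)
      then show ?thesis
        using \<open>dist z y < \<delta>\<close> z1 z2 by linarith
    qed
    have "m * measure lborel (ball (0 :: real ^ 2) \<delta>) = m * measure lborel (ball z \<delta>)"
      using \<delta> by (simp add: content_ball)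
    also have "\<dots> = (LINT y|lborel. m * indicator (ball z \<delta>) y)"
      by simp
    also have "\<dots> \<le> (LINT y|lborel. J (x - y) * indicator (ball 0 r) y)"
    proof (rule integral_mono)
      show "integrable lborel (\<lambda>y. m * indicator (ball z \<delta>) y)"
        by (intro integrable_mult_right integrable_real_indicator) (use emeasure_lborel_ball_finite[of z \<delta>] in \<open>auto simp: less_top\<close>)
      show "integrable lborel (\<lambda>y. J (x - y) * indicator (ball 0 r) y)"
        by (rule integrable_kernel_mult[where C = 1]) (auto simp: indicator_def)
      show "m * indicator (ball z \<delta>) y \<le> J (x - y) * indicator (ball 0 r) y" for y
      proof (cases "y \<in> ball z \<delta>")
        case True
        then show ?thesis
          using sub[OF True] m(1)[of "x - y"] by simp
      qed (simp add: J_nonneg)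
    qed
    finally show ?thesis
      by (subst convolution_eq) (simp_all add: borel_measurable_indicator borel_open)
  qed
  moreover have "0 < m * measure lborel (ball (0 :: real ^ 2) \<delta>)"
    using m \<delta> by simp
  ultimately show ?thesis
    using that \<delta>(1) by blast
qed

end

section \<open>The walk killed in the hole\<close>

text \<open>Subtracting the partial sums of \<open>y\<close> leaves a decreasing sequence that is
  still bounded below.\<close>

lemma convergent_almost_decreasing:
  fixes x y :: "nat \<Rightarrow> real"
  assumes x: "\<And>k. 0 \<le> x k" and step: "\<And>k. x (Suc k) \<le> x k + y k"
    and y: "summable y" "\<And>k. 0 \<le> y k"
  shows "convergent x"
proof -
  define z where "z k = x k - (\<Sum>j<k. y j)" for k
  have "decseq z"
    using step by (intro decseq_SucI) (simp add: z_def algebra_simps)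
  moreover have "- suminf y \<le> z k" for k
    using x[of k] sum_le_suminf[OF y(1), of "{..<k}"] y(2) by (simp add: z_def)
  ultimately obtain l where l: "z \<longlonglongrightarrow> l"
    using decseq_convergent[of z "- suminf y"] by blast
  have "(\<lambda>k. z k + (\<Sum>j<k. y j)) \<longlonglongrightarrow> l + suminf y"
    by (intro tendsto_add l summable_LIMSEQ y)
  then show ?thesis
    by (auto simp: z_def convergent_def)
qed

text \<open>Cauchy-Schwarz, read off from the squared norm of \<open>f - c 1_A\<close> as a
  nonnegative quadratic in \<open>c\<close>.\<close>

lemma (in nonneg_density) integral_indicator_sq_le:
  assumes [measurable]: "A \<in> sets borel" and fin: "emeasure lborel A < \<infinity>"
  shows "(LINT x|lborel. f x * indicator A x)\<^sup>2 \<le> autocorrelation f 0 * measure lborel A"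
proof -
  define I where "I = (LINT x|lborel. f x * indicator A x)"
  define v where "v = measure lborel A"
  have i1: "integrable lborel (\<lambda>x. f x * indicator A x)"
    by (rule integrable_mult_bounded[OF integrable, where C = 1]) (auto simp: indicator_def)
  have i2: "integrable lborel (\<lambda>x. f x * f x)"
    using integrable_shift_mult[of 0 0] by simp
  have i3: "integrable lborel (indicator A :: _ \<Rightarrow> real)"
    using fin by (intro integrable_real_indicator) auto
  have quad: "0 \<le> autocorrelation f 0 - 2 * c * I + c\<^sup>2 * v" for c
  proof -
    have "0 \<le> (LINT x|lborel. (f x - c * indicator A x)\<^sup>2)"
      by simp
    also have "(\<lambda>x. (f x - c * indicator A x)\<^sup>2)
        = (\<lambda>x. f x * f x - 2 * c * (f x * indicator A x) + c\<^sup>2 * indicator A x)"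
      by (rule ext) (simp add: power2_eq_square algebra_simps indicator_def)
    also have "(LINT x|lborel. \<dots> x) = autocorrelation f 0 - 2 * c * I + c\<^sup>2 * v"
      using i1 i2 i3 by (simp add: autocorrelation_def I_def v_def)
    finally show ?thesis .
  qed
  have v0: "0 \<le> v" by (simp add: v_def)
  have "I\<^sup>2 \<le> autocorrelation f 0 * v"
  proof (cases "v = 0")
    case True
    \<comment> \<open>With \<open>v = 0\<close> the quadratic is affine in \<open>c\<close>; a
      nonzero slope would make it equal to -1 at the chosen \<open>c\<close>.\<close>
    have "I = 0"
    proof (rule ccontr)
      assume "I \<noteq> 0"
      then show False
        using quad[of "(autocorrelation f 0 + 1) / (2 * I)"] True by (simp add: field_simps)
    qed
    then show ?thesis using True by simp
  next
    case False
    then have "v > 0" using v0 by simp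
    then show ?thesis
      using quad[of "I / v"] by (simp add: field_simps power2_eq_square)
  qed
  then show ?thesis
    by (simp add: I_def v_def)
qed

lemma integral_ball_le:
  fixes f :: "real ^ 2 \<Rightarrow> real"
  assumes f: "nonneg_density f C" and r: "0 \<le> r"
  shows "(LINT x|lborel. f x * indicator (ball 0 r) x) \<le> sqrt (unit_ball_vol 2 * autocorrelation f 0) * r"
proof -
  interpret nonneg_density f C by fact
  have "(LINT x|lborel. f x * indicator (ball 0 r) x)\<^sup>2 \<le> autocorrelation f 0 * measure lborel (ball (0 :: real ^ 2) r)"
    using emeasure_lborel_ball_finite[of "0 :: real ^ 2" r] by (intro integral_indicator_sq_le) auto
  also have "\<dots> = (unit_ball_vol 2 * autocorrelation f 0) * r\<^sup>2"
    using r by (simp add: content_ball mult_ac)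
  finally have "(LINT x|lborel. f x * indicator (ball 0 r) x) \<le> sqrt ((unit_ball_vol 2 * autocorrelation f 0) * r\<^sup>2)"
    by (rule real_le_rsqrt)
  then show ?thesis
    using r by (simp add: real_sqrt_mult)
qed

text \<open>The datum is a Borel version whose bounds and vanishing in \<open>H\<close> hold
  everywhere, which keeps null sets out of the iteration.\<close>

locale killed_walk = radial_kernel +
  fixes H :: "(real ^ 2) set" and f0 :: "real ^ 2 \<Rightarrow> real" and C0 :: real
  assumes H [measurable]: "H \<in> sets borel" and ball_H: "ball 0 2 \<subseteq> H"
    and f0: "nonneg_density f0 C0"
    and f0_moment: "integrable lborel (\<lambda>x. f0 x * (norm x)\<^sup>2)"
    and f0_H: "\<And>x. x \<in> H \<Longrightarrow> f0 x = 0"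
begin

definition walk :: "nat \<Rightarrow> real ^ 2 \<Rightarrow> real" where
  "walk k = ((\<lambda>g x. convolution J g x * indicator (- H) x) ^^ k) f0"

lemma walk_0 [simp]: "walk 0 = f0"
  by (simp add: walk_def)

lemma walk_Suc: "walk (Suc k) x = convolution J (walk k) x * indicator (- H) x"
  by (simp add: walk_def)

lemma walk_H: "x \<in> H \<Longrightarrow> walk k x = 0"
  by (cases k) (simp_all add: f0_H walk_Suc)

lemma walk_near_0: "norm x < 2 \<Longrightarrow> walk k x = 0"
  using ball_H by (intro walk_H) auto

text \<open>Duality for test functions of quadratic growth: within distance \<open>d\<close> of
  \<open>y\<close> they are bounded by a quadratic in \<open>norm y\<close>, which the second moment
  of \<open>g\<close> makes integrable.\<close>

lemma convolution_dual:
  assumes g: "nonneg_density g C0" and gm: "integrable lborel (\<lambda>x. g x * (norm x)\<^sup>2)"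
    and \<phi>: "\<phi> \<in> borel_measurable borel" "\<And>x. \<bar>\<phi> x\<bar> \<le> a + b * (norm x)\<^sup>2" "0 \<le> b"
  shows "integrable lborel (\<lambda>y. g y * convolution J \<phi> y)"
    and "integrable lborel (\<lambda>x. convolution J g x * \<phi> x)"
    and "(LINT x|lborel. convolution J g x * \<phi> x) = (LINT y|lborel. g y * convolution J \<phi> y)"
proof -
  interpret nonneg_density g C0 by fact
  have "\<bar>\<phi> x\<bar> \<le> (a + b * 2 * d\<^sup>2) + 2 * b * (norm y)\<^sup>2" if "norm (x - y) < d" for x y
  proof -
    have "b * (norm x)\<^sup>2 \<le> b * (2 * (norm y)\<^sup>2 + 2 * d\<^sup>2)"
      using that norm_near[of y x] \<phi>(3) by (intro mult_left_mono) (auto simp: norm_minus_commute)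
    then show ?thesis
      using \<phi>(2)[of x] by (simp add: algebra_simps)
  qed
  moreover have "integrable lborel (\<lambda>y. g y * ((a + b * 2 * d\<^sup>2) + 2 * b * (norm y)\<^sup>2))"
  proof -
    have "(\<lambda>y. g y * ((a + b * 2 * d\<^sup>2) + 2 * b * (norm y)\<^sup>2))
        = (\<lambda>y. (a + b * 2 * d\<^sup>2) * g y + 2 * b * (g y * (norm y)\<^sup>2))"
      by (rule ext) (simp add: algebra_simps)
    then show ?thesis
      using integrable gm by simp
  qed
  ultimately have near: "\<And>x y. norm (x - y) < d \<Longrightarrow> \<bar>\<phi> x\<bar> \<le> (a + b * 2 * d\<^sup>2) + 2 * b * (norm y)\<^sup>2"
    and int: "integrable lborel (\<lambda>y. g y * ((a + b * 2 * d\<^sup>2) + 2 * b * (norm y)\<^sup>2))"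
    by blast+
  note dual = convolution_duality[of J d, OF J_integrable J_nonneg J_even J_zero measurable_f \<phi>(1) near int]
  show "integrable lborel (\<lambda>y. g y * convolution J \<phi> y)"
    by (rule dual(1))
  show "integrable lborel (\<lambda>x. convolution J g x * \<phi> x)"
    by (rule dual(2))
  show "(LINT x|lborel. convolution J g x * \<phi> x) = (LINT y|lborel. g y * convolution J \<phi> y)"
    by (rule dual(3))
qed

text \<open>Proved jointly with the second moment, because \<open>convolution_dual\<close> needs
  both for the current step. Averaging and killing preserve the bound \<open>C0\<close>.\<close>

lemma walk_density: "nonneg_density (walk k) C0"
  and walk_moment: "integrable lborel (\<lambda>x. walk k x * (norm x)\<^sup>2)"
proof (induction k)
  case (Suc k)
  interpret nonneg_density "walk k" C0 by fact
  have c0: "0 \<le> convolution J (walk k) x" "convolution J (walk k) x \<le> C0" for x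
    using nonneg bounded by (auto intro!: convolution_nonneg convolution_le)
  have C0: "0 \<le> C0" using nonneg[of 0] bounded[of 0] by linarith
  have i: "integrable lborel (\<lambda>x. convolution J (walk k) x * 1)"
    by (rule convolution_dual(2)[where a = 1 and b = 0]) (use Suc in auto)
  {
    case 1
    show ?case
    proof
      show "integrable lborel (walk (Suc k))"
        using integrable_mult_bounded[of "convolution J (walk k)" "indicator (- H)" 1] i
        by (simp add: walk_Suc[abs_def] indicator_def)
    qed (use c0 C0 in \<open>auto simp: walk_Suc indicator_def\<close>)
  next
    case 2
    have "integrable lborel (\<lambda>x. (convolution J (walk k) x * (norm x)\<^sup>2) * indicator (- H) x)"
      by (rule integrable_mult_bounded[where C = 1])
        (use convolution_dual(2)[OF Suc, of "\<lambda>x. (norm x)\<^sup>2" 0 1] in \<open>auto simp: indicator_def\<close>)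
    then show ?case
      by (simp add: walk_Suc[abs_def] mult_ac)
  }
qed (use f0 f0_moment in simp_all)

lemma walk_measurable [measurable]: "walk k \<in> borel_measurable borel"
  using nonneg_density.measurable_f[OF walk_density] .

lemma walk_nonneg: "0 \<le> walk k x"
  using nonneg_density.nonneg[OF walk_density] .

lemma walk_integrable: "integrable lborel (walk k)"
  using nonneg_density.integrable[OF walk_density] .

lemma walk_integrable_mult:
  assumes [measurable]: "\<phi> \<in> borel_measurable borel" and \<phi>: "\<And>x. \<bar>\<phi> x\<bar> \<le> a + b * (norm x)\<^sup>2"
  shows "integrable lborel (\<lambda>x. walk k x * \<phi> x)"
proof (rule Bochner_Integration.integrable_bound)
  show "integrable lborel (\<lambda>x. a * walk k x + b * (walk k x * (norm x)\<^sup>2))"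
    using walk_integrable walk_moment by simp
  have "\<bar>walk k x * \<phi> x\<bar> \<le> a * walk k x + b * (walk k x * (norm x)\<^sup>2)" for x
    using mult_left_mono[OF \<phi>[of x] walk_nonneg[of k x]] walk_nonneg[of k x]
    by (simp add: abs_mult algebra_simps)
  then show "AE x in lborel. norm (walk k x * \<phi> x) \<le> norm (a * walk k x + b * (walk k x * (norm x)\<^sup>2))"
    by (auto intro!: AE_I2 order_trans[OF _ abs_ge_self])
qed measurable

text \<open>Killing can only lower the integral of a nonnegative function, and duality moves the
  kernel onto \<open>\<phi>\<close>. So pointwise bounds on \<open>convolution J \<phi>\<close>
  become bounds on the moments of the walk.\<close>

lemma walk_step_le:
  assumes \<phi> [measurable]: "\<phi> \<in> borel_measurable borel" and \<phi>': "\<And>x. 0 \<le> \<phi> x" "\<And>x. \<phi> x \<le> a + b * (norm x)\<^sup>2" "0 \<le> b"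
  shows "(LINT x|lborel. walk (Suc k) x * \<phi> x) \<le> (LINT x|lborel. walk k x * convolution J \<phi> x)"
proof -
  have ab: "\<bar>\<phi> x\<bar> \<le> a + b * (norm x)\<^sup>2" for x using \<phi>' by simp
  have "(LINT x|lborel. walk (Suc k) x * \<phi> x) \<le> (LINT x|lborel. convolution J (walk k) x * \<phi> x)"
  proof (rule integral_mono)
    show "integrable lborel (\<lambda>x. walk (Suc k) x * \<phi> x)"
      by (rule walk_integrable_mult[OF \<phi> ab])
    show "integrable lborel (\<lambda>x. convolution J (walk k) x * \<phi> x)"
      by (rule convolution_dual(2)[OF walk_density walk_moment \<phi> ab \<phi>'(3)])
    show "walk (Suc k) x * \<phi> x \<le> convolution J (walk k) x * \<phi> x" for x
      using convolution_nonneg[of "walk k" x] walk_nonneg \<phi>'(1)[of x] by (simp add: walk_Suc indicator_def)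
  qed
  then show ?thesis
    using convolution_dual(3)[OF walk_density walk_moment \<phi> ab \<phi>'(3)] by simp
qed

section \<open>Loss into the hole and summability on balls\<close>

definition mass :: "nat \<Rightarrow> real" where
  "mass k = (LINT x|lborel. walk k x)"

lemma mass_nonneg: "0 \<le> mass k"
  by (simp add: mass_def walk_nonneg)

text \<open>Mass absorbed between times \<open>k\<close> and \<open>k + 1\<close>.\<close>

definition loss :: "nat \<Rightarrow> real" where
  "loss k = (LINT x|lborel. convolution J (walk k) x * indicator H x)"

lemma convolution_walk_integrable: "integrable lborel (convolution J (walk k))"
  and convolution_walk_integral: "(LINT x|lborel. convolution J (walk k) x) = mass k"
  using convolution_dual[OF walk_density walk_moment, of "\<lambda>_. 1" 1 0 k]
  by (simp_all add: convolution_const mass_def)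

lemma convolution_walk_nonneg: "0 \<le> convolution J (walk k) x"
  by (rule convolution_nonneg) (simp_all add: walk_nonneg)

lemma convolution_walk_integrable_indicator:
  "A \<in> sets borel \<Longrightarrow> integrable lborel (\<lambda>x. convolution J (walk k) x * indicator A x)"
  by (rule integrable_mult_bounded[OF convolution_walk_integrable, where C = 1]) (auto simp: indicator_def)

lemma mass_Suc: "mass (Suc k) = mass k - loss k"
proof -
  have "mass (Suc k) = (LINT x|lborel. convolution J (walk k) x - convolution J (walk k) x * indicator H x)"
    unfolding mass_def by (rule Bochner_Integration.integral_cong) (simp_all add: walk_Suc indicator_def)
  then show ?thesis
    using convolution_walk_integrable_indicator[OF H, of k] convolution_walk_integrable[of k]
    by (simp add: convolution_walk_integral loss_def)
qed

lemma loss_nonneg: "0 \<le> loss k"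
  by (simp add: loss_def convolution_walk_nonneg)

lemma mass_decseq: "decseq mass"
  by (rule decseq_SucI) (simp add: mass_Suc loss_nonneg)

lemma summable_loss: "summable loss"
proof (rule summableI_nonneg_bounded)
  show "(\<Sum>j<n. loss j) \<le> mass 0" for n
  proof -
    have "(\<Sum>j<n. loss j) = mass 0 - mass n"
      by (induction n) (simp_all add: mass_Suc)
    then show ?thesis using mass_nonneg[of n] by simp
  qed
qed (rule loss_nonneg)

definition ball_mass :: "real \<Rightarrow> nat \<Rightarrow> real" where
  "ball_mass r k = (LINT x|lborel. walk k x * indicator (ball 0 r) x)"

lemma ball_mass_nonneg: "0 \<le> ball_mass r k"
  by (simp add: ball_mass_def walk_nonneg)

lemma borel_ball [measurable]: "ball (0 :: real ^ 2) r \<in> sets borel"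
  by (simp add: borel_open)

lemma walk_integrable_ball: "integrable lborel (\<lambda>x. walk k x * indicator (ball 0 r) x)"
  by (rule walk_integrable_mult[where a = 1 and b = 0]) (auto simp: indicator_def)

text \<open>Mass in a ball of radius \<open>r + \<delta>\<close> jumps with a fixed probability into the smaller ball, and
  there it is either killed or still counted at the next step.\<close>

lemma summable_ball_mass_step:
  assumes c: "0 < c" and ge: "\<And>x. x \<in> ball 0 r' \<Longrightarrow> c \<le> convolution J (indicator (ball 0 r)) x"
    and sum: "summable (ball_mass r)"
  shows "summable (ball_mass r')"
proof (rule summable_comparison_test')
  show "summable (\<lambda>k. (ball_mass r (Suc k) + loss k) / c)"
    using sum summable_loss by (intro summable_divide summable_add) (simp_all add: summable_Suc_iff)
  fix k
  let ?\<phi> = "indicator (ball 0 r) :: real ^ 2 \<Rightarrow> real"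
  have \<phi>: "?\<phi> \<in> borel_measurable borel" "\<And>x. \<bar>?\<phi> x\<bar> \<le> 1 + 0 * (norm x)\<^sup>2"
    by (auto simp: indicator_def)
  have conv0: "0 \<le> convolution J ?\<phi> x" for x
    by (rule convolution_nonneg) auto
  have "c * ball_mass r' k = (LINT x|lborel. c * (walk k x * indicator (ball 0 r') x))"
    by (simp add: ball_mass_def)
  also have "\<dots> \<le> (LINT x|lborel. walk k x * convolution J ?\<phi> x)"
  proof (rule integral_mono)
    show "integrable lborel (\<lambda>x. walk k x * convolution J ?\<phi> x)"
      by (rule convolution_dual(1)[OF walk_density walk_moment \<phi>]) simp
    show "c * (walk k x * indicator (ball 0 r') x) \<le> walk k x * convolution J ?\<phi> x" for x
      using mult_left_mono[OF ge[of x] walk_nonneg[of k x]] walk_nonneg[of k x] conv0[of x]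
      by (cases "x \<in> ball 0 r'") (simp_all add: mult.commute)
  qed (use walk_integrable_ball in simp)
  also have "\<dots> = (LINT x|lborel. convolution J (walk k) x * ?\<phi> x)"
    by (rule convolution_dual(3)[OF walk_density walk_moment \<phi>, symmetric]) simp
  also have "\<dots> \<le> (LINT x|lborel. walk (Suc k) x * ?\<phi> x + convolution J (walk k) x * indicator H x)"
    using convolution_walk_nonneg
    by (intro integral_mono Bochner_Integration.integrable_add walk_integrable_ball
        convolution_walk_integrable_indicator) (auto simp: walk_Suc indicator_def)
  also have "\<dots> = ball_mass r (Suc k) + loss k"
    using walk_integrable_ball[of "Suc k" r] convolution_walk_integrable_indicator[OF H, of k]
    by (simp add: ball_mass_def loss_def)
  finally show "norm (ball_mass r' k) \<le> (ball_mass r (Suc k) + loss k) / c"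
    using c ball_mass_nonneg[of r' k] by (simp add: pos_le_divide_eq mult.commute)
qed

lemma ball_mass_2: "ball_mass 2 k = 0"
  unfolding ball_mass_def
  by (rule integral_eq_zero_AE) (auto simp: indicator_def walk_near_0)

text \<open>The radius starts at 2, where the walk has no mass, and grows by the fixed
  \<open>\<delta>\<close> at each application of \<open>summable_ball_mass_step\<close>, so any
  \<open>r\<close> is passed eventually.\<close>

lemma summable_ball_mass: "summable (ball_mass r)"
proof -
  obtain \<delta> where \<delta>: "0 < \<delta>"
    "\<And>r. 2 \<le> r \<Longrightarrow> \<exists>c>0. \<forall>x\<in>ball 0 (r + \<delta>). c \<le> convolution J (indicator (ball 0 r)) x"
    using convolution_ball_pos by blast
  have grow: "summable (ball_mass (2 + real n * \<delta>))" for n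
  proof (induction n)
    case 0
    then show ?case by (simp add: ball_mass_2[abs_def])
  next
    case (Suc n)
    have "2 \<le> 2 + real n * \<delta>"
      using \<delta>(1) by simp
    from \<delta>(2)[OF this] obtain c where c: "c > 0"
      "\<forall>x\<in>ball 0 (2 + real n * \<delta> + \<delta>). c \<le> convolution J (indicator (ball 0 (2 + real n * \<delta>))) x"
      by blast
    have "summable (ball_mass (2 + real n * \<delta> + \<delta>))"
      by (rule summable_ball_mass_step[OF c(1) c(2)[rule_format] Suc])
    then show ?case by (simp add: algebra_simps)
  qed
  obtain n :: nat where n: "r / \<delta> < real n"
    using reals_Archimedean2 by blast
  have "r \<le> 2 + real n * \<delta>"
    using n \<delta>(1) by (simp add: divide_less_eq)
  then have "indicator (ball 0 r) x \<le> (indicator (ball 0 (2 + real n * \<delta>)) x :: real)" for x :: "real ^ 2"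
    by (simp add: indicator_def)
  then have "ball_mass r k \<le> ball_mass (2 + real n * \<delta>) k" for k
    unfolding ball_mass_def
    by (intro integral_mono walk_integrable_ball mult_left_mono walk_nonneg)
  then show ?thesis
    using summable_comparison_test'[OF grow[of n], of 0 "ball_mass r"] ball_mass_nonneg by simp
qed

section \<open>Convergence of the barrier moments and decay of the mass\<close>

definition barrier_moment :: "nat \<Rightarrow> real" where
  "barrier_moment k = (LINT x|lborel. walk k x * barrier x)"

lemma walk_integrable_barrier: "integrable lborel (\<lambda>x. walk k x * barrier x)"
  by (rule walk_integrable_mult[where a = "4 + 2 * d\<^sup>2" and b = 1])
    (use barrier_nonneg barrier_quadratic in \<open>auto simp: add.commute\<close>)

lemma convergent_barrier_moment: "convergent barrier_moment"
proof -
  obtain C K where C: "0 \<le> C" "\<And>x. convolution J barrier x \<le> barrier x + C * indicator (ball 0 K) x"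
    using convolution_barrier_le by blast
  have q: "barrier x \<le> (4 + 2 * d\<^sup>2) + 1 * (norm x)\<^sup>2" for x
    using barrier_quadratic[of x] by simp
  have q': "\<bar>barrier x\<bar> \<le> (4 + 2 * d\<^sup>2) + 1 * (norm x)\<^sup>2" for x
    using q[of x] barrier_nonneg[of x] by simp
  have step: "barrier_moment (Suc k) \<le> barrier_moment k + C * ball_mass K k" for k
  proof -
    have "barrier_moment (Suc k) \<le> (LINT x|lborel. walk k x * convolution J barrier x)"
      unfolding barrier_moment_def by (rule walk_step_le[OF measurable_barrier barrier_nonneg q]) simp
    also have "\<dots> \<le> (LINT x|lborel. walk k x * barrier x + C * (walk k x * indicator (ball 0 K) x))"
    proof (rule integral_mono)
      show "integrable lborel (\<lambda>x. walk k x * convolution J barrier x)"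
        by (rule convolution_dual(1)[OF walk_density walk_moment measurable_barrier q']) simp
      show "walk k x * convolution J barrier x \<le> walk k x * barrier x + C * (walk k x * indicator (ball 0 K) x)" for x
        using mult_left_mono[OF C(2)[of x] walk_nonneg[of k x]] by (simp add: algebra_simps)
    qed (use walk_integrable_barrier walk_integrable_ball in simp)
    also have "\<dots> = barrier_moment k + C * ball_mass K k"
      using walk_integrable_barrier[of k] walk_integrable_ball[of k K]
      by (simp add: barrier_moment_def ball_mass_def)
    finally show ?thesis .
  qed
  show ?thesis
  proof (rule convergent_almost_decreasing[where x = barrier_moment and y = "\<lambda>k. C * ball_mass K k"])
    show "barrier_moment (Suc k) \<le> barrier_moment k + C * ball_mass K k" for k
      by (rule step)
    show "0 \<le> barrier_moment k" for k
      by (simp add: barrier_moment_def walk_nonneg barrier_nonneg)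
    show "summable (\<lambda>k. C * ball_mass K k)"
      by (rule summable_mult[OF summable_ball_mass])
    show "0 \<le> C * ball_mass K k" for k
      using C(1) ball_mass_nonneg by simp
  qed
qed

lemma mass_tendsto_0: "mass \<longlonglongrightarrow> 0"
proof (rule LIMSEQ_I)
  fix e :: real assume e: "0 < e"
  obtain C where C: "\<And>k. \<bar>barrier_moment k\<bar> \<le> C"
    using convergent_barrier_moment LIMSEQ_bounded unfolding convergent_def by blast
  \<comment> \<open>Makes the barrier at least \<open>2 |C| / e + 1\<close> outside the ball. By
    Markov's inequality the mass there is at most \<open>e / 2\<close>; the summand 1 keeps the
    divisor positive even if \<open>C = 0\<close>.\<close>
  define \<rho> where "\<rho> = exp (2 * \<bar>C\<bar> / e + 1)"
  have l: "2 * \<bar>C\<bar> / e + 1 \<le> ln (1 + \<rho>\<^sup>2)"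
  proof -
    have "1 \<le> \<rho>" using e by (simp add: \<rho>_def)
    then have "\<rho> \<le> 1 + \<rho>\<^sup>2" by (simp add: power2_eq_square add_increasing)
    then have "ln \<rho> \<le> ln (1 + \<rho>\<^sup>2)"
      by (subst ln_le_cancel_iff) (auto simp: \<rho>_def intro: add_pos_nonneg)
    then show ?thesis by (simp add: \<rho>_def)
  qed
  have far: "mass k \<le> ball_mass \<rho> k + \<bar>C\<bar> / (2 * \<bar>C\<bar> / e + 1)" for k
  proof -
    let ?L = "2 * \<bar>C\<bar> / e + 1"
    have L: "0 < ?L" using e by (intro add_nonneg_pos) auto
    have "mass k \<le> (LINT x|lborel. walk k x * indicator (ball 0 \<rho>) x + (walk k x * barrier x) / ?L)"
      unfolding mass_def
    proof (rule integral_mono)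
      fix x :: "real ^ 2"
      show "walk k x \<le> walk k x * indicator (ball 0 \<rho>) x + (walk k x * barrier x) / ?L"
      proof (cases "norm x < \<rho>")
        case True
        then show ?thesis
          using L walk_nonneg[of k x] barrier_nonneg[of x] by simp
      next
        case False
        then have "\<rho>\<^sup>2 \<le> (norm x)\<^sup>2"
          by (intro power_mono) (auto simp: \<rho>_def)
        then have "ln (1 + \<rho>\<^sup>2) \<le> ln (1 + (norm x)\<^sup>2)"
          by (subst ln_le_cancel_iff) (auto intro: add_pos_nonneg)
        then have "?L \<le> barrier x"
          using l barrier_bounds(1)[of x] by linarith
        then have "walk k x * ?L \<le> walk k x * barrier x"
          using walk_nonneg by (rule mult_left_mono)
        then show ?thesis
          using False L by (simp add: pos_le_divide_eq)
      qed
    qed (use walk_integrable walk_integrable_ball walk_integrable_barrier in simp_all)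
    also have "\<dots> = ball_mass \<rho> k + barrier_moment k / ?L"
      using walk_integrable_ball[of k \<rho>] walk_integrable_barrier[of k]
      by (simp add: ball_mass_def barrier_moment_def)
    also have "\<dots> \<le> ball_mass \<rho> k + \<bar>C\<bar> / ?L"
      using C[of k] L by (intro add_left_mono divide_right_mono) auto
    finally show ?thesis .
  qed
  have small: "\<bar>C\<bar> / (2 * \<bar>C\<bar> / e + 1) \<le> e / 2"
  proof -
    have "e / 2 * (2 * \<bar>C\<bar> / e + 1) = \<bar>C\<bar> + e / 2"
      using e by (simp add: field_simps)
    moreover have "0 < 2 * \<bar>C\<bar> / e + 1"
      using e by (intro add_nonneg_pos) auto
    ultimately show ?thesis
      using e by (simp add: pos_divide_le_eq)
  qed
  have "ball_mass \<rho> \<longlonglongrightarrow> 0"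
    by (rule summable_LIMSEQ_zero[OF summable_ball_mass])
  then obtain N where N: "\<And>k. k \<ge> N \<Longrightarrow> ball_mass \<rho> k < e / 2"
    using order_tendstoD(2)[of _ 0 sequentially "e / 2"] e by (auto simp: eventually_sequentially)
  have "norm (mass k - 0) < e" if "k \<ge> N" for k
    using far[of k] small N[OF that] mass_nonneg[of k] by (simp only: real_norm_def)
  then show "\<exists>no. \<forall>n\<ge>no. norm (mass n - 0) < e" by blast
qed

section \<open>Energy and second moment\<close>

definition energy :: "nat \<Rightarrow> real" where
  "energy k = autocorrelation (walk k) 0"

lemma energy_nonneg: "0 \<le> energy k"
  unfolding energy_def by (rule nonneg_density.autocorrelation_nonneg[OF walk_density])

text \<open>Killing lowers the square pointwise, so \<open>nash_step\<close> for the unkilled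
  convolution applies. In the plane its volume factor is \<open>(2 m)^2\<close>, the
  \<open>4 m^2\<close> of \<open>nash_decay\<close>.\<close>

lemma energy_step:
  assumes B: "\<And>x. J x \<le> B" and m: "m > 0"
  shows "energy (Suc k) \<le> energy k - (energy k - (B * (mass k)\<^sup>2) / (4 * (real m)\<^sup>2)) / (2 * (real m)\<^sup>2)"
proof -
  interpret nonneg_density "walk k" C0 by (rule walk_density)
  have c: "\<bar>convolution J (walk k) x\<bar> \<le> C0" for x
    by (rule abs_convolution_le) (simp_all add: abs_le)
  have sq: "integrable lborel (\<lambda>x. (convolution J (walk k) x)\<^sup>2)"
    unfolding power2_eq_square
    by (rule integrable_mult_bounded[OF convolution_walk_integrable _ c]) measurable
  have "energy (Suc k) \<le> (LINT x|lborel. (convolution J (walk k) x)\<^sup>2)"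
    unfolding energy_def autocorrelation_def
  proof (rule integral_mono)
    show "integrable lborel (\<lambda>x. walk (Suc k) x * walk (Suc k) (x - 0))"
      using nonneg_density.integrable_shift_mult[OF walk_density, of "Suc k" 0 0] by simp
    show "walk (Suc k) x * walk (Suc k) (x - 0) \<le> (convolution J (walk k) x)\<^sup>2" for x
      by (simp add: walk_Suc indicator_def power2_eq_square)
  qed (rule sq)
  also have "\<dots> \<le> energy k - (energy k - B * (mass k)\<^sup>2 / (2 * real m) ^ DIM(real ^ 2)) / (2 * (real m)\<^sup>2)"
    unfolding energy_def mass_def by (rule nash_step[OF J_integrable J_nonneg J_even total B m sq])
  finally show ?thesis
    by (simp add: power_mult_distrib)
qed

text \<open>Started at time 0, \<open>nash_decay\<close> gives only a bound of order
  \<open>1 / k\<close>. Restarted at half the elapsed time it has the squared mass at that time as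
  its constant, and this tends to 0.\<close>

lemma energy_decay: "(\<lambda>k. real (Suc k) * energy k) \<longlonglongrightarrow> 0"
proof -
  obtain B where B: "0 \<le> B" "\<And>x. J x \<le> B"
    using J_bounded by blast
  note nash = nash_decay[of energy mass B, OF energy_nonneg mass_nonneg mass_decseq B(1) energy_step[OF B(2)]]
  define D where "D n = 4 * B * (mass n)\<^sup>2 + 8 * energy n" for n
  have e0: "energy \<longlonglongrightarrow> 0"
  proof (rule tendsto_sandwich[OF _ _ tendsto_const])
    have "(\<lambda>k. D 0 * (1 / real k)) \<longlonglongrightarrow> D 0 * 0"
      by (intro tendsto_mult tendsto_const lim_1_over_n)
    then show "(\<lambda>k. D 0 * (1 / real k)) \<longlonglongrightarrow> 0" by simp
    show "\<forall>\<^sub>F k in sequentially. energy k \<le> D 0 * (1 / real k)"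
      using eventually_gt_at_top[of 0]
    proof eventually_elim
      case (elim k)
      then show ?case
        using nash(1)[of k 0] by (simp add: D_def pos_le_divide_eq mult.commute)
    qed
    show "\<forall>\<^sub>F k in sequentially. 0 \<le> energy k"
      using energy_nonneg by simp
  qed
  \<comment> \<open>With \<open>j = k div 2\<close> one has \<open>k + 1 \<le> 2 j + 2\<close>: the
    part \<open>2 j\<close> is paid by the restarted bound, the remaining 2 by the energy at time
    \<open>j\<close>.\<close>
  define g where "g j = 2 * D j + 2 * energy j" for j
  have "g \<longlonglongrightarrow> 2 * (4 * B * 0\<^sup>2 + 8 * 0) + 2 * 0"
    unfolding g_def[abs_def] D_def by (intro tendsto_intros mass_tendsto_0 e0)
  then have g0: "g \<longlonglongrightarrow> 0" by simp
  have half: "filterlim (\<lambda>k::nat. k div 2) sequentially sequentially"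
    unfolding filterlim_at_top
  proof
    fix N :: nat
    show "\<forall>\<^sub>F k in sequentially. N \<le> k div 2"
      using eventually_ge_at_top[of "2 * N"] by eventually_elim linarith
  qed
  have le: "real (Suc k) * energy k \<le> g (k div 2)" for k
  proof -
    let ?j = "k div 2"
    have dec: "energy k \<le> energy (?j + ?j)" "energy (?j + ?j) \<le> energy ?j"
      using decseqD[OF nash(2)] by simp_all
    have "real (Suc k) * energy k \<le> (2 * real ?j + 2) * energy (?j + ?j)"
      using dec(1) energy_nonneg by (intro mult_mono) auto
    also have "\<dots> = 2 * (real ?j * energy (?j + ?j)) + 2 * energy (?j + ?j)"
      by (simp add: algebra_simps)
    also have "\<dots> \<le> 2 * D ?j + 2 * energy ?j"
      using nash(1)[of ?j ?j] dec(2) by (simp add: D_def)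
    finally show ?thesis by (simp add: g_def)
  qed
  show ?thesis
  proof (rule tendsto_sandwich[OF _ _ tendsto_const])
    show "(\<lambda>k. g (k div 2)) \<longlonglongrightarrow> 0"
      by (rule filterlim_compose[OF g0 half])
    show "\<forall>\<^sub>F k in sequentially. real (Suc k) * energy k \<le> g (k div 2)"
      using le by simp
    show "\<forall>\<^sub>F k in sequentially. 0 \<le> real (Suc k) * energy k"
      using energy_nonneg by simp
  qed
qed

definition second_moment :: "nat \<Rightarrow> real" where
  "second_moment k = (LINT x|lborel. walk k x * (norm x)\<^sup>2)"

text \<open>By the parallelogram law one step adds at most \<open>d^2\<close> times the current
  mass, and the mass tends to 0.\<close>

lemma second_moment_growth: "(\<lambda>k. second_moment k / real (Suc k)) \<longlonglongrightarrow> 0"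
proof (rule linear_growth_sublinear)
  show "0 \<le> second_moment k" for k
    by (simp add: second_moment_def walk_nonneg)
  have "(\<lambda>k. d\<^sup>2 * mass k) \<longlonglongrightarrow> d\<^sup>2 * 0"
    by (intro tendsto_intros mass_tendsto_0)
  then show "(\<lambda>k. d\<^sup>2 * mass k) \<longlonglongrightarrow> 0" by simp
  fix k
  have conv: "convolution J (\<lambda>x. (norm x)\<^sup>2) x \<le> (norm x)\<^sup>2 + d\<^sup>2" for x
  proof (rule convolution_four_point_le)
    show "\<bar>(norm y)\<^sup>2\<bar> \<le> 2 * (norm x)\<^sup>2 + 2 * d\<^sup>2" if "norm (x - y) < d" for y
      using norm_near[OF that] by simp
    fix z :: "real ^ 2" assume "norm z < d"
    then have "(norm z)\<^sup>2 \<le> d\<^sup>2"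
      by (intro power_mono) auto
    moreover have "(norm (x + w))\<^sup>2 + (norm (x - w))\<^sup>2 = 2 * (norm x)\<^sup>2 + 2 * (norm w)\<^sup>2" for w
      by (simp add: power2_norm_eq_inner inner_add inner_diff inner_commute)
    from this[of z] this[of "rot z"]
    have "(norm (x + z))\<^sup>2 + (norm (x - z))\<^sup>2 + (norm (x + rot z))\<^sup>2 + (norm (x - rot z))\<^sup>2
        = 4 * ((norm x)\<^sup>2 + (norm z)\<^sup>2)" by simp
    ultimately show "(norm (x + z))\<^sup>2 + (norm (x - z))\<^sup>2 + (norm (x + rot z))\<^sup>2 + (norm (x - rot z))\<^sup>2
        \<le> 4 * ((norm x)\<^sup>2 + d\<^sup>2)" by simp
  qed simp
  have "second_moment (Suc k) \<le> (LINT x|lborel. walk k x * convolution J (\<lambda>x. (norm x)\<^sup>2) x)"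
    unfolding second_moment_def by (rule walk_step_le[where a = 0 and b = 1]) simp_all
  also have "\<dots> \<le> (LINT x|lborel. walk k x * (norm x)\<^sup>2 + d\<^sup>2 * walk k x)"
  proof (rule integral_mono)
    show "integrable lborel (\<lambda>x. walk k x * convolution J (\<lambda>x. (norm x)\<^sup>2) x)"
      by (rule convolution_dual(1)[OF walk_density walk_moment, where a = 0 and b = 1]) simp_all
    show "walk k x * convolution J (\<lambda>x. (norm x)\<^sup>2) x \<le> walk k x * (norm x)\<^sup>2 + d\<^sup>2 * walk k x" for x
      using mult_left_mono[OF conv[of x] walk_nonneg[of k x]] by (simp add: algebra_simps)
  qed (use walk_moment walk_integrable in simp)
  also have "\<dots> = second_moment k + d\<^sup>2 * mass k"
    using walk_moment[of k] walk_integrable[of k] by (simp add: second_moment_def mass_def)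
  finally show "second_moment (Suc k) \<le> second_moment k + d\<^sup>2 * mass k" .
qed

section \<open>Logarithmic moments\<close>

definition log_moment :: "nat \<Rightarrow> real" where
  "log_moment k = (LINT x|lborel. walk k x * ln (1 + (norm x)\<^sup>2))"

lemma ln_quadratic: "0 \<le> ln (1 + (norm x)\<^sup>2)" "ln (1 + (norm x)\<^sup>2) \<le> (norm x)\<^sup>2" for x :: "real ^ 2"
  by (auto intro: ln_add_one_self_le_self)

lemma walk_integrable_log: "integrable lborel (\<lambda>x. walk k x * ln (1 + (norm x)\<^sup>2))"
  by (rule walk_integrable_mult[where a = 0 and b = 1]) (use ln_quadratic in auto)

text \<open>At time \<open>k\<close> the walk lives at distance \<open>\<surd>k\<close>.  Larger distances are excluded by the second
  moment, smaller ones, on dyadic scales, by the decay of the energy.\<close>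

lemma log_moment_mass: "(\<lambda>k. log_moment k - ln (real (Suc k)) * mass k) \<longlonglongrightarrow> 0"
proof -
  let ?c = "unit_ball_vol 2"
  \<comment> \<open>The factor 4 is the 2 of the dyadic count times the bound 2 for the geometric
    series of radii.\<close>
  define lower where "lower k = 4 * sqrt (?c * (real (Suc k) * energy k))" for k
  define upper where "upper k = (mass k + second_moment k) / real (Suc k)" for k
  have diff: "log_moment k - ln (real (Suc k)) * mass k
      = (LINT x|lborel. walk k x * ln (1 + (norm x)\<^sup>2) - ln (real (Suc k)) * walk k x)" for k
    using walk_integrable_log[of k] walk_integrable[of k] by (simp add: log_moment_def mass_def)
  have up: "log_moment k - ln (real (Suc k)) * mass k \<le> upper k" for k
  proof -
    let ?n = "real (Suc k)"
    have "log_moment k - ln ?n * mass k \<le> (LINT x|lborel. (walk k x + walk k x * (norm x)\<^sup>2) / ?n)"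
      unfolding diff
    proof (rule integral_mono)
      fix x :: "real ^ 2"
      have p: "0 < 1 + (norm x)\<^sup>2" by (intro add_pos_nonneg) auto
      then have "ln (1 + (norm x)\<^sup>2) - ln ?n = ln ((1 + (norm x)\<^sup>2) / ?n)"
        by (subst ln_div) auto
      also have "\<dots> \<le> (1 + (norm x)\<^sup>2) / ?n - 1"
        using p by (intro ln_le_minus_one divide_pos_pos) auto
      finally have "ln (1 + (norm x)\<^sup>2) - ln ?n \<le> (1 + (norm x)\<^sup>2) / ?n" by simp
      from mult_left_mono[OF this walk_nonneg[of k x]]
      show "walk k x * ln (1 + (norm x)\<^sup>2) - ln ?n * walk k x \<le> (walk k x + walk k x * (norm x)\<^sup>2) / ?n"
        by (simp add: algebra_simps)
    qed (use walk_integrable_log walk_integrable walk_moment in simp_all)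
    also have "\<dots> = upper k"
      using walk_integrable[of k] walk_moment[of k] by (simp add: upper_def mass_def second_moment_def)
    finally show ?thesis .
  qed
  have low: "- lower k \<le> log_moment k - ln (real (Suc k)) * mass k" for k
  proof -
    let ?n = "real (Suc k)"
    \<comment> \<open>If \<open>4 ^ j \<le> n / (1 + |x|^2)\<close>, then
      \<open>2 ^ j |x| < sqrt n\<close>, strictly because of the summand 1. Thus each counted power
      places \<open>x\<close> in an open ball of this radius.\<close>
    let ?r = "\<lambda>j::nat. sqrt ?n / 2 ^ j"
    have "ln ?n * mass k - log_moment k \<le>
        (LINT x|lborel. 2 * (\<Sum>j\<le>Suc k. walk k x * indicator (ball 0 (?r j)) x))"
    proof -
      have "ln ?n * mass k - log_moment k
          = (LINT x|lborel. ln ?n * walk k x - walk k x * ln (1 + (norm x)\<^sup>2))"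
        using walk_integrable_log[of k] walk_integrable[of k] by (simp add: log_moment_def mass_def)
      also have "\<dots> \<le> (LINT x|lborel. 2 * (\<Sum>j\<le>Suc k. walk k x * indicator (ball 0 (?r j)) x))"
      proof (rule integral_mono)
        fix x :: "real ^ 2"
        let ?v = "1 + (norm x)\<^sup>2"
        have p: "1 \<le> ?v" "0 < ?v" by (auto intro: add_pos_nonneg)
        have "?n / ?v \<le> ?n" using p by (simp add: divide_le_eq mult_le_cancel_left1)
        also have "?n \<le> 4 ^ Suc k"
          \<comment> \<open>This crude bound makes \<open>Suc k\<close> scales sufficient for the
            count.\<close>
          using of_nat_less_two_power[of "Suc k", where 'a = real] power_mono[of 2 "4::real" "Suc k"] by linarith
        finally have "ln (?n / ?v) \<le> 2 * (\<Sum>j\<le>Suc k. of_bool (4 ^ j \<le> ?n / ?v))"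
          using p by (intro ln_le_dyadic_count) auto
        also have "(\<Sum>j\<le>Suc k. of_bool (4 ^ j \<le> ?n / ?v) :: real) \<le> (\<Sum>j\<le>Suc k. indicator (ball 0 (?r j)) x)"
        proof (rule sum_mono)
          fix j
          have "x \<in> ball 0 (?r j)" if "4 ^ j \<le> ?n / ?v"
          proof -
            have "4 ^ j * ?v \<le> ?n"
              using that p by (simp add: pos_le_divide_eq)
            moreover have "(2 ^ j * norm x)\<^sup>2 = 4 ^ j * (norm x)\<^sup>2"
            proof -
              have "(2 ^ j * 2 ^ j :: real) = 4 ^ j"
                by (simp flip: power_mult_distrib)
              then show ?thesis
                by (simp add: power2_eq_square mult_ac)
            qed
            ultimately have "(2 ^ j * norm x)\<^sup>2 < ?n"
              using zero_less_power[of "4::real" j] by (simp add: distrib_left del: zero_less_power)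
            then have "2 ^ j * norm x < sqrt ?n"
              by (rule real_less_rsqrt)
            then show ?thesis
              by (simp add: pos_less_divide_eq mult.commute)
          qed
          then show "of_bool (4 ^ j \<le> ?n / ?v) \<le> (indicator (ball 0 (?r j)) x :: real)"
            by (auto simp: indicator_def)
        qed
        finally have "ln ?n - ln ?v \<le> 2 * (\<Sum>j\<le>Suc k. indicator (ball 0 (?r j)) x)"
          using p by (simp add: ln_div)
        from mult_left_mono[OF this walk_nonneg[of k x]]
        show "ln ?n * walk k x - walk k x * ln ?v \<le> 2 * (\<Sum>j\<le>Suc k. walk k x * indicator (ball 0 (?r j)) x)"
          by (simp add: algebra_simps sum_distrib_left)
      qed (intro integrable_mult_right Bochner_Integration.integrable_sum Bochner_Integration.integrable_diff
          walk_integrable walk_integrable_log walk_integrable_ball)+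
      finally show ?thesis .
    qed
    also have "\<dots> = 2 * (\<Sum>j\<le>Suc k. LINT x|lborel. walk k x * indicator (ball 0 (?r j)) x)"
      by (subst integral_mult_right_zero, subst Bochner_Integration.integral_sum) (rule walk_integrable_ball refl)+
    also have "\<dots> \<le> 2 * (\<Sum>j\<le>Suc k. sqrt (?c * energy k) * ?r j)"
      unfolding energy_def by (intro mult_left_mono sum_mono integral_ball_le[OF walk_density]) auto
    also have "\<dots> = 2 * (sqrt (?c * energy k) * sqrt ?n) * (\<Sum>j\<le>Suc k. (1 / 2) ^ j)"
    proof -
      have "sqrt (?c * energy k) * ?r j = (sqrt (?c * energy k) * sqrt ?n) * (1 / 2) ^ j" for j
        by (simp only: power_one_over times_divide_eq_right mult.assoc mult_1_right divide_inverse mult_1_left power_inverse)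
      then show ?thesis
        by (simp only: sum_distrib_left[symmetric] mult.assoc)
    qed
    also have "\<dots> \<le> 2 * (sqrt (?c * energy k) * sqrt ?n) * 2"
    proof (rule mult_left_mono)
      have "(\<Sum>j\<le>m. (1 / 2) ^ j) = (2 - (1 / 2) ^ m :: real)" for m
        by (induction m) (simp_all add: field_simps)
      from this[of "Suc k"] show "(\<Sum>j\<le>Suc k. (1 / 2) ^ j) \<le> (2 :: real)"
        using zero_le_power[of "1 / 2 :: real" "Suc k"] by linarith
    qed (use energy_nonneg in simp)
    also have "\<dots> = lower k"
      by (simp add: lower_def real_sqrt_mult mult_ac)
    finally show ?thesis by simp
  qed
  show ?thesis
  proof (rule tendsto_sandwich)
    have "(\<lambda>k. - (4 * sqrt (?c * (real (Suc k) * energy k)))) \<longlonglongrightarrow> - (4 * sqrt (?c * 0))"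
      by (intro tendsto_intros energy_decay)
    then show "(\<lambda>k. - lower k) \<longlonglongrightarrow> 0" by (simp add: lower_def)
    have "(\<lambda>k. mass k * (1 / real (Suc k)) + second_moment k / real (Suc k)) \<longlonglongrightarrow> 0 * 0 + 0"
      by (intro tendsto_add tendsto_mult mass_tendsto_0 second_moment_growth LIMSEQ_Suc[OF lim_1_over_n])
    then show "upper \<longlonglongrightarrow> 0" by (simp add: upper_def[abs_def] add_divide_distrib)
  qed (use low up in simp_all)
qed

text \<open>Differs from \<open>ln (norm x)\<close> only inside the unit ball, where walk and
  solution vanish. Its sign permits exchanging the integral with the Poisson sum in
  \<open>mixture_integral\<close>.\<close>

definition ln_pos :: "real ^ 2 \<Rightarrow> real" where
  "ln_pos x = max 0 (ln (norm x))"

lemma measurable_ln_pos [measurable]: "ln_pos \<in> borel_measurable borel"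
  unfolding ln_pos_def[abs_def] by measurable

lemma ln_pos_nonneg: "0 \<le> ln_pos x"
  by (simp add: ln_pos_def)

lemma ln_pos_quadratic: "\<bar>ln_pos x\<bar> \<le> 0 + 1 * (norm x)\<^sup>2"
proof (cases "1 \<le> norm x")
  case True
  then have "ln (norm x) \<le> norm x"
    by (intro ln_bound) linarith
  also have "\<dots> \<le> (norm x)\<^sup>2"
    using True self_le_power[of "norm x" 2] by simp
  finally show ?thesis
    using True by (simp add: ln_pos_def)
next
  case False
  then have "ln (norm x) \<le> 0"
    by (cases "x = 0") (auto simp: not_le)
  then show ?thesis by (simp add: ln_pos_def)
qed

definition ln_moment :: "nat \<Rightarrow> real" where
  "ln_moment k = (LINT x|lborel. walk k x * ln_pos x)"

text \<open>Where the walk lives, \<open>barrier x\<close>, \<open>ln (1 + |x|^2)\<close> and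
  \<open>2 * ln_pos x\<close> differ by bounded amounts, so their moments differ by multiples of the
  vanishing mass and share one limit. Only the comparison with
  \<open>ln (real (Suc k)) * mass k\<close> needs the diffusive estimates.\<close>

theorem walk_limit:
  obtains l where "(\<lambda>k. ln (real (Suc k)) * mass k) \<longlonglongrightarrow> l" "(\<lambda>k. 2 * ln_moment k) \<longlonglongrightarrow> l"
proof -
  obtain l where l: "barrier_moment \<longlonglongrightarrow> l"
    using convergent_barrier_moment by (auto simp: convergent_def)
  have sandwich: "(\<lambda>k. X k - Y k) \<longlonglongrightarrow> 0"
    if "\<And>k. Y k \<le> X k" "\<And>k. X k \<le> Y k + c * mass k" for X Y :: "nat \<Rightarrow> real" and c
  proof (rule tendsto_sandwich[OF _ _ tendsto_const])
    have "(\<lambda>k. c * mass k) \<longlonglongrightarrow> c * 0"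
      by (intro tendsto_intros mass_tendsto_0)
    then show "(\<lambda>k. c * mass k) \<longlonglongrightarrow> 0" by simp
  qed (use that in \<open>auto simp: algebra_simps\<close>)
  have 1: "(\<lambda>k. barrier_moment k - log_moment k) \<longlonglongrightarrow> 0"
  proof (rule sandwich)
    fix k
    show "log_moment k \<le> barrier_moment k"
      unfolding log_moment_def barrier_moment_def
      by (intro integral_mono walk_integrable_log walk_integrable_barrier mult_left_mono barrier_bounds walk_nonneg)
    have "barrier_moment k \<le> (LINT x|lborel. walk k x * ln (1 + (norm x)\<^sup>2) + (4 + 2 * d\<^sup>2) * walk k x)"
      unfolding barrier_moment_def
    proof (rule integral_mono)
      show "walk k x * barrier x \<le> walk k x * ln (1 + (norm x)\<^sup>2) + (4 + 2 * d\<^sup>2) * walk k x" for x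
        using mult_left_mono[OF barrier_bounds(2)[of x] walk_nonneg[of k x]] by (simp add: algebra_simps)
    qed (use walk_integrable_log walk_integrable walk_integrable_barrier in simp_all)
    then show "barrier_moment k \<le> log_moment k + (4 + 2 * d\<^sup>2) * mass k"
      using walk_integrable_log[of k] walk_integrable[of k] by (simp add: log_moment_def mass_def)
  qed
  have ip: "integrable lborel (\<lambda>x. walk k x * ln_pos x)" for k
    by (rule walk_integrable_mult[OF measurable_ln_pos ln_pos_quadratic])
  have 2: "(\<lambda>k. log_moment k - 2 * ln_moment k) \<longlonglongrightarrow> 0"
  proof (rule sandwich)
    fix k
    have pw: "2 * (walk k x * ln_pos x) \<le> walk k x * ln (1 + (norm x)\<^sup>2)
        \<and> walk k x * ln (1 + (norm x)\<^sup>2) \<le> 2 * (walk k x * ln_pos x) + 1 * walk k x" for x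
    proof (cases "norm x < 2")
      case False
      then have n: "norm x \<ge> 2" by simp
      have e: "2 * ln_pos x = ln ((norm x)\<^sup>2)"
        using n by (simp add: ln_pos_def ln_realpow)
      have "ln ((norm x)\<^sup>2) \<le> ln (1 + (norm x)\<^sup>2)"
        using n by (subst ln_le_cancel_iff) (auto intro: add_pos_nonneg)
      moreover have "ln (1 + (norm x)\<^sup>2) \<le> ln ((norm x)\<^sup>2) + 1"
      proof -
        have n2: "1 \<le> (norm x)\<^sup>2" "0 < (norm x)\<^sup>2"
          using n power_mono[of 1 "norm x" 2] by auto
        have "ln (1 + (norm x)\<^sup>2) \<le> ln ((norm x)\<^sup>2 * exp 1)"
        proof (subst ln_le_cancel_iff)
          have "(norm x)\<^sup>2 * 2 \<le> (norm x)\<^sup>2 * exp 1"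
            using exp_ge_add_one_self[of 1] by (intro mult_left_mono) auto
          then show "1 + (norm x)\<^sup>2 \<le> (norm x)\<^sup>2 * exp 1"
            using n2 by linarith
        qed (use n2 in \<open>auto intro: add_pos_nonneg\<close>)
        then show ?thesis
          using n2 by (simp add: ln_mult)
      qed
      ultimately have "2 * ln_pos x \<le> ln (1 + (norm x)\<^sup>2)" "ln (1 + (norm x)\<^sup>2) \<le> 2 * ln_pos x + 1"
        using e by auto
      from this[THEN mult_left_mono, OF walk_nonneg[of k x]] show ?thesis
        by (simp add: algebra_simps)
    qed (simp add: walk_near_0)
    have "(LINT x|lborel. 2 * (walk k x * ln_pos x)) \<le> log_moment k"
      unfolding log_moment_def using pw ip walk_integrable_log by (intro integral_mono) auto
    then show "2 * ln_moment k \<le> log_moment k"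
      by (simp add: ln_moment_def)
    have "log_moment k \<le> (LINT x|lborel. 2 * (walk k x * ln_pos x) + 1 * walk k x)"
      unfolding log_moment_def using pw ip walk_integrable_log walk_integrable by (intro integral_mono) auto
    then show "log_moment k \<le> 2 * ln_moment k + 1 * mass k"
      using ip[of k] walk_integrable[of k] by (simp add: ln_moment_def mass_def)
  qed
  have lm: "log_moment \<longlonglongrightarrow> l"
    using tendsto_diff[OF l 1] by simp
  show ?thesis
  proof
    show "(\<lambda>k. ln (real (Suc k)) * mass k) \<longlonglongrightarrow> l"
      using tendsto_diff[OF lm log_moment_mass] by simp
    show "(\<lambda>k. 2 * ln_moment k) \<longlonglongrightarrow> l"
      using tendsto_diff[OF lm 2] by simp
  qed
qed

end

section \<open>Poisson representation of the solution\<close>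

text \<open>The derivative of the remainder of \<open>z k\<close> of order \<open>n + 1\<close> is
  the remainder of \<open>z (Suc k)\<close> of order \<open>n\<close>, so the induction runs over
  all \<open>k\<close> at once. Derivatives are taken only inside the interval, since the equation
  is posed for positive times; continuity covers the initial time.\<close>

lemma taylor_flow_remainder:
  fixes z :: "nat \<Rightarrow> real \<Rightarrow> real"
  assumes cont: "\<And>k. continuous_on {0..T} (z k)"
    and deriv: "\<And>k s. 0 < s \<Longrightarrow> s < T \<Longrightarrow> (z k has_real_derivative z (Suc k) s) (at s)"
    and bound: "\<And>k s. 0 \<le> s \<Longrightarrow> s \<le> T \<Longrightarrow> \<bar>z k s\<bar> \<le> B"
    and t: "0 \<le> t" "t \<le> T"
  shows "\<bar>z k t - (\<Sum>j<n. z (k + j) 0 * (t ^ j / fact j))\<bar> \<le> B * (t ^ n / fact n)"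
  using t
proof (induction n arbitrary: k t)
  case 0
  then show ?case using bound by simp
next
  case (Suc n)
  define p where "p s = (\<Sum>j<Suc n. z (k + j) 0 * (s ^ j / fact j))" for s
  define q where "q s = (\<Sum>j<n. z (Suc k + j) 0 * (s ^ j / fact j))" for s
  have fact_deriv: "((\<lambda>s. s ^ Suc j / fact (Suc j)) has_real_derivative s ^ j / fact j) (at s)" for j and s :: real
    by (rule derivative_eq_intros refl | simp add: field_simps del: of_nat_Suc fact_Suc)+
      (simp add: field_simps)
  have p_eq: "p s = z k 0 + (\<Sum>j<n. z (Suc k + j) 0 * (s ^ Suc j / fact (Suc j)))" for s
    unfolding p_def by (subst sum.lessThan_Suc_shift) simp
  have p_deriv: "(p has_real_derivative q s) (at s)" for s
  proof -
    have "((\<lambda>s. z k 0 + (\<Sum>j<n. z (Suc k + j) 0 * (s ^ Suc j / fact (Suc j)))) has_real_derivative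
        0 + (\<Sum>j<n. z (Suc k + j) 0 * (s ^ j / fact j))) (at s)"
      by (intro DERIV_add DERIV_const DERIV_sum DERIV_cmult fact_deriv)
    then show ?thesis
      by (simp only: p_eq[abs_def] q_def add_0_left)
  qed
  have p0: "p 0 = z k 0"
    by (simp add: p_eq)
  have cont_p: "continuous_on A p" for A
    using p_deriv by (intro DERIV_continuous_on) (auto intro: has_field_derivative_at_within)
  have cont_pow: "continuous_on A (\<lambda>s::real. B * (s ^ Suc n / fact (Suc n)))" for A
    by (intro continuous_intros) simp
  have bound': "\<bar>z (Suc k) s - q s\<bar> \<le> B * (s ^ n / fact n)" if "0 \<le> s" "s \<le> T" for s
    using Suc.IH[OF that, of "Suc k"] by (simp add: q_def)
  \<comment> \<open>The two signs \<open>c\<close> split the absolute value. In each case the gap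
    between the bound and the signed remainder is 0 at time 0 and has nonnegative
    derivative.\<close>
  have side: "c * (z k t - p t) \<le> B * (t ^ Suc n / fact (Suc n))" if c: "\<bar>c\<bar> = 1" for c :: real
  proof -
    let ?h = "\<lambda>s. B * (s ^ Suc n / fact (Suc n)) - c * (z k s - p s)"
    have "?h 0 \<le> ?h t"
    proof (rule DERIV_nonneg_imp_increasing_open[OF Suc.prems(1)])
      fix s assume s: "0 < s" "s < t"
      have "(?h has_real_derivative B * (s ^ n / fact n) - c * (z (Suc k) s - q s)) (at s)"
        using s Suc.prems by (intro DERIV_diff DERIV_cmult deriv p_deriv fact_deriv) auto
      moreover have "c * (z (Suc k) s - q s) \<le> \<bar>z (Suc k) s - q s\<bar>"
        using c abs_ge_self[of "c * (z (Suc k) s - q s)"] by (simp add: abs_mult)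
      ultimately show "\<exists>y. (?h has_real_derivative y) (at s) \<and> 0 \<le> y"
        using bound'[of s] s Suc.prems by fastforce
    next
      have "{0..t} \<subseteq> {0..T}" using Suc.prems by auto
      then show "continuous_on {0..t} ?h"
        by (intro continuous_on_diff continuous_on_mult continuous_on_const cont_p cont_pow
            continuous_on_subset[OF cont])
    qed
    then show ?thesis by (simp add: p0)
  qed
  show ?case
    using side[of 1] side[of "-1"] unfolding p_def[symmetric] abs_le_iff by simp
qed

lemma taylor_flow_sums:
  fixes z :: "nat \<Rightarrow> real \<Rightarrow> real"
  assumes "\<And>k. continuous_on {0..T} (z k)"
    and "\<And>k s. 0 < s \<Longrightarrow> s < T \<Longrightarrow> (z k has_real_derivative z (Suc k) s) (at s)"
    and "\<And>k s. 0 \<le> s \<Longrightarrow> s \<le> T \<Longrightarrow> \<bar>z k s\<bar> \<le> B"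
    and T: "0 \<le> T"
  shows "(\<lambda>j. z j 0 * (T ^ j / fact j)) sums z 0 T"
proof -
  have "(\<lambda>n. B * (T ^ n / fact n)) \<longlonglongrightarrow> B * 0"
    using summable_LIMSEQ_zero[OF summable_exp, of T]
    by (intro tendsto_mult tendsto_const) (simp add: field_simps)
  moreover have "\<bar>(\<Sum>j<n. z j 0 * (T ^ j / fact j)) - z 0 T\<bar> \<le> B * (T ^ n / fact n)" for n
    using taylor_flow_remainder[of T z B T 0 n] assms by (simp add: abs_minus_commute)
  ultimately have "(\<lambda>n. (\<Sum>j<n. z j 0 * (T ^ j / fact j)) - z 0 T) \<longlonglongrightarrow> 0"
    using Lim_null_comparison[of "\<lambda>n. (\<Sum>j<n. z j 0 * (T ^ j / fact j)) - z 0 T" "\<lambda>n. B * (T ^ n / fact n)" sequentially]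
    by (simp only: real_norm_def mult_zero_right eventually_True)
  then show ?thesis
    unfolding sums_def by (simp add: LIM_zero_iff)
qed

section \<open>Passage between Lebesgue and Borel measurable functions\<close>

lemma integrable_mult_bounded_lebesgue:
  fixes f g :: "'a::euclidean_space \<Rightarrow> real"
  assumes f: "integrable lebesgue f" and g: "g \<in> borel_measurable borel" and C: "\<And>x. \<bar>g x\<bar> \<le> C"
  shows "integrable lebesgue (\<lambda>x. f x * g x)"
proof (rule Bochner_Integration.integrable_bound)
  show "integrable lebesgue (\<lambda>x. C * f x)"
    using f by simp
  show "(\<lambda>x. f x * g x) \<in> borel_measurable lebesgue"
    by (intro borel_measurable_times borel_measurable_integrable[OF f] measurable_completion) (use g in simp)
  have "\<bar>f x\<bar> * \<bar>g x\<bar> \<le> \<bar>f x\<bar> * \<bar>C\<bar>" for x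
    using C[of x] by (intro mult_left_mono) auto
  then show "AE x in lebesgue. norm (f x * g x) \<le> norm (C * f x)"
    by (simp add: abs_mult mult.commute)
qed

lemma lebesgue_borel_version:
  fixes f :: "'a::euclidean_space \<Rightarrow> real"
  assumes f: "f \<in> borel_measurable lebesgue"
  obtains g where "g \<in> borel_measurable borel" "AE x in lborel. f x = g x"
  using completion_ex_borel_measurable_real[OF f] by auto

text \<open>The solution is only Lebesgue measurable, whereas convolution duality is available for
  Borel functions; integrals against Borel weights do not see the difference.\<close>

lemma
  fixes f g \<phi> :: "'a::euclidean_space \<Rightarrow> real"
  assumes f: "f \<in> borel_measurable lebesgue" and g: "g \<in> borel_measurable borel"
    and ae: "AE x in lborel. f x = g x" and \<phi>: "\<phi> \<in> borel_measurable borel"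
  shows integral_borel_version: "(LINT x|lebesgue. f x * \<phi> x) = (LINT x|lborel. g x * \<phi> x)"
    and integrable_borel_version: "integrable lebesgue (\<lambda>x. f x * \<phi> x) \<longleftrightarrow> integrable lborel (\<lambda>x. g x * \<phi> x)"
proof -
  have m: "(\<lambda>x. f x * \<phi> x) \<in> borel_measurable lebesgue" "(\<lambda>x. g x * \<phi> x) \<in> borel_measurable lebesgue"
    by (intro borel_measurable_times f measurable_completion; use g \<phi> in simp)+
  have ae': "AE x in lebesgue. f x * \<phi> x = g x * \<phi> x"
    using AE_completion[OF ae] by eventually_elim simp
  have "(LINT x|lebesgue. f x * \<phi> x) = (LINT x|lebesgue. g x * \<phi> x)"
    by (rule integral_cong_AE[OF m ae'])
  also have "\<dots> = (LINT x|lborel. g x * \<phi> x)"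
    using g \<phi> by (intro integral_completion) simp
  finally show "(LINT x|lebesgue. f x * \<phi> x) = (LINT x|lborel. g x * \<phi> x)" .
  have "integrable lebesgue (\<lambda>x. f x * \<phi> x) \<longleftrightarrow> integrable lebesgue (\<lambda>x. g x * \<phi> x)"
    by (rule integrable_cong_AE[OF m ae'])
  also have "\<dots> \<longleftrightarrow> integrable lborel (\<lambda>x. g x * \<phi> x)"
    using g \<phi> by (intro integrable_completion) simp
  finally show "integrable lebesgue (\<lambda>x. f x * \<phi> x) \<longleftrightarrow> integrable lborel (\<lambda>x. g x * \<phi> x)" .
qed

locale exterior_flow = killed_walk +
  fixes u :: "real \<Rightarrow> real ^ 2 \<Rightarrow> real"
  assumes solution: "exterior_solution J H f0 u"
begin

lemma u_integrable: "0 \<le> t \<Longrightarrow> integrable lebesgue (u t)"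
  using solution by (simp add: exterior_solution_def)

lemma u_measurable: "0 \<le> t \<Longrightarrow> u t \<in> borel_measurable lebesgue"
  using borel_measurable_integrable[OF u_integrable] .

lemma u_H: "0 \<le> t \<Longrightarrow> AE x in lebesgue. x \<in> H \<longrightarrow> u t x = 0"
proof (cases "t = 0")
  case True
  have "AE x in lebesgue. u 0 x = f0 x"
    using solution by (simp add: exterior_solution_def)
  then have "AE x in lebesgue. x \<in> H \<longrightarrow> u 0 x = 0"
    by eventually_elim (simp add: f0_H)
  then show ?thesis using True by simp
qed (use solution in \<open>simp add: exterior_solution_def\<close>)

section \<open>Weak form of the equation\<close>

definition pairing :: "(real ^ 2 \<Rightarrow> real) \<Rightarrow> real \<Rightarrow> real" where
  "pairing \<phi> t = (LINT x|lebesgue. u t x * \<phi> x)"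

text \<open>One step of the walk convolves and then cuts off, so its adjoint cuts off first and
  convolves afterwards. It does not increase the sup norm.\<close>

definition killed_adjoint :: "(real ^ 2 \<Rightarrow> real) \<Rightarrow> real ^ 2 \<Rightarrow> real" where
  "killed_adjoint \<phi> = convolution J (\<lambda>x. indicator (- H) x * \<phi> x)"

lemma killed_adjoint_measurable [measurable]: "\<phi> \<in> borel_measurable borel \<Longrightarrow> killed_adjoint \<phi> \<in> borel_measurable borel"
  unfolding killed_adjoint_def by measurable

lemma killed_adjoint_bound:
  assumes [measurable]: "\<phi> \<in> borel_measurable borel" and C: "\<And>x. \<bar>\<phi> x\<bar> \<le> C"
  shows "\<bar>killed_adjoint \<phi> x\<bar> \<le> C"
  unfolding killed_adjoint_def
proof (rule abs_convolution_le)
  show "\<bar>indicator (- H) y * \<phi> y\<bar> \<le> C" for y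
    using C[of y] order_trans[OF abs_ge_zero C[of y]] by (simp add: indicator_def)
qed measurable

lemma pairing_diff_le:
  assumes \<phi>: "\<phi> \<in> borel_measurable borel" "\<And>x. \<bar>\<phi> x\<bar> \<le> C" and st: "0 \<le> s" "0 \<le> t"
  shows "\<bar>pairing \<phi> s - pairing \<phi> t\<bar> \<le> C * (LINT x|lebesgue. \<bar>u s x - u t x\<bar>)"
proof -
  have i: "integrable lebesgue (\<lambda>x. u s x * \<phi> x)" "integrable lebesgue (\<lambda>x. u t x * \<phi> x)"
    by (rule integrable_mult_bounded_lebesgue[OF u_integrable \<phi>]; use st in simp)+
  have "\<bar>pairing \<phi> s - pairing \<phi> t\<bar> = \<bar>LINT x|lebesgue. u s x * \<phi> x - u t x * \<phi> x\<bar>"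
    using i by (simp add: pairing_def)
  also have "\<dots> \<le> (LINT x|lebesgue. \<bar>u s x * \<phi> x - u t x * \<phi> x\<bar>)"
    by (rule integral_abs_bound)
  also have "\<dots> \<le> (LINT x|lebesgue. C * \<bar>u s x - u t x\<bar>)"
  proof (rule integral_mono)
    show "\<bar>u s x * \<phi> x - u t x * \<phi> x\<bar> \<le> C * \<bar>u s x - u t x\<bar>" for x
      using mult_right_mono[OF \<phi>(2)[of x] abs_ge_zero[of "u s x - u t x"]]
      by (simp add: abs_mult[symmetric] algebra_simps)
  qed (use i u_integrable st in auto)
  finally show ?thesis by simp
qed

lemma continuous_on_pairing:
  assumes \<phi>: "\<phi> \<in> borel_measurable borel" "\<And>x. \<bar>\<phi> x\<bar> \<le> C"
  shows "continuous_on {0..} (pairing \<phi>)"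
  unfolding continuous_on_def
proof
  fix t :: real assume t: "t \<in> {0..}"
  have "((\<lambda>s. C * (LINT x|lebesgue. \<bar>u s x - u t x\<bar>)) \<longlongrightarrow> C * 0) (at t within {0..})"
    using solution t by (intro tendsto_mult tendsto_const) (simp add: exterior_solution_def)
  then have lim: "((\<lambda>s. C * (LINT x|lebesgue. \<bar>u s x - u t x\<bar>)) \<longlongrightarrow> 0) (at t within {0..})"
    by simp
  have "((\<lambda>s. pairing \<phi> s - pairing \<phi> t) \<longlongrightarrow> 0) (at t within {0..})"
  proof (rule Lim_null_comparison[OF _ lim])
    show "\<forall>\<^sub>F s in at t within {0..}. norm (pairing \<phi> s - pairing \<phi> t) \<le> C * (LINT x|lebesgue. \<bar>u s x - u t x\<bar>)"
      using t pairing_diff_le[OF \<phi>] by (auto simp: eventually_at_filter)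
  qed
  then show "(pairing \<phi> \<longlongrightarrow> pairing \<phi> t) (at t within {0..})"
    by (rule LIM_zero_cancel)
qed

text \<open>The equation holds only outside \<open>H\<close>, but \<open>u\<close> vanishes in
  \<open>H\<close>, so \<open>\<phi>\<close> may be cut off there without changing the pairing. The
  \<open>L^1\<close> derivative then tests against the cut-off function, and duality turns its
  convolution into \<open>killed_adjoint\<close>.\<close>

lemma pairing_deriv:
  assumes \<phi>: "\<phi> \<in> borel_measurable borel" and C: "\<And>x. \<bar>\<phi> x\<bar> \<le> C" and t: "0 < t"
  shows "(pairing \<phi> has_real_derivative pairing (killed_adjoint \<phi>) t - pairing \<phi> t) (at t)"
proof -
  note [measurable] = \<phi>
  define q where "q x = indicator (- H) x * \<phi> x" for x
  have q_meas [measurable]: "q \<in> borel_measurable borel"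
    unfolding q_def[abs_def] by measurable
  have C0: "0 \<le> C" using order_trans[OF abs_ge_zero C] .
  have q: "\<bar>q x\<bar> \<le> C" for x
    using C[of x] C0 by (simp add: q_def indicator_def)
  have pq: "pairing q s = pairing \<phi> s" if s: "0 \<le> s" for s
    unfolding pairing_def
  proof (rule integral_cong_AE)
    show "(\<lambda>x. u s x * q x) \<in> borel_measurable lebesgue" "(\<lambda>x. u s x * \<phi> x) \<in> borel_measurable lebesgue"
      by (intro borel_measurable_times u_measurable[OF s] measurable_completion; simp)+
    show "AE x in lebesgue. u s x * q x = u s x * \<phi> x"
      using u_H[OF s] by eventually_elim (auto simp: q_def indicator_def)
  qed
  obtain g where g [measurable]: "g \<in> borel_measurable borel" and ug: "AE x in lborel. u t x = g x"
    using lebesgue_borel_version u_measurable t by (metis less_imp_le)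
  have ut: "u t \<in> borel_measurable lebesgue" using u_measurable t by simp
  have g_int: "integrable lborel g"
    using integrable_borel_version[OF ut g ug, of "\<lambda>_. 1"] u_integrable t by simp
  have conv_g: "convolution J (u t) x = convolution J g x" for x
    using integral_borel_version[OF ut g ug, of "\<lambda>y. J (x - y)"]
    by (simp add: convolution_eq) (simp add: convolution_def mult.commute)
  note dual1 = convolution_duality[of J d g "\<lambda>_. 1" "\<lambda>_. 1", OF J_integrable J_nonneg J_even J_zero g]
  have conv_g_int: "integrable lborel (convolution J g)"
    using dual1(2) g_int by simp
  have dual: "(LINT x|lborel. convolution J g x * q x) = (LINT y|lborel. g y * convolution J q y)"
    by (rule convolution_duality(3)[OF J_integrable J_nonneg J_even J_zero g q_meas, where W = "\<lambda>_. C"])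
      (use q g_int in auto)
  define L where "L = nonlocal_op J (u t)"
  have L_eq: "L x = convolution J g x - u t x" for x
    by (simp add: L_def nonlocal_op_def conv_g)
  have conv_int: "integrable lebesgue (convolution J g)"
    using conv_g_int by (subst integrable_completion) simp_all
  have L_int: "integrable lebesgue L"
    unfolding L_eq[abs_def] using conv_int u_integrable t by simp
  have L_pair: "(LINT x|lebesgue. L x * q x) = pairing (killed_adjoint \<phi>) t - pairing \<phi> t"
  proof -
    have "(LINT x|lebesgue. L x * q x) = (LINT x|lebesgue. convolution J g x * q x - u t x * q x)"
      by (simp add: L_eq algebra_simps)
    also have "\<dots> = (LINT x|lebesgue. convolution J g x * q x) - pairing q t"
      using integrable_mult_bounded_lebesgue[OF conv_int q_meas q]
        integrable_mult_bounded_lebesgue[OF u_integrable q_meas q, of t] t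
      by (simp add: pairing_def)
    also have "(LINT x|lebesgue. convolution J g x * q x) = (LINT x|lborel. convolution J g x * q x)"
      by (rule integral_completion) measurable
    also have "\<dots> = (LINT x|lborel. g x * killed_adjoint \<phi> x)"
    proof -
      have "killed_adjoint \<phi> = convolution J q"
        by (simp add: killed_adjoint_def q_def[abs_def])
      then show ?thesis
        by (simp only: dual)
    qed
    also have "\<dots> = pairing (killed_adjoint \<phi>) t"
      unfolding pairing_def using \<phi> by (intro integral_borel_version[OF ut g ug, symmetric]) simp
    finally show ?thesis
      using pq t by simp
  qed
  define N where "N h = (LINT x:- H|lebesgue. \<bar>(u (t + h) x - u t x) / h - L x\<bar>)" for h
  have N: "(N \<longlongrightarrow> 0) (at 0)"
    using solution t unfolding N_def L_def exterior_solution_def by blast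
  \<comment> \<open>\<open>|h| < t\<close> keeps \<open>t + h\<close> among the times at which
    \<open>u\<close> is integrable and vanishes in \<open>H\<close>. The cut-off \<open>q\<close>
    restricts the error to the complement of \<open>H\<close>, where \<open>N\<close> controls
    it.\<close>
  have bound: "\<bar>(pairing \<phi> (t + h) - pairing \<phi> t) / h - (pairing (killed_adjoint \<phi>) t - pairing \<phi> t)\<bar> \<le> C * N h"
    if h: "\<bar>h\<bar> < t" for h
  proof -
    have th: "0 \<le> t + h" "0 \<le> t" using h t by auto
    let ?e = "\<lambda>x. (u (t + h) x - u t x) / h - L x"
    have e_int: "integrable lebesgue ?e"
      using u_integrable[OF th(1)] u_integrable[OF th(2)] L_int by simp
    have iq: "integrable lebesgue (\<lambda>x. u (t + h) x * q x)" "integrable lebesgue (\<lambda>x. u t x * q x)"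
      "integrable lebesgue (\<lambda>x. L x * q x)"
      using integrable_mult_bounded_lebesgue[OF u_integrable q_meas q] th
        integrable_mult_bounded_lebesgue[OF L_int q_meas q] by auto
    have "(LINT x|lebesgue. ?e x * q x)
        = (LINT x|lebesgue. (u (t + h) x * q x - u t x * q x) / h - L x * q x)"
      by (simp add: left_diff_distrib)
    also have "\<dots> = (pairing q (t + h) - pairing q t) / h - (LINT x|lebesgue. L x * q x)"
      using iq by (simp add: pairing_def)
    finally have "\<bar>(pairing \<phi> (t + h) - pairing \<phi> t) / h - (pairing (killed_adjoint \<phi>) t - pairing \<phi> t)\<bar>
        = \<bar>LINT x|lebesgue. ?e x * q x\<bar>"
      using pq th L_pair by simp
    also have "\<dots> \<le> (LINT x|lebesgue. \<bar>?e x * q x\<bar>)"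
      by (rule integral_abs_bound)
    also have "\<dots> \<le> (LINT x|lebesgue. C * (\<bar>?e x\<bar> * indicator (- H) x))"
    proof (rule integral_mono)
      show "integrable lebesgue (\<lambda>x. \<bar>?e x * q x\<bar>)"
        using integrable_mult_bounded_lebesgue[OF e_int q_meas q] by simp
      show "integrable lebesgue (\<lambda>x. C * (\<bar>?e x\<bar> * indicator (- H) x))"
        using integrable_mult_bounded_lebesgue[OF integrable_abs[OF e_int], of "indicator (- H)" 1]
        by (simp add: indicator_def)
      show "\<bar>?e x * q x\<bar> \<le> C * (\<bar>?e x\<bar> * indicator (- H) x)" for x
        using mult_right_mono[OF C[of x] abs_ge_zero[of "?e x"]]
        by (auto simp: q_def indicator_def abs_mult mult_ac)
    qed
    also have "\<dots> = C * N h"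
      by (simp add: N_def set_lebesgue_integral_def mult.commute)
    finally show ?thesis .
  qed
  have CN: "((\<lambda>h. C * N h) \<longlongrightarrow> 0) (at 0)"
    using tendsto_mult[OF tendsto_const[of C] N] by simp
  have "((\<lambda>h. (pairing \<phi> (t + h) - pairing \<phi> t) / h - (pairing (killed_adjoint \<phi>) t - pairing \<phi> t)) \<longlongrightarrow> 0) (at 0)"
  proof (rule Lim_null_comparison[OF _ CN])
    show "\<forall>\<^sub>F h in at 0. norm ((pairing \<phi> (t + h) - pairing \<phi> t) / h - (pairing (killed_adjoint \<phi>) t - pairing \<phi> t)) \<le> C * N h"
      unfolding eventually_at using bound t by (intro exI[of _ t]) (auto simp: dist_real_def)
  qed
  then show ?thesis
    unfolding DERIV_def by (rule LIM_zero_cancel)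
qed

text \<open>The innermost adjoint step is peeled off, so the induction hypothesis is applied to
  \<open>killed_adjoint \<phi>\<close> and has to range over all bounded test functions.\<close>

lemma killed_adjoint_walk:
  assumes [measurable]: "\<phi> \<in> borel_measurable borel" and C: "\<And>x. \<bar>\<phi> x\<bar> \<le> C"
  shows "(LINT x|lborel. f0 x * (killed_adjoint ^^ k) \<phi> x) = (LINT x|lborel. walk k x * \<phi> x)"
  using assms
proof (induction k arbitrary: \<phi>)
  case (Suc k)
  note [measurable] = Suc.prems(1)
  let ?q = "\<lambda>x. indicator (- H) x * \<phi> x"
  have q: "\<bar>?q x\<bar> \<le> C + 0 * (norm x)\<^sup>2" for x
    using Suc.prems(2)[of x] order_trans[OF abs_ge_zero Suc.prems(2)[of x]] by (simp add: indicator_def)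
  have "(LINT x|lborel. f0 x * (killed_adjoint ^^ Suc k) \<phi> x) = (LINT x|lborel. f0 x * (killed_adjoint ^^ k) (killed_adjoint \<phi>) x)"
    by (simp only: funpow_Suc_right comp_apply)
  also have "\<dots> = (LINT x|lborel. walk k x * killed_adjoint \<phi> x)"
    by (rule Suc.IH) (use killed_adjoint_bound[OF Suc.prems] Suc.prems(1) in auto)
  also have "\<dots> = (LINT x|lborel. convolution J (walk k) x * ?q x)"
    unfolding killed_adjoint_def
    by (rule convolution_dual(3)[OF walk_density walk_moment, symmetric, OF _ q]) simp_all
  also have "\<dots> = (LINT x|lborel. walk (Suc k) x * \<phi> x)"
    by (simp add: walk_Suc mult_ac)
  finally show ?case .
qed simp

text \<open>The functions \<open>z\<^sub>k(t) = e\<^sup>t \<langle>u(t), T\<^sup>k \<phi>\<rangle>\<close> with \<open>T\<close> the adjoint of the killed step satisfy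
  \<open>z\<^sub>k' = z\<^sub>k\<^sub>+\<^sub>1\<close>, so Taylor's formula gives uniqueness and the Poisson representation at once.\<close>

lemma pairing_poisson_bounded:
  assumes \<phi>: "\<phi> \<in> borel_measurable borel" "\<And>x. \<bar>\<phi> x\<bar> \<le> C" and t: "0 \<le> t"
  shows "pairing \<phi> t = poisson_mean t (\<lambda>k. LINT x|lborel. walk k x * \<phi> x)"
proof -
  define z where "z k s = exp s * pairing ((killed_adjoint ^^ k) \<phi>) s" for k s
  have ak: "(killed_adjoint ^^ k) \<phi> \<in> borel_measurable borel" "\<bar>(killed_adjoint ^^ k) \<phi> x\<bar> \<le> C" for k x
  proof (induction k arbitrary: x)
    case (Suc k)
    {
      case 1
      then show ?case using Suc(1) by simp
    next
      case 2
      then show ?case using killed_adjoint_bound[OF Suc] by simp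
    }
  qed (use \<phi> in simp_all)
  have cont: "continuous_on {0..t} (z k)" for k
    unfolding z_def
    by (intro continuous_intros continuous_on_subset[OF continuous_on_pairing[OF ak]]) auto
  have deriv: "(z k has_real_derivative z (Suc k) s) (at s)" if "0 < s" "s < t" for k s
  proof -
    have "(z k has_real_derivative exp s * pairing ((killed_adjoint ^^ k) \<phi>) s
        + (pairing (killed_adjoint ((killed_adjoint ^^ k) \<phi>)) s - pairing ((killed_adjoint ^^ k) \<phi>) s) * exp s) (at s)"
      unfolding z_def by (intro DERIV_mult DERIV_exp pairing_deriv[OF ak that(1)])
    then show ?thesis
      by (simp add: z_def algebra_simps)
  qed
  \<comment> \<open>Taylor's formula needs one bound for all \<open>k\<close>. As the adjoint is a
    sup norm contraction, the \<open>L^1\<close> norm of \<open>u\<close>, continuous and hence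
    bounded on compact time intervals, provides it.\<close>
  define n where "n s = (LINT x|lebesgue. \<bar>u s x\<bar>)" for s
  have zn: "\<bar>pairing ((killed_adjoint ^^ k) \<phi>) s\<bar> \<le> C * n s" if s: "0 \<le> s" for k s
  proof -
    have "\<bar>pairing ((killed_adjoint ^^ k) \<phi>) s\<bar> \<le> (LINT x|lebesgue. \<bar>u s x * (killed_adjoint ^^ k) \<phi> x\<bar>)"
      unfolding pairing_def by (rule integral_abs_bound)
    also have "\<dots> \<le> (LINT x|lebesgue. C * \<bar>u s x\<bar>)"
    proof (rule integral_mono)
      show "\<bar>u s x * (killed_adjoint ^^ k) \<phi> x\<bar> \<le> C * \<bar>u s x\<bar>" for x
        using mult_right_mono[OF ak(2)[of k x] abs_ge_zero[of "u s x"]] by (simp add: abs_mult mult.commute)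
    qed (use integrable_mult_bounded_lebesgue[OF u_integrable ak] u_integrable s in auto)
    finally show ?thesis by (simp add: n_def)
  qed
  have n_cont: "continuous_on {0..} n"
    unfolding continuous_on_def
  proof
    fix s :: real assume s: "s \<in> {0..}"
    have lim: "((\<lambda>r. LINT x|lebesgue. \<bar>u r x - u s x\<bar>) \<longlongrightarrow> 0) (at s within {0..})"
      using solution s by (simp add: exterior_solution_def)
    have "\<bar>n r - n s\<bar> \<le> (LINT x|lebesgue. \<bar>u r x - u s x\<bar>)" if r: "0 \<le> r" for r
    proof -
      have "\<bar>n r - n s\<bar> = \<bar>LINT x|lebesgue. \<bar>u r x\<bar> - \<bar>u s x\<bar>\<bar>"
        using u_integrable r s by (simp add: n_def)
      also have "\<dots> \<le> (LINT x|lebesgue. \<bar>\<bar>u r x\<bar> - \<bar>u s x\<bar>\<bar>)"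
        by (rule integral_abs_bound)
      also have "\<dots> \<le> (LINT x|lebesgue. \<bar>u r x - u s x\<bar>)"
        using u_integrable r s by (intro integral_mono) auto
      finally show ?thesis .
    qed
    then have "((\<lambda>r. n r - n s) \<longlongrightarrow> 0) (at s within {0..})"
      by (intro Lim_null_comparison[OF _ lim]) (auto simp: eventually_at_filter)
    then show "(n \<longlongrightarrow> n s) (at s within {0..})"
      by (rule LIM_zero_cancel)
  qed
  have "compact ((\<lambda>s. exp s * (C * n s)) ` {0..t})"
    by (intro compact_continuous_image continuous_intros continuous_on_subset[OF n_cont]) auto
  then have "bounded ((\<lambda>s. exp s * (C * n s)) ` {0..t})"
    by (rule compact_imp_bounded)
  then obtain B where "\<forall>y\<in>(\<lambda>s. exp s * (C * n s)) ` {0..t}. norm y \<le> B"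
    unfolding bounded_iff by blast
  then have B: "\<bar>exp s * (C * n s)\<bar> \<le> B" if "0 \<le> s" "s \<le> t" for s
    using that by auto
  have zB: "\<bar>z k s\<bar> \<le> B" if s: "0 \<le> s" "s \<le> t" for k s
  proof -
    have "\<bar>z k s\<bar> = exp s * \<bar>pairing ((killed_adjoint ^^ k) \<phi>) s\<bar>"
      by (simp add: z_def abs_mult)
    also have "\<dots> \<le> exp s * (C * n s)"
      using zn[OF s(1)] by (intro mult_left_mono) auto
    finally show ?thesis
      using B[OF s] by linarith
  qed
  have z0: "z k 0 = (LINT x|lborel. walk k x * \<phi> x)" for k
  proof -
    have u0: "AE x in lborel. u 0 x = f0 x"
      using solution by (simp add: exterior_solution_def AE_completion_iff)
    have "pairing ((killed_adjoint ^^ k) \<phi>) 0 = (LINT x|lborel. f0 x * (killed_adjoint ^^ k) \<phi> x)"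
      unfolding pairing_def
      by (rule integral_borel_version[OF u_measurable nonneg_density.measurable_f[OF f0] u0 ak(1)]) simp
    then show ?thesis
      using killed_adjoint_walk[OF \<phi>] by (simp add: z_def)
  qed
  have "(\<lambda>k. z k 0 * (t ^ k / fact k)) sums z 0 t"
    by (rule taylor_flow_sums[of t z B, OF cont deriv zB t])
  then have "(\<lambda>k. exp (- t) * (z k 0 * (t ^ k / fact k))) sums (exp (- t) * z 0 t)"
    by (rule sums_mult)
  moreover have "exp (- t) * z 0 t = pairing \<phi> t"
    by (simp add: z_def exp_minus)
  ultimately show ?thesis
    by (simp add: z0 poisson_mean_def poisson_def sums_iff mult_ac)
qed

section \<open>The solution as a Poisson mixture\<close>

definition mixture :: "real \<Rightarrow> real ^ 2 \<Rightarrow> real" where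
  "mixture t x = poisson_mean t (\<lambda>k. walk k x)"

lemma walk_le: "\<bar>walk k x\<bar> \<le> C0"
  using nonneg_density.abs_le[OF walk_density] .

lemma mixture_measurable [measurable]: "mixture t \<in> borel_measurable borel"
  unfolding mixture_def[abs_def] poisson_mean_def by measurable

text \<open>Nonnegative terms and a bound uniform in \<open>k\<close> justify termwise integration
  even for unbounded \<open>\<phi>\<close>.\<close>

lemma mixture_integral:
  assumes [measurable]: "\<phi> \<in> borel_measurable borel" and \<phi>: "\<And>x. 0 \<le> \<phi> x" and t: "0 \<le> t"
    and int: "\<And>k. integrable lborel (\<lambda>x. walk k x * \<phi> x)"
    and bound: "\<And>k. (LINT x|lborel. walk k x * \<phi> x) \<le> B"
  shows "integrable lborel (\<lambda>x. mixture t x * \<phi> x)"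
    and "(LINT x|lborel. mixture t x * \<phi> x) = poisson_mean t (\<lambda>k. LINT x|lborel. walk k x * \<phi> x)"
proof -
  let ?f = "\<lambda>k x. poisson t k * walk k x * \<phi> x"
  have nn: "0 \<le> ?f k x" for k x
    using poisson_nonneg[OF t] walk_nonneg \<phi> by simp
  have fint: "integrable lborel (?f k)" for k
    using integrable_mult_right[OF int[of k], of "poisson t k"] by (simp add: mult.assoc)
  have s: "summable (\<lambda>k. poisson t k * walk k x)" for x
    by (rule summable_poisson_bounded[OF t walk_le])
  have eq: "mixture t x * \<phi> x = (\<Sum>k. ?f k x)" for x
    using suminf_mult2[OF s[of x], of "\<phi> x"] by (simp add: mixture_def poisson_mean_def)
  have ae: "AE x in lborel. summable (\<lambda>k. norm (?f k x))"
    using summable_mult2[OF s] nn by simp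
  have ints: "(LINT x|lborel. ?f k x) = poisson t k * (LINT x|lborel. walk k x * \<phi> x)" for k
    by (simp add: mult.assoc)
  have b: "\<bar>LINT x|lborel. walk k x * \<phi> x\<bar> \<le> B" for k
    using bound[of k] walk_nonneg \<phi> by simp
  have sn: "summable (\<lambda>k. LINT x|lborel. norm (?f k x))"
    using summable_poisson_bounded[OF t b] nn ints by simp
  show "integrable lborel (\<lambda>x. mixture t x * \<phi> x)"
    unfolding eq by (rule integrable_suminf[OF fint ae sn])
  show "(LINT x|lborel. mixture t x * \<phi> x) = poisson_mean t (\<lambda>k. LINT x|lborel. walk k x * \<phi> x)"
    unfolding eq poisson_mean_def ints[symmetric] by (rule integral_suminf[OF fint ae sn])
qed

lemma walk_integral_le:
  assumes "A \<in> sets borel"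
  shows "(LINT x|lborel. walk k x * indicator A x) \<le> mass 0"
proof -
  have "(LINT x|lborel. walk k x * indicator A x) \<le> mass k"
    unfolding mass_def using assms walk_nonneg
    by (intro integral_mono walk_integrable walk_integrable_mult[where a = 1 and b = 0])
      (auto simp: indicator_def)
  also have "\<dots> \<le> mass 0"
    using decseqD[OF mass_decseq] by simp
  finally show ?thesis .
qed

text \<open>\<open>pairing_poisson_bounded\<close> does not reach the logarithm. Used with
  indicators of Borel sets it determines \<open>u t\<close> almost everywhere, and unbounded weights
  can then be integrated through the mixture.\<close>

lemma u_eq_mixture:
  assumes t: "0 \<le> t"
  shows "AE x in lborel. u t x = mixture t x"
proof -
  obtain g where g [measurable]: "g \<in> borel_measurable borel" and ug: "AE x in lborel. u t x = g x"
    using lebesgue_borel_version[OF u_measurable[OF t]] by blast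
  have g_int: "integrable lborel g"
    using integrable_borel_version[OF u_measurable[OF t] g ug, of "\<lambda>_. 1"] u_integrable[OF t] by simp
  have mix: "integrable lborel (\<lambda>x. mixture t x * indicator A x)"
    "(LINT x|lborel. mixture t x * indicator A x) = poisson_mean t (\<lambda>k. LINT x|lborel. walk k x * indicator A x)"
    if A: "A \<in> sets borel" for A
    by (rule mixture_integral[OF _ _ t walk_integrable_mult[where a = 1 and b = 0] walk_integral_le];
        use A in \<open>auto simp: indicator_def borel_measurable_indicator\<close>)+
  have "AE x in lborel. g x = mixture t x"
  proof (rule density_unique_real[OF g_int])
    show "integrable lborel (mixture t)"
      using mix(1)[of UNIV] by simp
    fix A :: "(real ^ 2) set" assume "A \<in> sets lborel"
    then have A [measurable]: "A \<in> sets borel" by simp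
    have "(LINT x|lborel. g x * indicator A x) = pairing (indicator A) t"
      unfolding pairing_def by (rule integral_borel_version[OF u_measurable[OF t] g ug, symmetric]) measurable
    also have "\<dots> = (LINT x|lborel. mixture t x * indicator A x)"
      unfolding mix(2)[OF A]
      by (rule pairing_poisson_bounded[where C = 1]) (use t in \<open>auto simp: indicator_def\<close>)
    finally show "(LINT x:A|lborel. g x) = (LINT x:A|lborel. mixture t x)"
      by (simp add: set_lebesgue_integral_def mult.commute)
  qed
  with ug show ?thesis
    by eventually_elim simp
qed

lemma u_integral:
  assumes \<phi>: "\<phi> \<in> borel_measurable borel" "\<And>x. 0 \<le> \<phi> x" and t: "0 \<le> t"
    and int: "\<And>k. integrable lborel (\<lambda>x. walk k x * \<phi> x)"
    and bound: "\<And>k. (LINT x|lborel. walk k x * \<phi> x) \<le> B"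
  shows "integrable lebesgue (\<lambda>x. u t x * \<phi> x)"
    and "(LINT x|lebesgue. u t x * \<phi> x) = poisson_mean t (\<lambda>k. LINT x|lborel. walk k x * \<phi> x)"
  using mixture_integral[OF \<phi> t int bound]
    integral_borel_version[OF u_measurable[OF t] mixture_measurable u_eq_mixture[OF t] \<phi>(1)]
    integrable_borel_version[OF u_measurable[OF t] mixture_measurable u_eq_mixture[OF t] \<phi>(1)]
  by simp_all

text \<open>Total mass and logarithmic moment of \<open>u t\<close> are Poisson averages of those of
  the walk, so \<open>poisson_mean_log\<close> and \<open>poisson_mean_tendsto\<close> carry the
  common limit over.\<close>

theorem exterior_limits:
  "(\<forall>t\<ge>0. integrable lebesgue (\<lambda>x. u t x * ln (norm x))) \<and>
    (\<exists>l. ((\<lambda>t. ln t * (LINT x|lebesgue. u t x)) \<longlongrightarrow> l) at_top \<and>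
         ((\<lambda>t. 2 * (LINT x|lebesgue. u t x * ln (norm x))) \<longlongrightarrow> l) at_top)"
proof -
  obtain l where l: "(\<lambda>k. ln (real (Suc k)) * mass k) \<longlonglongrightarrow> l" "(\<lambda>k. 2 * ln_moment k) \<longlonglongrightarrow> l"
    using walk_limit by blast
  have "(\<lambda>k. (1 / 2) * (2 * ln_moment k)) \<longlonglongrightarrow> (1 / 2) * l"
    by (intro tendsto_mult tendsto_const l)
  then have lm: "ln_moment \<longlonglongrightarrow> l / 2" by simp
  obtain B where B: "\<And>k. \<bar>ln_moment k\<bar> \<le> B"
    using LIMSEQ_bounded[OF lm] by blast
  have ip: "integrable lborel (\<lambda>x. walk k x * ln_pos x)" for k
    by (rule walk_integrable_mult[OF measurable_ln_pos ln_pos_quadratic])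
  have M: "(LINT x|lebesgue. u t x) = poisson_mean t mass" if t: "0 \<le> t" for t
  proof -
    have "(LINT x|lborel. walk k x * 1) \<le> mass 0" for k
      using decseqD[OF mass_decseq, of 0 k] by (simp add: mass_def)
    then show ?thesis
      using u_integral(2)[of "\<lambda>_. 1" t "mass 0"] walk_integrable t by (simp add: mass_def[abs_def])
  qed
  have pos: "integrable lebesgue (\<lambda>x. u t x * ln_pos x)" "(LINT x|lebesgue. u t x * ln_pos x) = poisson_mean t ln_moment"
    if t: "0 \<le> t" for t
    using u_integral[OF measurable_ln_pos ln_pos_nonneg t ip, of B] B
    by (auto simp: ln_moment_def[abs_def] abs_le_iff)
  have meas_ln: "(\<lambda>x. u t x * ln_pos x) \<in> borel_measurable lebesgue" "(\<lambda>x. u t x * ln (norm x)) \<in> borel_measurable lebesgue"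
    if t: "0 \<le> t" for t
    by (intro borel_measurable_times u_measurable[OF t] measurable_completion; simp)+
  \<comment> \<open>The two logarithms can differ only inside \<open>ball 0 2\<close>, a part of the
    hole.\<close>
  have ae: "AE x in lebesgue. u t x * ln_pos x = u t x * ln (norm x)" if t: "0 \<le> t" for t
    using u_H[OF t]
  proof eventually_elim
    case (elim x)
    show ?case
    proof (cases "norm x < 2")
      case True
      then have "x \<in> H" using ball_H by auto
      then show ?thesis using elim by simp
    qed (simp add: ln_pos_def)
  qed
  have I: "integrable lebesgue (\<lambda>x. u t x * ln (norm x))" if t: "0 \<le> t" for t
    using pos(1)[OF t] integrable_cong_AE[OF meas_ln[OF t] ae[OF t]] by simp
  have L: "2 * (LINT x|lebesgue. u t x * ln (norm x)) = poisson_mean t (\<lambda>k. 2 * ln_moment k)" if t: "0 \<le> t" for t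
    using pos(2)[OF t] integral_cong_AE[OF meas_ln[OF t] ae[OF t]] poisson_mean_cmult[OF t B, of 2] by simp
  have ev: "\<forall>\<^sub>F t in at_top. (0::real) \<le> t" by (rule eventually_ge_at_top)
  have "((\<lambda>t. ln t * (LINT x|lebesgue. u t x)) \<longlongrightarrow> l) at_top"
    by (rule Lim_transform_eventually[OF poisson_mean_log[OF mass_tendsto_0 l(1)] eventually_mono[OF ev]])
      (simp add: M)
  moreover have "((\<lambda>t. 2 * (LINT x|lebesgue. u t x * ln (norm x))) \<longlongrightarrow> l) at_top"
    by (rule Lim_transform_eventually[OF poisson_mean_tendsto[OF l(2)] eventually_mono[OF ev]])
      (simp only: L)
  ultimately show ?thesis
    using I by blast
qed

end

text \<open>The integrability clause ensures that the second limit concerns genuine integrals and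
  not the default value 0.\<close>

theorem proposition4p2:
  fixes H :: "(real ^ 2) set" and R d :: real
    and J u0 :: "real ^ 2 \<Rightarrow> real" and u :: "real \<Rightarrow> real ^ 2 \<Rightarrow> real"
  assumes "H \<noteq> {}" and "bounded H" and "open H"
    and "2 < R" and "ball 0 2 \<subseteq> H" and "H \<subseteq> ball 0 R"
    and "C2_on_space J" and "compactly_supported J" and "radially_symmetric J"
    and "0 < d"
    and "\<And>x. norm x < d \<Longrightarrow> 0 < J x" and "\<And>x. d \<le> norm x \<Longrightarrow> J x = 0"
    and "(LINT x|lebesgue. J x) = 1"
    and "AE x in lebesgue. 0 \<le> u0 x"
    and "AE x in lebesgue. x \<in> H \<longrightarrow> u0 x = 0"
    and "Linfty u0"
    and "integrable lebesgue (\<lambda>x. u0 x * ln (norm x))"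
    and "integrable lebesgue (\<lambda>x. u0 x * (norm x)\<^sup>2)"
    and "exterior_solution J H u0 u"
  shows "(\<forall>t\<ge>0. integrable lebesgue (\<lambda>x. u t x * ln (norm x))) \<and>
    (\<exists>l. ((\<lambda>t. ln t * (LINT x|lebesgue. u t x)) \<longlongrightarrow> l) at_top \<and>
         ((\<lambda>t. 2 * (LINT x|lebesgue. u t x * ln (norm x))) \<longlongrightarrow> l) at_top)"
proof -
  obtain J' where "\<forall>x. (J has_derivative blinfun_apply (J' x)) (at x)"
    using assms(7) unfolding C2_on_space_def by blast
  then have "\<forall>x\<in>UNIV. isCont J x"
    using has_derivative_continuous by blast
  then have cont: "continuous_on UNIV J"
    by (rule continuous_at_imp_continuous_on)
  then have [measurable]: "J \<in> borel_measurable borel"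
    by (rule borel_measurable_continuous_onI)
  have total: "(LINT x|lborel. J x) = 1"
    using assms(13) by (subst (asm) integral_completion) simp_all
  have H [measurable]: "H \<in> sets borel"
    using assms(3) by simp
  obtain C where u0: "u0 \<in> borel_measurable lebesgue" and C: "AE x in lebesgue. \<bar>u0 x\<bar> \<le> C"
    using assms(16) unfolding Linfty_def by blast
  obtain g where g [measurable]: "g \<in> borel_measurable borel" and u0g: "AE x in lborel. u0 x = g x"
    using lebesgue_borel_version[OF u0] by blast
  \<comment> \<open>A version of \<open>u0\<close> for which sign, bound and vanishing in
    \<open>H\<close> hold at every point, as \<open>killed_walk\<close> requires.\<close>
  define f0 where "f0 x = indicator (- H) x * max 0 (min \<bar>C\<bar> (g x))" for x
  have f0_meas: "f0 \<in> borel_measurable borel"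
    unfolding f0_def[abs_def] by measurable
  have u0f0: "AE x in lborel. u0 x = f0 x"
    using u0g assms(14,15)[unfolded AE_completion_iff] C[unfolded AE_completion_iff]
    by eventually_elim (auto simp: f0_def indicator_def)
  have sol: "exterior_solution J H f0 u"
  proof -
    have "AE x in lebesgue. u 0 x = u0 x"
      using assms(19) by (simp add: exterior_solution_def)
    then have "AE x in lebesgue. u 0 x = f0 x"
      using AE_completion[OF u0f0] by eventually_elim simp
    then show ?thesis
      using assms(19) by (simp add: exterior_solution_def)
  qed
  \<comment> \<open>Integrability of the datum is read off from the solution at time 0.\<close>
  have "integrable lebesgue (u 0)" "AE x in lborel. u 0 x = f0 x"
    using sol by (simp_all add: exterior_solution_def AE_completion_iff)
  then have f0_int: "integrable lborel f0"
    using integrable_borel_version[of "u 0" f0 "\<lambda>_. 1"] f0_meas by (simp add: borel_measurable_integrable)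
  have f0_mom: "integrable lborel (\<lambda>x. f0 x * (norm x)\<^sup>2)"
    using integrable_borel_version[OF u0 f0_meas u0f0, of "\<lambda>x. (norm x)\<^sup>2"] assms(18) by simp
  have f0_density: "nonneg_density f0 \<bar>C\<bar>"
    by standard (use f0_int in \<open>auto simp: f0_def indicator_def\<close>)
  interpret exterior_flow J d H f0 "\<bar>C\<bar>" u
  proof (intro exterior_flow.intro killed_walk.intro radial_kernel.intro
      exterior_flow_axioms.intro killed_walk_axioms.intro)
    show "continuous_on UNIV J" by (rule cont)
    show "radially_symmetric J" "0 < d" "ball 0 2 \<subseteq> H" by fact+
    show "0 < J x" if "norm x < d" for x using that by (rule assms(11))
    show "J x = 0" if "d \<le> norm x" for x using that by (rule assms(12))
    show "f0 x = 0" if "x \<in> H" for x using that by (simp add: f0_def)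
  qed (use total H f0_density f0_mom sol in simp_all)
  show ?thesis by (rule exterior_limits)
qed

end
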